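(* Let $n\ge 1$ and let $V$ be a simple left $K[C_n]$-module. Then one of the following holds: (i) $n=2s$ is even and $V$ is isomorphic to one of the modules $V(\lambda_1,\dots,\lambda_s)$ with $\lambda_1,\dots,\lambda_s\in K\setminus\{0\}$; or (ii) $xV=0$, where $x=a_i-\lambda$ for some $i\in\{1,\dots,n\}$ and $\lambda\in K$, or $x=\lambda a_j-\mu a_{j-1}$ for some $j\in\{2,\dots,n\}$ and $\lambda,\mu\in K$ not both equal to zero. In case (ii), $V$ may be treated as a simple left $K[C_{n-1}]$-module (so that its structure can be described inductively): for some $k\in\{1,\dots,n\}$, $V$ is simple as a module over $K[\langle a_l: l\ne k\rangle]$, where the submonoid $\langle a_l:l\neq k\rangle\subseteq C_n$ is a Chinese monoid of rank $n-1$.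
   Context: $K$ is a nondenumerable (uncountable) algebraically closed field. For a positive integer $n$, the Chinese monoid of rank $n$ is the monoid $C_n=\langle a_1,\dots,a_n\rangle$ given by the defining relations $a_ja_ka_i=a_ka_ja_i=a_ka_ia_j$ for all $i\le j\le k$ ($C_0$ is the trivial monoid); $K[C_n]$ is its monoid algebra. For $n=2s$, $s\ge1$, and nonzero $\lambda_1,\dots,\lambda_s\in K$, $V(\lambda_1,\dots,\lambda_s)$ denotes the left $K[C_n]$-module with $K$-basis $\{e_{i_1,\dots,i_s}: i_1,\dots,i_s\ge 0\}$ and action $$a_je_{i_1,\dots,i_s}=\begin{cases}\lambda_j e_{i_1,\dots,i_{j-1},i_j+1,\dots,i_s+1} & \text{if } j\le s,\\ e_{i_1,\dots,i_{n-j},i_{n-j+1}-1,\dots,i_s-1} & \text{if } j>s \text{ and } i_k>0 \text{ for all } k>n-j,\\ 0 & \text{if } j>s\text{ and } i_k=0 \text{ for some } k>n-j.\end{cases}$$ (For $j\le s$ all indices in positions $j,\dots,s$ are increased by one; for $j>s$ all indices in positions $n-j+1,\dots,s$ are decreased by one.) *)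

theory Defs
  imports
    "HOL-Algebra.Module"
    "HOL-Computational_Algebra.Polynomial"
    "HOL-Library.Countable_Set"
    "HOL.Hull"
begin

section \<open>Monoids given by generators and relations\<close>

text \<open>The least congruence on the free monoid of words over \<open>A\<close> that contains \<open>R\<close>.\<close>

inductive_set presented_cong :: "'a set \<Rightarrow> ('a list \<times> 'a list) set \<Rightarrow> ('a list \<times> 'a list) set"
  for A :: "'a set" and R :: "('a list \<times> 'a list) set" where
  pc_base: "(u, v) \<in> R \<Longrightarrow> u \<in> lists A \<Longrightarrow> v \<in> lists A \<Longrightarrow> (u, v) \<in> presented_cong A R"
| pc_refl: "u \<in> lists A \<Longrightarrow> (u, u) \<in> presented_cong A R"
| pc_sym: "(u, v) \<in> presented_cong A R \<Longrightarrow> (v, u) \<in> presented_cong A R"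
| pc_trans: "(u, v) \<in> presented_cong A R \<Longrightarrow> (v, w) \<in> presented_cong A R \<Longrightarrow>
    (u, w) \<in> presented_cong A R"
| pc_append: "(u, u') \<in> presented_cong A R \<Longrightarrow> (v, v') \<in> presented_cong A R \<Longrightarrow>
    (u @ v, u' @ v') \<in> presented_cong A R"

definition presented_monoid :: "'a set \<Rightarrow> ('a list \<times> 'a list) set \<Rightarrow> 'a list set monoid" where
  "presented_monoid A R = \<lparr>
     carrier = lists A // presented_cong A R,
     monoid.mult = (\<lambda>X Y. \<Union>u\<in>X. \<Union>v\<in>Y. presented_cong A R `` {u @ v}),
     one = presented_cong A R `` {[]}\<rparr>"

definition chinese_relations :: "nat \<Rightarrow> (nat list \<times> nat list) set" where
  "chinese_relations n =
     {([j, k, i], [k, j, i]) | i j k. 1 \<le> i \<and> i \<le> j \<and> j \<le> k \<and> k \<le> n} \<union>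
     {([k, j, i], [k, i, j]) | i j k. 1 \<le> i \<and> i \<le> j \<and> j \<le> k \<and> k \<le> n}"

definition chinese_monoid :: "nat \<Rightarrow> nat list set monoid" where
  "chinese_monoid n = presented_monoid {1..n} (chinese_relations n)"

definition chinese_gen :: "nat \<Rightarrow> nat \<Rightarrow> nat list set" where
  "chinese_gen n i = presented_cong {1..n} (chinese_relations n) `` {[i]}"

text \<open>The submonoid generated by all \<open>a\<^sub>l\<close> with \<open>l \<noteq> k\<close>, with the operations of \<open>C\<^sub>n\<close>.\<close>

definition chinese_submonoid :: "nat \<Rightarrow> nat \<Rightarrow> nat list set monoid" where
  "chinese_submonoid n k = (chinese_monoid n)
     \<lparr>carrier := (\<lambda>H. submonoid H (chinese_monoid n)) hull (chinese_gen n ` ({1..n} - {k}))\<rparr>"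

section \<open>Monoid algebras\<close>

text \<open>
  Elements are finitely supported functions vanishing outside \<open>carrier G\<close>. Hence for a
  submonoid \<open>H\<close> of \<open>G\<close> the algebra of \<open>G\<lparr>carrier := H\<rparr>\<close> is literally a subring of the
  algebra of \<open>G\<close>, and restriction of scalars leaves a module record unchanged.
\<close>

definition monoid_algebra :: "('m, 'z) monoid_scheme \<Rightarrow> ('m \<Rightarrow> 'k::comm_ring_1) ring" where
  "monoid_algebra G = \<lparr>
     carrier = {f. finite {x. f x \<noteq> 0} \<and> {x. f x \<noteq> 0} \<subseteq> carrier G},
     monoid.mult = (\<lambda>f g z. \<Sum>(x, y) | f x \<noteq> 0 \<and> g y \<noteq> 0 \<and> x \<otimes>\<^bsub>G\<^esub> y = z. f x * g y),
     one = (\<lambda>x. if x = \<one>\<^bsub>G\<^esub> then 1 else 0),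
     zero = (\<lambda>x. 0),
     add = (\<lambda>f g x. f x + g x)\<rparr>"

definition single :: "'m \<Rightarrow> 'k::zero \<Rightarrow> 'm \<Rightarrow> 'k" where
  "single m c = (\<lambda>x. if x = m then c else 0)"

abbreviation chinese_algebra :: "nat \<Rightarrow> (nat list set \<Rightarrow> 'k::comm_ring_1) ring" where
  "chinese_algebra n \<equiv> monoid_algebra (chinese_monoid n)"

section \<open>Left modules over noncommutative rings\<close>

text \<open>The locale \<^locale>\<open>module\<close> requires a commutative ring of scalars.\<close>

locale left_module = R?: ring R + M?: abelian_group M
  for R (structure) and M :: "('a, 'b, 'c) module_scheme" (structure) +
  assumes smult_closed [simp, intro]:
      "\<lbrakk>a \<in> carrier R; x \<in> carrier M\<rbrakk> \<Longrightarrow> a \<odot>\<^bsub>M\<^esub> x \<in> carrier M"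
    and smult_l_distr:
      "\<lbrakk>a \<in> carrier R; b \<in> carrier R; x \<in> carrier M\<rbrakk> \<Longrightarrow>
       (a \<oplus>\<^bsub>R\<^esub> b) \<odot>\<^bsub>M\<^esub> x = a \<odot>\<^bsub>M\<^esub> x \<oplus>\<^bsub>M\<^esub> b \<odot>\<^bsub>M\<^esub> x"
    and smult_r_distr:
      "\<lbrakk>a \<in> carrier R; x \<in> carrier M; y \<in> carrier M\<rbrakk> \<Longrightarrow>
       a \<odot>\<^bsub>M\<^esub> (x \<oplus>\<^bsub>M\<^esub> y) = a \<odot>\<^bsub>M\<^esub> x \<oplus>\<^bsub>M\<^esub> a \<odot>\<^bsub>M\<^esub> y"
    and smult_assoc:
      "\<lbrakk>a \<in> carrier R; b \<in> carrier R; x \<in> carrier M\<rbrakk> \<Longrightarrow>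
       (a \<otimes>\<^bsub>R\<^esub> b) \<odot>\<^bsub>M\<^esub> x = a \<odot>\<^bsub>M\<^esub> (b \<odot>\<^bsub>M\<^esub> x)"
    and smult_one [simp]:
      "x \<in> carrier M \<Longrightarrow> \<one>\<^bsub>R\<^esub> \<odot>\<^bsub>M\<^esub> x = x"

definition simple_left_module ::
    "('a, 'r) ring_scheme \<Rightarrow> ('a, 'b, 'c) module_scheme \<Rightarrow> bool" where
  "simple_left_module R M \<longleftrightarrow> left_module R M \<and> carrier M \<noteq> {\<zero>\<^bsub>M\<^esub>} \<and>
     (\<forall>N. submodule N R M \<longrightarrow> N = {\<zero>\<^bsub>M\<^esub>} \<or> N = carrier M)"

definition left_module_isomorphic ::
    "('a, 'r) ring_scheme \<Rightarrow> ('a, 'b, 'c) module_scheme \<Rightarrow> ('a, 'd, 'e) module_scheme \<Rightarrow> bool" where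
  "left_module_isomorphic R M N \<longleftrightarrow>
     (\<exists>h. bij_betw h (carrier M) (carrier N) \<and>
       (\<forall>x\<in>carrier M. \<forall>y\<in>carrier M. h (x \<oplus>\<^bsub>M\<^esub> y) = h x \<oplus>\<^bsub>N\<^esub> h y) \<and>
       (\<forall>a\<in>carrier R. \<forall>x\<in>carrier M. h (a \<odot>\<^bsub>M\<^esub> x) = a \<odot>\<^bsub>N\<^esub> h x))"

section \<open>The modules \<open>V(\<lambda>\<^sub>1, \<dots>, \<lambda>\<^sub>s)\<close> of \<open>K[C\<^sub>2\<^sub>s]\<close>\<close>

text \<open>
  A multi-index \<open>(i\<^sub>1, \<dots>, i\<^sub>s)\<close> is a function \<^typ>\<open>nat \<Rightarrow> nat\<close> that vanishes outside \<open>{1..s}\<close>; a vector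
  is the finitely supported function sending a multi-index to its coefficient. Likewise only
  the values of \<open>\<Lambda>\<close> on \<open>{1..s}\<close> matter.
\<close>

definition multi_indices :: "nat \<Rightarrow> (nat \<Rightarrow> nat) set" where
  "multi_indices s = {i. \<forall>k. k \<notin> {1..s} \<longrightarrow> i k = 0}"

definition raise_from :: "nat \<Rightarrow> nat \<Rightarrow> (nat \<Rightarrow> nat) \<Rightarrow> nat \<Rightarrow> nat" where
  "raise_from s a i = (\<lambda>k. if k \<in> {a..s} then i k + 1 else i k)"

definition lower_from :: "nat \<Rightarrow> nat \<Rightarrow> (nat \<Rightarrow> nat) \<Rightarrow> nat \<Rightarrow> nat" where
  "lower_from s a i = (\<lambda>k. if k \<in> {a..s} then i k - 1 else i k)"

definition positive_from :: "nat \<Rightarrow> nat \<Rightarrow> (nat \<Rightarrow> nat) \<Rightarrow> bool" where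
  "positive_from s a i \<longleftrightarrow> (\<forall>k\<in>{a..s}. i k > 0)"

text \<open>The coefficient function of \<open>a\<^sub>j e\<^sub>i\<close> and its linear extension.\<close>

definition V_gen_basis ::
    "nat \<Rightarrow> (nat \<Rightarrow> 'k::comm_ring_1) \<Rightarrow> nat \<Rightarrow> (nat \<Rightarrow> nat) \<Rightarrow> (nat \<Rightarrow> nat) \<Rightarrow> 'k" where
  "V_gen_basis s \<Lambda> j i =
     (if j \<le> s then single (raise_from s j i) (\<Lambda> j)
      else if positive_from s (2 * s - j + 1) i then single (lower_from s (2 * s - j + 1) i) 1
      else (\<lambda>x. 0))"

definition V_gen ::
    "nat \<Rightarrow> (nat \<Rightarrow> 'k::comm_ring_1) \<Rightarrow> nat \<Rightarrow> ((nat \<Rightarrow> nat) \<Rightarrow> 'k) \<Rightarrow> (nat \<Rightarrow> nat) \<Rightarrow> 'k" where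
  "V_gen s \<Lambda> j v = (\<lambda>x. \<Sum>i | v i \<noteq> 0. v i * V_gen_basis s \<Lambda> j i x)"

definition V_word ::
    "nat \<Rightarrow> (nat \<Rightarrow> 'k::comm_ring_1) \<Rightarrow> nat list \<Rightarrow> ((nat \<Rightarrow> nat) \<Rightarrow> 'k) \<Rightarrow> (nat \<Rightarrow> nat) \<Rightarrow> 'k" where
  "V_word s \<Lambda> w = foldr (V_gen s \<Lambda>) w"

text \<open>
  An element of \<open>C\<^sub>2\<^sub>s\<close> acts through any of its representing words; see \<open>V_word_cong\<close> below
  for the independence of the choice.
\<close>

definition V_module ::
    "nat \<Rightarrow> (nat \<Rightarrow> 'k::comm_ring_1) \<Rightarrow>
      (nat list set \<Rightarrow> 'k, (nat \<Rightarrow> nat) \<Rightarrow> 'k) module" where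
  "V_module s \<Lambda> = \<lparr>
     carrier = {v. finite {i. v i \<noteq> 0} \<and> {i. v i \<noteq> 0} \<subseteq> multi_indices s},
     monoid.mult = undefined,
     one = undefined,
     zero = (\<lambda>i. 0),
     add = (\<lambda>v w i. v i + w i),
     module.smult = (\<lambda>f v i. \<Sum>m | f m \<noteq> 0. f m * V_word s \<Lambda> (SOME w. w \<in> m) v i)\<rparr>"

lemma V_gen_finite_support:
  assumes "finite {i. v i \<noteq> 0}"
  shows "finite {x. V_gen s \<Lambda> j v x \<noteq> 0}"
proof -
  have "{x. V_gen s \<Lambda> j v x \<noteq> 0} \<subseteq> (\<Union>i\<in>{i. v i \<noteq> 0}. {x. V_gen_basis s \<Lambda> j i x \<noteq> 0})"
    unfolding V_gen_def by (auto elim!: sum.not_neutral_contains_not_neutral)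
  moreover have "finite {x. V_gen_basis s \<Lambda> j i x \<noteq> 0}" for i
    by (auto simp: V_gen_basis_def single_def)
  ultimately show ?thesis
    using assms by (meson finite_UN_I finite_subset)
qed

lemma V_word_finite_support:
  "finite {i. v i \<noteq> 0} \<Longrightarrow> finite {x. V_word s \<Lambda> w v x \<noteq> 0}"
  by (induction w) (auto simp: V_word_def intro: V_gen_finite_support)

lemma V_gen_superset:
  assumes "finite A" "{i. v i \<noteq> 0} \<subseteq> A"
  shows "V_gen s \<Lambda> j v x = (\<Sum>i\<in>A. v i * V_gen_basis s \<Lambda> j i x)"
  unfolding V_gen_def using assms by (intro sum.mono_neutral_left) auto

lemma V_gen_zero: "V_gen s \<Lambda> j (\<lambda>x. 0) = (\<lambda>x. 0)"
  by (simp add: V_gen_def)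

lemma V_gen_single: "V_gen s \<Lambda> j (single i c) = (\<lambda>x. c * V_gen_basis s \<Lambda> j i x)"
  by (rule ext, subst V_gen_superset[where A = "{i}"]) (auto simp: single_def)

lemma V_gen_sum:
  assumes "finite I" "\<And>p. p \<in> I \<Longrightarrow> finite {i. f p i \<noteq> 0}"
  shows "V_gen s \<Lambda> j (\<lambda>i. \<Sum>p\<in>I. c p * f p i) = (\<lambda>x. \<Sum>p\<in>I. c p * V_gen s \<Lambda> j (f p) x)"
proof
  fix x
  define A where "A = (\<Union>p\<in>I. {i. f p i \<noteq> 0})"
  have A: "finite A" unfolding A_def using assms by auto
  have "{i. (\<Sum>p\<in>I. c p * f p i) \<noteq> 0} \<subseteq> A"
    unfolding A_def by (auto elim!: sum.not_neutral_contains_not_neutral)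
  then have "V_gen s \<Lambda> j (\<lambda>i. \<Sum>p\<in>I. c p * f p i) x =
      (\<Sum>i\<in>A. (\<Sum>p\<in>I. c p * f p i) * V_gen_basis s \<Lambda> j i x)"
    using A by (rule V_gen_superset[rotated])
  also have "\<dots> = (\<Sum>p\<in>I. \<Sum>i\<in>A. c p * f p i * V_gen_basis s \<Lambda> j i x)"
    by (simp add: sum_distrib_right) (rule sum.swap)
  also have "\<dots> = (\<Sum>p\<in>I. c p * V_gen s \<Lambda> j (f p) x)"
  proof (rule sum.cong)
    fix p assume "p \<in> I"
    then have "V_gen s \<Lambda> j (f p) x = (\<Sum>i\<in>A. f p i * V_gen_basis s \<Lambda> j i x)"
      using A by (intro V_gen_superset) (auto simp: A_def)
    then show "(\<Sum>i\<in>A. c p * f p i * V_gen_basis s \<Lambda> j i x) = c p * V_gen s \<Lambda> j (f p) x"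
      by (simp add: sum_distrib_left mult.assoc)
  qed simp
  finally show "V_gen s \<Lambda> j (\<lambda>i. \<Sum>p\<in>I. c p * f p i) x = (\<Sum>p\<in>I. c p * V_gen s \<Lambda> j (f p) x)" .
qed

lemma V_word_sum:
  assumes "finite I" "\<And>p. p \<in> I \<Longrightarrow> finite {i. f p i \<noteq> 0}"
  shows "V_word s \<Lambda> w (\<lambda>i. \<Sum>p\<in>I. c p * f p i) = (\<lambda>x. \<Sum>p\<in>I. c p * V_word s \<Lambda> w (f p) x)"
proof (induction w)
  case (Cons j w)
  have "V_gen s \<Lambda> j (\<lambda>i. \<Sum>p\<in>I. c p * V_word s \<Lambda> w (f p) i) =
      (\<lambda>x. \<Sum>p\<in>I. c p * V_gen s \<Lambda> j (V_word s \<Lambda> w (f p)) x)"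
    using assms by (intro V_gen_sum V_word_finite_support)
  with Cons show ?case by (simp add: V_word_def)
qed (simp add: V_word_def)

lemma V_word_basis_expansion:
  fixes v :: "(nat \<Rightarrow> nat) \<Rightarrow> 'k::comm_ring_1"
  assumes "finite {i. v i \<noteq> 0}"
  shows "V_word s \<Lambda> w v = (\<lambda>x. \<Sum>p | v p \<noteq> 0. v p * V_word s \<Lambda> w (single p 1) x)"
proof -
  have "v = (\<lambda>i. \<Sum>p | v p \<noteq> 0. v p * single p 1 i)"
  proof
    fix i
    show "v i = (\<Sum>p | v p \<noteq> 0. v p * single p 1 i)"
      using assms by (cases "v i = 0") (auto simp: single_def if_distrib sum.delta' cong: if_cong)
  qed
  then have "V_word s \<Lambda> w v = V_word s \<Lambda> w (\<lambda>i. \<Sum>p | v p \<noteq> 0. v p * single p 1 i)"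
    by simp
  also have "\<dots> = (\<lambda>x. \<Sum>p | v p \<noteq> 0. v p * V_word s \<Lambda> w (single p 1) x)"
    using assms by (intro V_word_sum) (auto simp: single_def)
  finally show ?thesis .
qed

lemma V_gen_single_up:
  assumes "j \<le> s"
  shows "V_gen s \<Lambda> j (single i c) = single (raise_from s j i) (c * \<Lambda> j)"
  unfolding V_gen_single using assms by (auto simp: V_gen_basis_def single_def)

lemma V_gen_single_down:
  assumes "\<not> j \<le> s"
  shows "V_gen s \<Lambda> j (single i c) =
    (if positive_from s (2 * s - j + 1) i then single (lower_from s (2 * s - j + 1) i) c
     else (\<lambda>x. 0))"
  unfolding V_gen_single using assms by (auto simp: V_gen_basis_def single_def)

lemma raise_raise: "raise_from s a (raise_from s b p) = raise_from s b (raise_from s a p)"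
  by (auto simp: raise_from_def)

lemma lower_lower: "lower_from s a (lower_from s b p) = lower_from s b (lower_from s a p)"
  by (auto simp: lower_from_def)

lemma raise_lower:
  "positive_from s b p \<Longrightarrow> lower_from s b (raise_from s a p) = raise_from s a (lower_from s b p)"
  by (auto simp: raise_from_def lower_from_def positive_from_def)

lemma positive_raise: "positive_from s a p \<Longrightarrow> positive_from s a (raise_from s b p)"
  by (auto simp: raise_from_def positive_from_def)

lemma positive_raise_raise:
  "i \<le> j \<Longrightarrow> positive_from s a (raise_from s j (raise_from s i p)) \<longleftrightarrow>
    positive_from s a (raise_from s i p)"
  by (auto simp: raise_from_def positive_from_def)

lemma positive_lower:
  assumes "a \<le> b"
  shows "positive_from s b p \<and> positive_from s a (lower_from s b p) \<longleftrightarrow>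
    positive_from s a p \<and> positive_from s b (lower_from s a p)"
proof -
  have "{b..s} \<subseteq> {a..s}" using assms by simp
  then have "positive_from s b p \<and> positive_from s a (lower_from s b p) \<longleftrightarrow>
      (\<forall>k\<in>{a..s}. (k \<in> {b..s} \<longrightarrow> p k > 0) \<and> (if k \<in> {b..s} then p k - 1 else p k) > 0)"
    unfolding positive_from_def lower_from_def by blast
  also have "\<dots> \<longleftrightarrow> (\<forall>k\<in>{a..s}. p k > 0 \<and> (k \<in> {b..s} \<longrightarrow> p k - 1 > 0))"
    by (rule ball_cong[OF refl]) simp
  also have "\<dots> \<longleftrightarrow> positive_from s a p \<and> positive_from s b (lower_from s a p)"
  proof -
    have "positive_from s b (lower_from s a p) \<longleftrightarrow> (\<forall>k\<in>{b..s}. p k - 1 > 0)"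
      using \<open>{b..s} \<subseteq> {a..s}\<close> unfolding positive_from_def lower_from_def
      by (intro ball_cong) auto
    then show ?thesis
      using \<open>{b..s} \<subseteq> {a..s}\<close> unfolding positive_from_def by blast
  qed
  finally show ?thesis .
qed

lemma not_positive_lower_raise:
  assumes "a \<le> b" "positive_from s b (raise_from s i p)" "\<not> positive_from s b p"
  shows "\<not> positive_from s a (lower_from s b (raise_from s i p))"
proof -
  obtain l where l: "l \<in> {b..s}" "p l = 0"
    using assms(3) by (auto simp: positive_from_def)
  then have "lower_from s b (raise_from s i p) l = 0"
    by (auto simp: lower_from_def raise_from_def)
  moreover have "l \<in> {a..s}" using l assms(1) by simp
  ultimately show ?thesis unfolding positive_from_def by (metis less_irrefl)
qed

lemma V_gen_up_commute:
  assumes "i \<le> s" "j \<le> s"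
  shows "V_gen s \<Lambda> i (V_gen s \<Lambda> j (single p c)) = V_gen s \<Lambda> j (V_gen s \<Lambda> i (single p c))"
  using assms by (simp add: V_gen_single_up raise_raise[of s i j] mult_ac)

lemma V_gen_down_commute_le:
  assumes "j \<le> k" "\<not> j \<le> s" "\<not> k \<le> s"
  shows "V_gen s \<Lambda> j (V_gen s \<Lambda> k (single p c)) = V_gen s \<Lambda> k (V_gen s \<Lambda> j (single p c))"
proof -
  have "2 * s - k + 1 \<le> 2 * s - j + 1" using assms by simp
  from positive_lower[OF this, of s p] show ?thesis
    by (auto simp: V_gen_single_down assms(2,3) V_gen_zero lower_lower[of s "Suc (2 * s - k)"])
qed

lemma V_gen_down_commute:
  assumes "\<not> j \<le> s" "\<not> k \<le> s"
  shows "V_gen s \<Lambda> j (V_gen s \<Lambda> k (single p c)) = V_gen s \<Lambda> k (V_gen s \<Lambda> j (single p c))"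
  using V_gen_down_commute_le[of j k] V_gen_down_commute_le[of k j] assms by (metis linear)

lemma V_gen_up_down:
  assumes "i \<le> j" "j \<le> s" "\<not> k \<le> s"
  shows "V_gen s \<Lambda> j (V_gen s \<Lambda> k (V_gen s \<Lambda> i (single p c))) =
    V_gen s \<Lambda> k (V_gen s \<Lambda> j (V_gen s \<Lambda> i (single p c)))"
proof -
  have i: "i \<le> s" using assms by simp
  show ?thesis
    by (simp add: V_gen_single_up i assms(2) V_gen_single_down[OF assms(3)] V_gen_zero raise_lower
        positive_raise_raise[OF assms(1)])
qed

lemma V_gen_down_down_up:
  assumes "j \<le> k" "i \<le> s" "\<not> j \<le> s"
  shows "V_gen s \<Lambda> k (V_gen s \<Lambda> j (V_gen s \<Lambda> i (single p c))) =
    V_gen s \<Lambda> k (V_gen s \<Lambda> i (V_gen s \<Lambda> j (single p c)))"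
proof -
  have k: "\<not> k \<le> s" using assms by simp
  have "2 * s - k + 1 \<le> 2 * s - j + 1" using assms by simp
  note N = not_positive_lower_raise[OF this]
  show ?thesis
  proof (cases "positive_from s (2 * s - j + 1) p")
    case True
    then show ?thesis
      by (simp add: V_gen_single_up assms(2) V_gen_single_down[OF assms(3)] raise_lower positive_raise)
  next
    case False
    then show ?thesis using N[of s i p]
      by (simp add: V_gen_single_up assms(2) V_gen_single_down[OF assms(3)]
          V_gen_single_down[OF k] V_gen_zero)
  qed
qed

lemma V_gen_single_cases:
  obtains q d where "V_gen s \<Lambda> j (single p c) = single q d" | "V_gen s \<Lambda> j (single p c) = (\<lambda>x. 0)"
  using V_gen_single_up[of j s] V_gen_single_down[of j s] by (metis (full_types))

lemma V_word_relations_single: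
  assumes "(u, v) \<in> chinese_relations (2 * s)"
  shows "V_word s \<Lambda> u (single p c) = V_word s \<Lambda> v (single p c)"
proof -
  from assms obtain i j k where ijk: "i \<le> j" "j \<le> k"
    and uv: "u = [j, k, i] \<and> v = [k, j, i] \<or> u = [k, j, i] \<and> v = [k, i, j]"
    unfolding chinese_relations_def by blast
  have "V_word s \<Lambda> [j, k, i] (single p c) = V_word s \<Lambda> [k, j, i] (single p c)"
  proof -
    consider "k \<le> s" | "j \<le> s" "\<not> k \<le> s" | "\<not> j \<le> s" by linarith
    then show ?thesis
    proof cases
      case 1
      with ijk show ?thesis
        by (cases rule: V_gen_single_cases[of s \<Lambda> i p c])
          (simp_all add: V_word_def V_gen_zero V_gen_up_commute[of j s k])
    next
      case 2
      with ijk show ?thesis using V_gen_up_down[of i j s k] by (simp add: V_word_def)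
    next
      case 3
      with ijk show ?thesis
        by (cases rule: V_gen_single_cases[of s \<Lambda> i p c])
          (simp_all add: V_word_def V_gen_zero V_gen_down_commute[of j s k])
    qed
  qed
  moreover have "V_word s \<Lambda> [k, j, i] (single p c) = V_word s \<Lambda> [k, i, j] (single p c)"
  proof -
    consider "j \<le> s" | "i \<le> s" "\<not> j \<le> s" | "\<not> i \<le> s" by linarith
    then show ?thesis
    proof cases
      case 1
      with ijk show ?thesis by (simp add: V_word_def V_gen_up_commute[of j s i])
    next
      case 2
      with ijk show ?thesis by (simp add: V_word_def V_gen_down_down_up)
    next
      case 3
      with ijk show ?thesis by (simp add: V_word_def V_gen_down_commute[of j s i])
    qed
  qed
  ultimately show ?thesis using uv by auto
qed

lemma V_word_append: "V_word s \<Lambda> (u @ w) v = V_word s \<Lambda> u (V_word s \<Lambda> w v)"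
  by (simp add: V_word_def)

lemma V_word_cong:
  fixes v :: "(nat \<Rightarrow> nat) \<Rightarrow> 'k::comm_ring_1"
  assumes "(u, w) \<in> presented_cong {1..2 * s} (chinese_relations (2 * s))"
    and "finite {i. v i \<noteq> 0}"
  shows "V_word s \<Lambda> u v = V_word s \<Lambda> w v"
  using assms
proof (induction arbitrary: v)
  case (pc_base u w)
  then show ?case
    by (simp add: V_word_basis_expansion V_word_relations_single)
next
  case (pc_append u u' w w')
  then show ?case
    by (simp add: V_word_append V_word_finite_support)
qed simp_all

section \<open>The exceptional elements of \<open>K[C\<^sub>n]\<close>\<close>

definition exceptional_elements :: "nat \<Rightarrow> (nat list set \<Rightarrow> 'k::comm_ring_1) set" where
  "exceptional_elements n =
     {single (chinese_gen n i) 1 \<ominus>\<^bsub>chinese_algebra n\<^esub> single \<one>\<^bsub>chinese_monoid n\<^esub> c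
       | i c. i \<in> {1..n}} \<union>
     {single (chinese_gen n j) c \<ominus>\<^bsub>chinese_algebra n\<^esub> single (chinese_gen n (j - 1)) d
       | j c d. j \<in> {2..n} \<and> (c, d) \<noteq> (0, 0)}"

end

theory Submission
  imports Defs "HOL-Algebra.Subrings" "HOL-Library.Function_Algebras"
begin

text \<open>
  Let \<open>a\<^sub>1, \<dots>, a\<^sub>n\<close> be the operators by which the generators act on the simple module \<open>V\<close>.  As \<open>V\<close> has
  countable dimension over the uncountable field, an operator that commutes with all of them is a
  scalar (\<open>schur_uncountable\<close>).  The proof peels off the generators in pairs from the outside: it
  considers operators \<open>a\<^sub>l, \<dots>, a\<^sub>r\<close> that satisfy the Chinese relations and act irreducibly on a space
  \<open>U\<close>, and calls them exceptional if some \<open>a\<^sub>i\<close> is a scalar or two neighbours \<open>a\<^sub>j\<^sub>-\<^sub>1, a\<^sub>j\<close> are linearly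
  dependent on \<open>U\<close>.

  The product \<open>a\<^sub>r a\<^sub>l\<close> is central, hence a scalar \<open>\<lambda>\<close>.  If \<open>\<lambda> = 0\<close>, then \<open>a\<^sub>r\<close> kills the whole ideal
  generated by \<open>a\<^sub>l\<close>, so one of the two operators is zero.  If \<open>\<lambda> \<noteq> 0\<close>, put \<open>x = a\<^sub>l\<close> and
  \<open>y = \<lambda>\<^sup>-\<^sup>1 a\<^sub>r\<close>, so that \<open>y x = 1\<close>.  The relations give \<open>y a\<^sub>j x = a\<^sub>j\<close>: the other generators are
  Toeplitz operators for the shift \<open>x\<close>.  With \<open>E = ker y\<close> the space \<open>U\<close> is spanned by the \<open>x\<^sup>k E\<close>, and
  each inner \<open>a\<^sub>j\<close> is given by a tridiagonal symbol \<open>A\<^sub>j + x B\<^sub>j + C\<^sub>j y\<close> with operators \<open>A\<^sub>j, B\<^sub>j, C\<^sub>j\<close> on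
  \<open>E\<close>.  The Chinese relations become quadratic relations between these coefficients
  (\<open>toeplitz_coefficients\<close>), which allow products to be written with the \<open>C\<close>'s on the left, the \<open>A\<close>'s
  in the middle and the \<open>B\<close>'s on the right.  So \<open>E\<close> has the structure of a highest weight module: it is
  generated by means of the \<open>C\<close>'s from \<open>W = \<Inter> ker B\<^sub>i\<close>.  On \<open>W\<close> the inner \<open>a\<^sub>j\<close> act as \<open>A\<^sub>j\<close>, and they
  do so irreducibly (\<open>W_irreducible\<close>); this makes an induction on \<open>r - l\<close> possible.  Both possible
  outcomes on \<open>W\<close> propagate to \<open>U\<close>: an exceptional relation (\<open>inner_exceptional_lifts\<close>), and the
  property that every product \<open>a\<^sub>t a\<^sub>q\<close> with \<open>q < t\<close> and \<open>q + t = l + r\<close> is a nonzero scalar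
  (\<open>inner_arcs_lift\<close>).  In the second case there is also a vacuum vector that these \<open>a\<^sub>t\<close> annihilate.

  So if \<open>V\<close> is not exceptional, then \<open>n = 2s\<close> and \<open>a\<^bsub>n+1-q\<^esub> a\<^sub>q = \<lambda>\<^sub>q\<close> for \<open>q \<le> s\<close>
  (\<open>nested_arcs_or_exceptional\<close>).  Suitable products of generators then form \<open>s\<close> pairs
  \<open>up k, down k\<close> with \<open>down k up k = 1\<close>, different pairs commuting, and the monomials in the \<open>up k\<close>
  applied to the vacuum form the basis of \<open>V(\<lambda>\<^sub>1, \<dots>, \<lambda>\<^sub>s)\<close> (\<open>isomorphic_V_module\<close>).  If \<open>V\<close> is
  exceptional, some generator acts as a scalar multiple of a word in the others, so it can be dropped
  without losing simplicity (\<open>simple_over_submonoid\<close>); the remaining generators generate a Chinese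
  monoid because a monotone relabelling of generators respects the defining relations
  (\<open>chinese_submonoid_iso\<close>).
\<close>

section \<open>Irreducible families of operators and Schur's lemma\<close>

locale uncountable_vector_space = vector_space scale
  for scale :: "'a::alg_closed_field \<Rightarrow> 'b::ab_group_add \<Rightarrow> 'b" (infixr \<open>*s\<close> 75) +
  assumes uncountable_scalars: "uncountable (UNIV :: 'a set)"
begin

abbreviation lin :: "('b \<Rightarrow> 'b) \<Rightarrow> bool" where
  "lin f \<equiv> Vector_Spaces.linear scale scale f"

lemma lin_iff: "lin f \<longleftrightarrow> (\<forall>x y. f (x + y) = f x + f y) \<and> (\<forall>c x. f (c *s x) = c *s f x)"
  using vector_space_axioms by (auto simp: Vector_Spaces.linear_iff)

lemma linI: "(\<And>x y. f (x + y) = f x + f y) \<Longrightarrow> (\<And>c x. f (c *s x) = c *s f x) \<Longrightarrow> lin f"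
  by (simp add: lin_iff)

lemma lin_module_hom: "lin f \<Longrightarrow> module_hom scale scale f"
  by (simp add: module_hom_iff_linear)

lemma lin_add: "lin f \<Longrightarrow> f (x + y) = f x + f y"
  by (simp add: lin_iff)

lemma lin_scale: "lin f \<Longrightarrow> f (c *s x) = c *s f x"
  by (simp add: lin_iff)

lemma lin_zero: "lin f \<Longrightarrow> f 0 = 0"
  using lin_module_hom module_hom.zero by blast

lemma lin_diff: "lin f \<Longrightarrow> f (x - y) = f x - f y"
  using lin_module_hom module_hom.diff by blast

lemma lin_neg: "lin f \<Longrightarrow> f (- x) = - f x"
  using lin_module_hom module_hom.neg by blast

lemma lin_sum: "lin f \<Longrightarrow> f (sum g S) = (\<Sum>i\<in>S. f (g i))"
  using lin_module_hom module_hom.sum by blast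

lemmas lin_simps = lin_add lin_scale lin_zero lin_diff lin_neg

lemma lin_comp: "lin f \<Longrightarrow> lin g \<Longrightarrow> lin (\<lambda>v. f (g v))"
  by (simp add: lin_iff)

lemma subspace_vimage: "lin f \<Longrightarrow> subspace N \<Longrightarrow> subspace {v. f v \<in> N}"
  by (auto simp: subspace_def lin_simps)

lemma subspace_kernel: "lin f \<Longrightarrow> subspace {v. f v = 0}"
  by (auto simp: subspace_def lin_simps)

lemma subspace_equalizer: "lin f \<Longrightarrow> lin g \<Longrightarrow> subspace {v. f v = g v}"
  by (auto simp: subspace_def lin_simps)

lemma lin_scaled: "lin f \<Longrightarrow> lin (\<lambda>v. c *s f v)"
  by (auto simp: lin_iff scale_right_distrib mult.commute)

lemma lin_ident: "lin (\<lambda>v. v)"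
  by (simp add: lin_iff)

lemma lin_minus: "lin f \<Longrightarrow> lin g \<Longrightarrow> lin (\<lambda>v. f v - g v)"
  by (simp add: lin_iff scale_right_diff_distrib)

lemma subspace_Collect_conj:
  "subspace U \<Longrightarrow> subspace {v. P v} \<Longrightarrow> subspace {v \<in> U. P v}"
  by (simp add: subspace_def)

lemma subspace_Collect_ball:
  "(\<And>i. i \<in> I \<Longrightarrow> subspace {v. P i v}) \<Longrightarrow> subspace {v. \<forall>i\<in>I. P i v}"
  by (simp add: subspace_def)

lemma subspace_image: "lin f \<Longrightarrow> subspace N \<Longrightarrow> subspace (f ` N)"
  using lin_module_hom module_hom.subspace_image by blast

definition irreducible_on :: "('b \<Rightarrow> 'b) set \<Rightarrow> 'b set \<Rightarrow> bool" where
  "irreducible_on F U \<longleftrightarrow> subspace U \<and> (\<exists>v\<in>U. v \<noteq> 0) \<and> (\<forall>f\<in>F. \<forall>v\<in>U. f v \<in> U) \<and>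
     (\<forall>N. subspace N \<longrightarrow> N \<subseteq> U \<longrightarrow> (\<forall>f\<in>F. \<forall>v\<in>N. f v \<in> N) \<longrightarrow> N \<subseteq> {0} \<or> N = U)"

lemma irreducible_onD:
  assumes "irreducible_on F U" "subspace N" "N \<subseteq> U" "\<And>f v. f \<in> F \<Longrightarrow> v \<in> N \<Longrightarrow> f v \<in> N"
    and "v \<in> N" "v \<noteq> 0"
  shows "N = U"
  using assms unfolding irreducible_on_def by blast

text \<open>
  Each of the countably many finite subsets of \<open>S\<close> spans a space that contains only finitely many
  elements of \<open>I\<close>.
\<close>

lemma countable_independent_subset_span:
  assumes "countable S" "independent I" "I \<subseteq> span S"
  shows "countable I"
proof -
  have "I \<subseteq> (\<Union>T\<in>{T. T \<subseteq> S \<and> finite T}. I \<inter> span T)"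
  proof
    fix v assume "v \<in> I"
    then have "v \<in> span S" using assms by blast
    then obtain T where "finite T" "T \<subseteq> S" "v \<in> span T"
      unfolding span_explicit by (auto intro!: span_sum span_scale span_base)
    then show "v \<in> (\<Union>T\<in>{T. T \<subseteq> S \<and> finite T}. I \<inter> span T)"
      using \<open>v \<in> I\<close> by blast
  qed
  moreover have "countable (\<Union>T\<in>{T. T \<subseteq> S \<and> finite T}. I \<inter> span T)"
  proof (rule countable_UN)
    show "countable {T. T \<subseteq> S \<and> finite T}"
      using countable_Collect_finite_subset[OF assms(1)] by (simp add: conj_commute)
    fix T assume "T \<in> {T. T \<subseteq> S \<and> finite T}"
    then have "finite (I \<inter> span T)"
      using independent_span_bound[of T "I \<inter> span T"]
        independent_mono[OF assms(2), of "I \<inter> span T"] by auto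
    then show "countable (I \<inter> span T)" by (rule countable_finite)
  qed
  ultimately show ?thesis by (rule countable_subset)
qed

lemma irreducible_on_countable_span:
  assumes "irreducible_on F U" "countable F" "\<And>f. f \<in> F \<Longrightarrow> lin f"
  obtains S where "countable S" "span S = U"
proof -
  from assms(1) obtain v where v: "v \<in> U" "v \<noteq> 0" unfolding irreducible_on_def by blast
  define S where "S = (\<lambda>fs. foldr (\<lambda>f. f) fs v) ` lists F"
  have U: "subspace U" "\<And>f u. f \<in> F \<Longrightarrow> u \<in> U \<Longrightarrow> f u \<in> U"
    using assms(1) unfolding irreducible_on_def by auto
  have "foldr (\<lambda>f. f) fs v \<in> U" if "fs \<in> lists F" for fs
    using that by (induction fs) (auto simp: v U)
  then have "S \<subseteq> U" unfolding S_def by blast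
  then have SU: "span S \<subseteq> U" using U(1) by (rule span_minimal)
  have inv: "f u \<in> span S" if "f \<in> F" "u \<in> span S" for f u
  proof -
    have "f ` S \<subseteq> S"
    proof
      fix y assume "y \<in> f ` S"
      then obtain fs where "fs \<in> lists F" "y = foldr (\<lambda>f. f) (f # fs) v" unfolding S_def by auto
      moreover have "f # fs \<in> lists F" using that \<open>fs \<in> lists F\<close> by simp
      ultimately show "y \<in> S" unfolding S_def by blast
    qed
    then have "f ` span S \<subseteq> span S"
      using module_hom.span_image[OF lin_module_hom[OF assms(3)[OF that(1)]], of S] span_mono
      by metis
    then show ?thesis using that(2) by blast
  qed
  have "v = foldr (\<lambda>f. f) [] v" by simp
  then have "v \<in> S" unfolding S_def using lists.Nil by blast
  then have "v \<in> span S" by (rule span_base)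
  with inv v(2) have "span S = U"
    using irreducible_onD[OF assms(1) subspace_span SU] by blast
  moreover have "countable S" unfolding S_def using assms(2) by simp
  ultimately show ?thesis using that by blast
qed

text \<open>The vector \<open>p(T) u\<close>, by Horner's scheme.\<close>

definition poly_apply :: "('b \<Rightarrow> 'b) \<Rightarrow> 'a poly \<Rightarrow> 'b \<Rightarrow> 'b" where
  "poly_apply T p u = fold_coeffs (\<lambda>a w. a *s u + T w) p 0"

context
  fixes T :: "'b \<Rightarrow> 'b"
  assumes T: "lin T"
begin

lemma poly_apply_0 [simp]: "poly_apply T 0 u = 0"
  by (simp add: poly_apply_def)

lemma poly_apply_pCons [simp]: "poly_apply T (pCons a p) u = a *s u + T (poly_apply T p u)"
  unfolding poly_apply_def by (cases "a = 0 \<and> p = 0") (auto simp: lin_zero[OF T])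

lemma poly_apply_smult: "poly_apply T (Polynomial.smult c p) u = c *s poly_apply T p u"
  by (induction p) (auto simp: lin_simps[OF T] scale_right_distrib)

lemma poly_apply_add: "poly_apply T (p + q) u = poly_apply T p u + poly_apply T q u"
  by (induction p q rule: poly_induct2)
    (auto simp: lin_simps[OF T] scale_left_distrib algebra_simps)

lemma poly_apply_mult: "poly_apply T (p * q) u = poly_apply T p (poly_apply T q u)"
  by (induction p) (auto simp: poly_apply_add poly_apply_smult)

lemma poly_apply_sum: "poly_apply T (sum f S) u = (\<Sum>i\<in>S. poly_apply T (f i) u)"
  by (induction S rule: infinite_finite_induct) (auto simp: poly_apply_add)

lemma lin_poly_apply: "lin (poly_apply T p)"
proof (rule linI)
  show "poly_apply T p (x + y) = poly_apply T p x + poly_apply T p y" for x y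
    by (induction p) (auto simp: lin_simps[OF T] scale_right_distrib algebra_simps)
  show "poly_apply T p (c *s x) = c *s poly_apply T p x" for c x
    by (induction p) (auto simp: lin_simps[OF T] scale_right_distrib mult.commute)
qed

end

text \<open>
  If \<open>T - c\<close> were invertible on \<open>U\<close> for every scalar \<open>c\<close>, then the vectors \<open>(T - c)\<^sup>-\<^sup>1 v\<close> would be
  linearly independent: clearing denominators in a relation between them gives a nonzero polynomial
  \<open>q\<close> with \<open>q(T) v = 0\<close>, and \<open>q(T)\<close> is a product of injective factors \<open>T - c\<close>.  But \<open>U\<close> has
  countable dimension, and there are uncountably many scalars.
\<close>

lemma schur_uncountable:
  fixes F :: "('b \<Rightarrow> 'b) set"
  assumes irr: "irreducible_on F U" and F: "countable F" "\<And>f. f \<in> F \<Longrightarrow> lin f"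
    and T: "lin T" "\<And>v. v \<in> U \<Longrightarrow> T v \<in> U"
    and comm: "\<And>f v. f \<in> F \<Longrightarrow> v \<in> U \<Longrightarrow> T (f v) = f (T v)"
  shows "\<exists>c. \<forall>v\<in>U. T v = c *s v"
proof (rule ccontr)
  assume no: "\<not> ?thesis"
  from irr obtain v where v: "v \<in> U" "v \<noteq> 0" unfolding irreducible_on_def by blast
  have U: "subspace U" and FU: "\<And>f u. f \<in> F \<Longrightarrow> u \<in> U \<Longrightarrow> f u \<in> U"
    using irr unfolding irreducible_on_def by auto
  define D where "D c u = T u - c *s u" for c u
  have D: "lin (D c)" for c
    unfolding D_def by (intro lin_minus T lin_scaled lin_ident)
  have DU: "D c u \<in> U" if "u \<in> U" for c u
    unfolding D_def using that T U by (simp add: subspace_diff subspace_scale)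
  have Dcomm: "D c (f u) = f (D c u)" if "f \<in> F" "u \<in> U" for c f u
    unfolding D_def using that comm F(2) by (simp add: lin_diff lin_scale)
  have inj: "u = 0" if "u \<in> U" "D c u = 0" for c u
  proof (rule ccontr)
    assume "u \<noteq> 0"
    have "{u \<in> U. D c u = 0} = U"
    proof (rule irreducible_onD[OF irr])
      show "subspace {u \<in> U. D c u = 0}"
        using U subspace_kernel[OF D] by (rule subspace_Collect_conj)
      show "f w \<in> {u \<in> U. D c u = 0}" if "f \<in> F" "w \<in> {u \<in> U. D c u = 0}" for f w
        using that FU Dcomm F(2) by (simp add: lin_zero)
    qed (use that \<open>u \<noteq> 0\<close> in auto)
    then have "\<forall>w\<in>U. T w = c *s w" unfolding D_def by auto
    with no show False by blast
  qed
  have surj: "\<exists>u\<in>U. D c u = v" for c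
  proof -
    have "D c v \<noteq> 0" using inj v by blast
    have "D c ` U = U"
    proof (rule irreducible_onD[OF irr])
      show "subspace (D c ` U)" using D U by (rule subspace_image)
      show "f w \<in> D c ` U" if "f \<in> F" "w \<in> D c ` U" for f w
      proof -
        from that(2) obtain u where "u \<in> U" "w = D c u" by blast
        then have "f w = D c (f u)" using Dcomm that(1) by simp
        then show ?thesis using FU that(1) \<open>u \<in> U\<close> by blast
      qed
      show "D c v \<in> D c ` U" using v by blast
    qed (use DU \<open>D c v \<noteq> 0\<close> in auto)
    then show ?thesis using v by (metis imageE)
  qed
  then obtain g where g: "\<And>c. g c \<in> U" "\<And>c. D c (g c) = v" by metis
  have TU: "poly_apply T p u \<in> U" if "u \<in> U" for p u
    by (induction p) (auto simp: T U that subspace_0 subspace_add subspace_scale)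
  have lin_factor: "poly_apply T [:- c, 1:] u = D c u" for c u
    using T(1) by (simp add: D_def lin_zero)
  have poly_inj: "poly_apply T p v \<noteq> 0" if "p \<noteq> 0" for p
    using that
  proof (induction "degree p" arbitrary: p)
    case 0
    then obtain a where "p = [:a:]" "a \<noteq> 0" by (metis degree_eq_zeroE pCons_0_0)
    then show ?case using v T(1) by (simp add: lin_zero)
  next
    case (Suc d)
    then obtain x where "poly p x = 0" by (metis alg_closed_imp_poly_has_root zero_less_Suc)
    then obtain q where q: "p = [:- x, 1:] * q" by (metis poly_eq_0_iff_dvd dvdE)
    then have "q \<noteq> 0" using Suc by auto
    then have "degree p = Suc (degree q)" unfolding q by (subst degree_mult_eq) auto
    then have "poly_apply T q v \<noteq> 0" using Suc \<open>q \<noteq> 0\<close> by auto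
    moreover have "poly_apply T p v = D x (poly_apply T q v)"
      unfolding q poly_apply_mult[OF T(1)] lin_factor ..
    ultimately show ?case using inj TU v by metis
  qed
  have g_inj: "inj g"
  proof (rule injI)
    fix c d assume cd: "g c = g d"
    have "(c - d) *s g c = D d (g c) - D c (g c)" unfolding D_def by (simp add: scale_left_diff_distrib)
    also have "\<dots> = 0" using g(2)[of c] g(2)[of d] cd by simp
    finally have "c = d \<or> g c = 0" by simp
    moreover have "g c \<noteq> 0" using g(2)[of c] v lin_zero[OF D] by metis
    ultimately show "c = d" by simp
  qed
  have "independent (range g)"
    unfolding dependent_explicit
  proof clarify
    fix t w y assume t: "finite t" "t \<subseteq> range g" "(\<Sum>v\<in>t. w v *s v) = 0" "y \<in> t" "w y \<noteq> 0"
    define X where "X = g -` t"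
    have X: "finite X" unfolding X_def using t(1) g_inj by (rule finite_vimageI)
    have tX: "t = g ` X" unfolding X_def using t(2) by auto
    define al where "al c = w (g c)" for c
    have sum0: "(\<Sum>c\<in>X. al c *s g c) = 0"
      using t(3) unfolding tX al_def by (subst (asm) sum.reindex) (auto intro: inj_on_subset[OF g_inj])
    define P where "P Y = (\<Prod>d\<in>Y. [:- d, 1:])" for Y :: "'a set"
    define q where "q = (\<Sum>c\<in>X. Polynomial.smult (al c) (P (X - {c})))"
    have "poly_apply T q v = (\<Sum>c\<in>X. al c *s poly_apply T (P X) (g c))"
    proof -
      have "poly_apply T (P (X - {c})) v = poly_apply T (P X) (g c)" if "c \<in> X" for c
      proof -
        have "P X = P (X - {c}) * [:- c, 1:]"
          unfolding P_def using X that by (simp add: prod.remove mult.commute)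
        then show ?thesis
          by (simp only: poly_apply_mult[OF T(1)] lin_factor g(2))
      qed
      then show ?thesis
        unfolding q_def poly_apply_sum[OF T(1)] poly_apply_smult[OF T(1)] by simp
    qed
    also have "\<dots> = poly_apply T (P X) (\<Sum>c\<in>X. al c *s g c)"
      using lin_poly_apply[OF T(1), of "P X"] by (simp add: lin_sum lin_scale)
    also have "\<dots> = 0" using sum0 lin_zero[OF lin_poly_apply[OF T(1)]] by simp
    finally have "q = 0" using poly_inj by blast
    from t(4) tX obtain c where c: "c \<in> X" "y = g c" by blast
    have "poly q c = (\<Sum>d\<in>X. al d * poly (P (X - {d})) c)"
      unfolding q_def by (simp add: poly_sum)
    also have "\<dots> = al c * poly (P (X - {c})) c"
    proof (subst sum.remove[OF X c(1)])
      have "poly (P (X - {d})) c = 0" if "d \<in> X - {c}" for d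
        unfolding P_def poly_prod using that c X by (intro prod_zero) auto
      then show "al c * poly (P (X - {c})) c + (\<Sum>d\<in>X - {c}. al d * poly (P (X - {d})) c) =
          al c * poly (P (X - {c})) c" by simp
    qed
    finally have "al c * poly (P (X - {c})) c = 0" using \<open>q = 0\<close> by simp
    moreover have "poly (P (X - {c})) c \<noteq> 0"
      unfolding P_def poly_prod using X by auto
    ultimately have "al c = 0" by simp
    then show False using t(5) c by (simp add: al_def)
  qed
  moreover obtain S where S: "countable S" "span S = U"
    using irreducible_on_countable_span[OF irr F] by blast
  ultimately have "countable (range g)"
    using countable_independent_subset_span g(1) by blast
  then show False
    using uncountable_scalars g_inj countable_image_inj_on by blast
qed

text \<open>Extend a basis of \<open>L\<close> to a basis of \<open>R\<close> and send the vectors of the former to zero.\<close>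

lemma projection_along:
  assumes "subspace L" "subspace R" "L \<subseteq> R"
  obtains p where "lin p" "\<And>f. p f \<in> R" "\<And>f. f \<in> R \<Longrightarrow> f - p f \<in> L" "\<And>f. f \<in> L \<Longrightarrow> p f = 0"
proof -
  interpret pair: vector_space_pair scale scale
    by (intro vector_space_pair.intro vector_space_axioms)
  obtain B where B: "B \<subseteq> L" "independent B" "L \<subseteq> span B"
    using maximal_independent_subset[of L] by blast
  obtain D where D: "B \<subseteq> D" "D \<subseteq> R" "independent D" "R \<subseteq> span D"
    using maximal_independent_subset_extend[of B R] B assms by blast
  define f where "f b = (if b \<in> B then 0 else b)" for b
  define p where "p = pair.construct D f"
  have lin: "lin p" unfolding p_def using D(3) by (rule pair.linear_construct)
  have pD: "p b = f b" if "b \<in> D" for b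
    unfolding p_def using D(3) that by (rule pair.construct_basis)
  have "p v \<in> span (f ` D)" for v
    unfolding p_def using D(3) by (rule pair.construct_in_span)
  moreover have "span (f ` D) \<subseteq> R"
    by (rule span_minimal) (use D assms subspace_0 in \<open>auto simp: f_def\<close>)
  ultimately have range: "p v \<in> R" for v by blast
  have "span D \<subseteq> {v. v - p v \<in> L}"
  proof (rule span_minimal)
    show "subspace {v. v - p v \<in> L}"
      by (rule subspace_vimage[of "\<lambda>v. v - p v"]) (intro lin_minus lin_ident lin assms)+
    show "D \<subseteq> {v. v - p v \<in> L}"
      using B(1) subspace_0[OF assms(1)] by (auto simp: pD f_def)
  qed
  moreover have "span B \<subseteq> {v. p v = 0}"
    by (rule span_minimal) (use D(1) in \<open>auto simp: pD f_def intro!: subspace_kernel lin\<close>)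
  ultimately show ?thesis using that[OF lin range] B D by blast
qed

definition lincomb :: "('i \<Rightarrow> 'b) \<Rightarrow> ('i \<Rightarrow> 'a) \<Rightarrow> 'b" where
  "lincomb b f = (\<Sum>i | f i \<noteq> 0. f i *s b i)"

lemma lincomb_superset:
  assumes "finite X" "{i. f i \<noteq> 0} \<subseteq> X"
  shows "lincomb b f = (\<Sum>i\<in>X. f i *s b i)"
  unfolding lincomb_def using assms by (intro sum.mono_neutral_left) auto

lemma lincomb_single: "lincomb b (single i c) = c *s b i"
  by (subst lincomb_superset[of "{i}"]) (auto simp: single_def)

lemma lincomb_add:
  assumes "finite {i. f i \<noteq> 0}" "finite {i. g i \<noteq> 0}"
  shows "lincomb b (\<lambda>i. f i + g i) = lincomb b f + lincomb b g"
proof -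
  let ?X = "{i. f i \<noteq> 0} \<union> {i. g i \<noteq> 0}"
  have X: "finite ?X" using assms by simp
  have "lincomb b (\<lambda>i. f i + g i) = (\<Sum>i\<in>?X. (f i + g i) *s b i)"
    by (rule lincomb_superset[OF X]) auto
  also have "\<dots> = (\<Sum>i\<in>?X. f i *s b i) + (\<Sum>i\<in>?X. g i *s b i)"
    by (simp add: scale_left_distrib sum.distrib)
  also have "\<dots> = lincomb b f + lincomb b g"
    by (subst (1 2) lincomb_superset[OF X]) auto
  finally show ?thesis .
qed

lemma lincomb_sum:
  assumes I: "finite I" "\<And>q. q \<in> I \<Longrightarrow> finite {i. f q i \<noteq> 0}"
  shows "lincomb b (\<lambda>i. \<Sum>q\<in>I. c q * f q i) = (\<Sum>q\<in>I. c q *s lincomb b (f q))"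
proof -
  let ?X = "\<Union>q\<in>I. {i. f q i \<noteq> 0}"
  have X: "finite ?X" using I by simp
  have "lincomb b (\<lambda>i. \<Sum>q\<in>I. c q * f q i) = (\<Sum>i\<in>?X. (\<Sum>q\<in>I. c q * f q i) *s b i)"
    by (rule lincomb_superset[OF X]) (auto elim!: sum.not_neutral_contains_not_neutral)
  also have "\<dots> = (\<Sum>i\<in>?X. \<Sum>q\<in>I. (c q * f q i) *s b i)"
    by (simp add: scale_sum_left)
  also have "\<dots> = (\<Sum>q\<in>I. \<Sum>i\<in>?X. (c q * f q i) *s b i)"
    by (rule sum.swap)
  also have "\<dots> = (\<Sum>q\<in>I. c q *s lincomb b (f q))"
  proof (rule sum.cong)
    fix q assume "q \<in> I"
    then have "lincomb b (f q) = (\<Sum>i\<in>?X. f q i *s b i)"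
      by (intro lincomb_superset[OF X]) auto
    then show "(\<Sum>i\<in>?X. (c q * f q i) *s b i) = c q *s lincomb b (f q)"
      by (simp add: scale_sum_right)
  qed simp
  finally show ?thesis .
qed

lemma lincomb_in: "subspace N \<Longrightarrow> (\<And>i. f i \<noteq> 0 \<Longrightarrow> b i \<in> N) \<Longrightarrow> lincomb b f \<in> N"
  unfolding lincomb_def by (intro subspace_sum subspace_scale) auto

lemma lincomb_scale:
  assumes "finite {i. f i \<noteq> 0}"
  shows "lincomb b (\<lambda>i. c * f i) = c *s lincomb b f"
  using lincomb_sum[of "{()}" "\<lambda>_. f" b "\<lambda>_. c"] assms by simp

end

section \<open>Coefficients of Toeplitz operators\<close>

text \<open>
  The relations between the coefficients of the Toeplitz operators \<open>A\<^sub>j + x B\<^sub>j + C\<^sub>j y\<close>, indexed by the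
  inner generators \<open>m, \<dots>, p\<close>.  The products \<open>B\<^sub>j A\<^sub>i\<close>, \<open>B\<^sub>j C\<^sub>i\<close> and \<open>A\<^sub>j C\<^sub>i\<close> with \<open>i \<le> j\<close> vanish because
  of the Chinese relations that involve an outermost generator and depend on the order of the indices.
  All other relations say that the symbols commute: the coefficients of the powers of \<open>x\<close> in the
  commutator of two symbols are zero.  The last two assumptions fail only if \<open>a\<^sub>m\<close> is proportional to
  \<open>x\<close> or \<open>a\<^sub>p\<close> to \<open>y\<close>.
\<close>

locale toeplitz_coefficients = uncountable_vector_space scale
  for scale :: "'a::alg_closed_field \<Rightarrow> 'b::ab_group_add \<Rightarrow> 'b" (infixr \<open>*s\<close> 75) +
  fixes A B C :: "nat \<Rightarrow> 'b \<Rightarrow> 'b" and E :: "'b set" and m p :: nat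
  assumes mp: "m \<le> p"
    and lin_A: "lin (A i)" and lin_B: "lin (B i)" and lin_C: "lin (C i)"
    and irr: "irreducible_on (A ` {m..p} \<union> B ` {m..p} \<union> C ` {m..p}) E"
    and BB: "\<lbrakk>i \<in> {m..p}; j \<in> {m..p}; v \<in> E\<rbrakk> \<Longrightarrow> B i (B j v) = B j (B i v)"
    and CC: "\<lbrakk>i \<in> {m..p}; j \<in> {m..p}; v \<in> E\<rbrakk> \<Longrightarrow> C i (C j v) = C j (C i v)"
    and BA0: "\<lbrakk>i \<in> {m..p}; j \<in> {m..p}; i \<le> j; v \<in> E\<rbrakk> \<Longrightarrow> B j (A i v) = 0"
    and BC0: "\<lbrakk>i \<in> {m..p}; j \<in> {m..p}; i \<le> j; v \<in> E\<rbrakk> \<Longrightarrow> B j (C i v) = 0"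
    and AC0: "\<lbrakk>i \<in> {m..p}; j \<in> {m..p}; i \<le> j; v \<in> E\<rbrakk> \<Longrightarrow> A j (C i v) = 0"
    and BA: "\<lbrakk>i \<in> {m..p}; j \<in> {m..p}; i \<le> j; v \<in> E\<rbrakk> \<Longrightarrow> B i (A j v) = A j (B i v) - A i (B j v)"
    and AC: "\<lbrakk>i \<in> {m..p}; j \<in> {m..p}; i \<le> j; v \<in> E\<rbrakk> \<Longrightarrow> A i (C j v) = C j (A i v) - C i (A j v)"
    and BC: "\<lbrakk>i \<in> {m..p}; j \<in> {m..p}; i \<le> j; v \<in> E\<rbrakk> \<Longrightarrow>
      B i (C j v) = C j (B i v) - C i (B j v) - (A i (A j v) - A j (A i v))"
    and nondegenerate_first: "\<exists>v\<in>E. A m v \<noteq> 0 \<or> C m v \<noteq> 0"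
    and nondegenerate_last: "\<exists>v\<in>E. A p v \<noteq> 0 \<or> B p v \<noteq> 0"
begin

lemmas lin_ABC = lin_simps[OF lin_A] lin_simps[OF lin_B] lin_simps[OF lin_C]

lemma subspace_E: "subspace E"
  using irr unfolding irreducible_on_def by blast

lemma A_E [simp]: "i \<in> {m..p} \<Longrightarrow> v \<in> E \<Longrightarrow> A i v \<in> E"
  and B_E [simp]: "i \<in> {m..p} \<Longrightarrow> v \<in> E \<Longrightarrow> B i v \<in> E"
  and C_E [simp]: "i \<in> {m..p} \<Longrightarrow> v \<in> E \<Longrightarrow> C i v \<in> E"
  using irr unfolding irreducible_on_def by blast+

lemma E_irreducible:
  assumes "subspace N" "N \<subseteq> E" "u \<in> N" "u \<noteq> 0"
    and "\<And>i v. i \<in> {m..p} \<Longrightarrow> v \<in> N \<Longrightarrow> A i v \<in> N"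
    and "\<And>i v. i \<in> {m..p} \<Longrightarrow> v \<in> N \<Longrightarrow> B i v \<in> N"
    and "\<And>i v. i \<in> {m..p} \<Longrightarrow> v \<in> N \<Longrightarrow> C i v \<in> N"
  shows "N = E"
  using irreducible_onD[OF irr assms(1,2) _ assms(3,4)] assms(5-) by blast

text \<open>
  All \<open>B\<^sub>p A\<^sub>i\<close> and \<open>B\<^sub>p C\<^sub>i\<close> vanish, so it is enough that the images of the \<open>A\<close>'s and \<open>C\<close>'s span \<open>E\<close>.
  They span a subspace that is stable under the \<open>B\<close>'s as well.
\<close>

lemma B_last: "v \<in> E \<Longrightarrow> B p v = 0"
proof -
  define G where "G = (\<Union>i\<in>{m..p}. A i ` E \<union> C i ` E)"
  have GE: "span G \<subseteq> E"
    by (rule span_minimal) (auto simp: G_def subspace_E)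
  have A: "A i v \<in> span G" and C: "C i v \<in> span G" if "i \<in> {m..p}" "v \<in> E" for i v
    using that unfolding G_def by (auto intro!: span_base)
  have B: "B i v \<in> span G" if i: "i \<in> {m..p}" and v: "v \<in> span G" for i v
  proof -
    have "G \<subseteq> {v. B i v \<in> span G}"
    proof
      fix g assume "g \<in> G"
      then obtain j u where j: "j \<in> {m..p}" "u \<in> E" "g = A j u \<or> g = C j u"
        unfolding G_def by blast
      note mem = span_diff A C i j(1,2) A_E B_E
      have "B i (A j u) \<in> span G"
      proof (cases "i \<le> j")
        case True
        then show ?thesis unfolding BA[OF i j(1) True j(2)] by (intro mem)
      next
        case False
        then show ?thesis using BA0[OF j(1) i _ j(2)] by (simp add: span_zero)
      qed
      moreover have "B i (C j u) \<in> span G"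
      proof (cases "i \<le> j")
        case True
        then show ?thesis unfolding BC[OF i j(1) True j(2)] by (intro mem)
      next
        case False
        then show ?thesis using BC0[OF j(1) i _ j(2)] by (simp add: span_zero)
      qed
      ultimately show "g \<in> {v. B i v \<in> span G}" using j(3) by auto
    qed
    then have "span G \<subseteq> {v. B i v \<in> span G}"
      by (rule span_minimal) (intro subspace_vimage lin_B subspace_span)
    then show ?thesis using v by blast
  qed
  from nondegenerate_first obtain u where "u \<in> E" "A m u \<noteq> 0 \<or> C m u \<noteq> 0" by blast
  then obtain g where "g \<in> span G" "g \<noteq> 0" using A[of m u] C[of m u] mp by auto
  then have "span G = E"
    by (rule E_irreducible[OF subspace_span GE]) (use A B C GE in auto)
  moreover have "span G \<subseteq> {v. B p v = 0}"
  proof (rule span_minimal)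
    show "G \<subseteq> {v. B p v = 0}" unfolding G_def using BA0 BC0 mp by auto
  qed (intro subspace_kernel lin_B)
  ultimately show "v \<in> E \<Longrightarrow> B p v = 0" by blast
qed

text \<open>
  Dually, \<open>C\<^sub>m\<close> maps into the common kernel of the \<open>A\<close>'s and \<open>B\<close>'s.  This kernel is stable under the
  \<open>C\<close>'s, and it is not \<open>E\<close> because \<open>A\<^sub>p\<close> or \<open>B\<^sub>p\<close> is nonzero.
\<close>

lemma C_first: "v \<in> E \<Longrightarrow> C m v = 0"
proof -
  define N where "N = {v \<in> E. \<forall>i\<in>{m..p}. A i v = 0 \<and> B i v = 0}"
  have N: "subspace N"
    unfolding N_def
    by (intro subspace_Collect_conj subspace_Collect_ball subspace_E)
      (auto simp: subspace_def lin_ABC)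
  have CN: "C j v \<in> N" if j: "j \<in> {m..p}" and v: "v \<in> N" for j v
  proof -
    have vE: "v \<in> E" and v0: "\<And>i. i \<in> {m..p} \<Longrightarrow> A i v = 0" "\<And>i. i \<in> {m..p} \<Longrightarrow> B i v = 0"
      using v unfolding N_def by auto
    have "A i (C j v) = 0 \<and> B i (C j v) = 0" if i: "i \<in> {m..p}" for i
    proof (cases "i \<le> j")
      case True
      then show ?thesis using AC[OF i j True vE] BC[OF i j True vE] v0 i j by (simp add: lin_ABC)
    next
      case False
      then show ?thesis using AC0[OF j i _ vE] BC0[OF j i _ vE] by simp
    qed
    then show ?thesis unfolding N_def using j vE by simp
  qed
  show "C m v = 0" if "v \<in> E"
  proof (rule ccontr)
    assume "C m v \<noteq> 0"
    moreover have "C m v \<in> N"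
      unfolding N_def using that mp by (auto intro: AC0 BC0)
    moreover have "A i v \<in> N" "B i v \<in> N" if "i \<in> {m..p}" "v \<in> N" for i v
      using that subspace_0[OF N] unfolding N_def by auto
    moreover have "N \<subseteq> E" unfolding N_def by blast
    ultimately have "N = E"
      by (intro E_irreducible[OF N _ _ _ _ _ CN])
    then have "A p v = 0 \<and> B p v = 0" if "v \<in> E" for v
      using that mp unfolding N_def by (metis (mono_tags, lifting) atLeastAtMost_iff mem_Collect_eq order_refl)
    with nondegenerate_last show False by blast
  qed
qed

text \<open>
  The relations allow every operator to be written with the \<open>C\<close>'s on the left of the \<open>A\<close>'s and these on
  the left of the \<open>B\<close>'s.  So a subspace that is stable under the \<open>A\<close>'s and \<open>B\<close>'s generates \<open>E\<close> by means
  of the \<open>C\<close>'s alone.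
\<close>

lemma C_induct:
  assumes G0: "subspace G0" "G0 \<subseteq> E" "u \<in> G0" "u \<noteq> 0"
    and A_G0: "\<And>i v. i \<in> {m..p} \<Longrightarrow> v \<in> G0 \<Longrightarrow> A i v \<in> G0"
    and B_G0: "\<And>i v. i \<in> {m..p} \<Longrightarrow> v \<in> G0 \<Longrightarrow> B i v \<in> G0"
    and P: "subspace P" "G0 \<subseteq> P" "\<And>i v. i \<in> {m..p} \<Longrightarrow> v \<in> E \<Longrightarrow> v \<in> P \<Longrightarrow> C i v \<in> P"
  shows "E \<subseteq> P"
proof -
  define closed where "closed G \<longleftrightarrow> subspace G \<and> G0 \<subseteq> G \<and> G \<subseteq> E \<and>
    (\<forall>i\<in>{m..p}. \<forall>v\<in>G. C i v \<in> G)" for G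
  define G where "G = \<Inter>{G. closed G}"
  have closed_E: "closed E"
    unfolding closed_def using subspace_E G0 by auto
  have GE: "G \<subseteq> E" unfolding G_def using closed_E by blast
  have G: "subspace G" unfolding G_def by (rule subspace_Inter) (auto simp: closed_def)
  have G0G: "G0 \<subseteq> G" unfolding G_def closed_def by blast
  have C_G: "C i v \<in> G" if "i \<in> {m..p}" "v \<in> G" for i v
    using that unfolding G_def closed_def by blast
  have least: "G \<subseteq> H" if "closed H" for H using that unfolding G_def by blast
  have "closed {v \<in> G. \<forall>i\<in>{m..p}. A i v \<in> G}"
    unfolding closed_def
  proof (intro conjI ballI)
    show "subspace {v \<in> G. \<forall>i\<in>{m..p}. A i v \<in> G}"
      by (intro subspace_Collect_conj subspace_Collect_ball subspace_vimage lin_A G)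
    show "G0 \<subseteq> {v \<in> G. \<forall>i\<in>{m..p}. A i v \<in> G}" using G0G A_G0 by auto
    fix j v assume j: "j \<in> {m..p}" and v: "v \<in> {v \<in> G. \<forall>i\<in>{m..p}. A i v \<in> G}"
    have "A i (C j v) \<in> G" if i: "i \<in> {m..p}" for i
    proof (cases "i \<le> j")
      case True
      have vE: "v \<in> E" using v GE by auto
      show ?thesis unfolding AC[OF i j True vE] using v i j by (auto intro!: subspace_diff[OF G] C_G)
    next
      case False
      then show ?thesis using AC0[OF j i] v GE by (auto simp: subspace_0[OF G])
    qed
    then show "C j v \<in> {v \<in> G. \<forall>i\<in>{m..p}. A i v \<in> G}" using v j C_G by auto
  qed (use GE in auto)
  then have A_G: "A i v \<in> G" if "i \<in> {m..p}" "v \<in> G" for i v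
    using least that by blast
  have "closed {v \<in> G. \<forall>i\<in>{m..p}. B i v \<in> G}"
    unfolding closed_def
  proof (intro conjI ballI)
    show "subspace {v \<in> G. \<forall>i\<in>{m..p}. B i v \<in> G}"
      by (intro subspace_Collect_conj subspace_Collect_ball subspace_vimage lin_B G)
    show "G0 \<subseteq> {v \<in> G. \<forall>i\<in>{m..p}. B i v \<in> G}" using G0G B_G0 by auto
    fix j v assume j: "j \<in> {m..p}" and v: "v \<in> {v \<in> G. \<forall>i\<in>{m..p}. B i v \<in> G}"
    have "B i (C j v) \<in> G" if i: "i \<in> {m..p}" for i
    proof (cases "i \<le> j")
      case True
      have vE: "v \<in> E" using v GE by auto
      show ?thesis unfolding BC[OF i j True vE] using v i j
        by (auto intro!: subspace_diff[OF G] C_G A_G)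
    next
      case False
      then show ?thesis using BC0[OF j i] v GE by (auto simp: subspace_0[OF G])
    qed
    then show "C j v \<in> {v \<in> G. \<forall>i\<in>{m..p}. B i v \<in> G}" using v j C_G by auto
  qed (use GE in auto)
  then have B_G: "B i v \<in> G" if "i \<in> {m..p}" "v \<in> G" for i v
    using least that by blast
  have "G = E"
    using G0 G0G by (intro E_irreducible[OF G GE _ _ A_G B_G C_G]) auto
  moreover have "closed (G \<inter> P)"
    unfolding closed_def using G P G0G GE C_G by (auto intro: subspace_inter)
  ultimately show ?thesis using least by blast
qed

definition W :: "'b set" where
  "W = {v \<in> E. \<forall>i\<in>{m..p}. B i v = 0}"

definition CE :: "'b set" where
  "CE = span (\<Union>i\<in>{m..p}. C i ` E)"

lemma subspace_W: "subspace W"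
  unfolding W_def by (intro subspace_Collect_conj subspace_Collect_ball subspace_E subspace_kernel lin_B)

lemma W_E: "w \<in> W \<Longrightarrow> w \<in> E"
  by (simp add: W_def)

lemma B_W: "w \<in> W \<Longrightarrow> i \<in> {m..p} \<Longrightarrow> B i w = 0"
  by (simp add: W_def)

lemma A_W [simp]: assumes "w \<in> W" "i \<in> {m..p}" shows "A i w \<in> W"
proof -
  have "B j (A i w) = 0" if j: "j \<in> {m..p}" for j
  proof (cases "j \<le> i")
    case True
    then show ?thesis using BA[OF j assms(2) True] assms j by (simp add: W_def lin_ABC)
  next
    case False
    then show ?thesis using BA0[OF assms(2) j] assms by (simp add: W_def)
  qed
  then show ?thesis using assms by (simp add: W_def)
qed

lemma A_first_W: "v \<in> E \<Longrightarrow> A m v \<in> W"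
  using mp by (auto simp: W_def intro: BA0)

lemma W_nontrivial: obtains w where "w \<in> W" "w \<noteq> 0"
  using nondegenerate_first C_first A_first_W by metis

lemma A_last_nonzero: "\<exists>v\<in>E. A p v \<noteq> 0"
  using nondegenerate_last B_last by auto

lemma subspace_CE: "subspace CE"
  by (simp add: CE_def)

lemma C_CE: "i \<in> {m..p} \<Longrightarrow> v \<in> E \<Longrightarrow> C i v \<in> CE"
  unfolding CE_def by (intro span_base) blast

lemma CE_minimal:
  assumes "subspace P" "\<And>i v. i \<in> {m..p} \<Longrightarrow> v \<in> E \<Longrightarrow> C i v \<in> P"
  shows "CE \<subseteq> P"
  unfolding CE_def by (rule span_minimal) (use assms in auto)

lemma CE_E: "v \<in> CE \<Longrightarrow> v \<in> E"
  using CE_minimal[OF subspace_E] by auto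

lemma A_CE: assumes i: "i \<in> {m..p}" and v: "v \<in> CE" shows "A i v \<in> CE"
proof -
  have "CE \<subseteq> {v. A i v \<in> CE}"
  proof (rule CE_minimal)
    show "subspace {v. A i v \<in> CE}" by (intro subspace_vimage lin_A subspace_CE)
    fix j v assume j: "j \<in> {m..p}" and v: "v \<in> E"
    show "C j v \<in> {v. A i v \<in> CE}"
    proof (cases "i \<le> j")
      case True
      then show ?thesis using AC[OF i j True v] i j v
        by (auto intro!: subspace_diff[OF subspace_CE] C_CE)
    next
      case False
      then show ?thesis using AC0[OF j i _ v] subspace_0[OF subspace_CE] by auto
    qed
  qed
  then show ?thesis using v by blast
qed

lemma W_induct:
  assumes "subspace P" "W \<subseteq> P" "\<And>i v. i \<in> {m..p} \<Longrightarrow> v \<in> E \<Longrightarrow> v \<in> P \<Longrightarrow> C i v \<in> P"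
  shows "E \<subseteq> P"
proof -
  obtain w where "w \<in> W" "w \<noteq> 0" using W_nontrivial .
  then show ?thesis
    by (intro C_induct[OF subspace_W _ _ _ _ _ assms])
      (auto simp: W_E B_W subspace_0[OF subspace_W])
qed

lemma E_induct:
  assumes "subspace P" "W \<subseteq> P" "CE \<subseteq> P"
  shows "E \<subseteq> P"
  using C_CE assms by (intro W_induct[OF assms(1,2)]) auto

lemma AC_last: "v \<in> CE \<Longrightarrow> A p v = 0"
proof -
  have "CE \<subseteq> {v. A p v = 0}"
    by (rule CE_minimal) (use mp in \<open>auto intro: AC0 subspace_kernel[OF lin_A]\<close>)
  then show "v \<in> CE \<Longrightarrow> A p v = 0" by blast
qed

text \<open>
  \<open>W \<inter> CE\<close> is stable under the \<open>A\<close>'s and is killed by \<open>A\<^sub>p\<close>.  If it were nonzero it would generate \<open>E\<close>,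
  and as \<open>A\<^sub>p C\<^sub>i = 0\<close>, the operator \<open>A\<^sub>p\<close> would vanish on \<open>E\<close>.
\<close>

lemma W_CE: assumes "u \<in> W" "u \<in> CE" shows "u = 0"
proof (rule ccontr)
  assume "u \<noteq> 0"
  have "E \<subseteq> {v. A p v = 0}"
  proof (rule C_induct[of "W \<inter> CE"])
    show "u \<in> W \<inter> CE" "u \<noteq> 0" using assms \<open>u \<noteq> 0\<close> by auto
    show "subspace {v. A p v = 0}" by (intro subspace_kernel lin_A)
    show "C i v \<in> {v. A p v = 0}" if "i \<in> {m..p}" "v \<in> E" for i v
      using AC_last C_CE that by blast
  qed (auto simp: subspace_inter subspace_W subspace_CE W_E A_CE B_W AC_last subspace_0)
  with A_last_nonzero show False by blast
qed

text \<open>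
  A nonzero \<open>A\<close>-stable \<open>N \<subseteq> W\<close> generates \<open>E\<close>, so \<open>E = N + CE\<close>; since \<open>W \<inter> CE = 0\<close>, this forces \<open>N = W\<close>.
\<close>

lemma W_irreducible: "irreducible_on (A ` {m..p}) W"
  unfolding irreducible_on_def
proof (intro conjI allI impI)
  show "\<exists>v\<in>W. v \<noteq> 0" using W_nontrivial by blast
  fix N assume N: "subspace N" "N \<subseteq> W" "\<forall>f\<in>A ` {m..p}. \<forall>v\<in>N. f v \<in> N"
  show "N \<subseteq> {0} \<or> N = W"
  proof (cases "N \<subseteq> {0}")
    case False
    then obtain u where u: "u \<in> N" "u \<noteq> 0" by blast
    have "E \<subseteq> {x + y |x y. x \<in> N \<and> y \<in> CE}"
    proof (rule C_induct[of N u])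
      show "subspace {x + y |x y. x \<in> N \<and> y \<in> CE}"
        using N subspace_CE by (intro subspace_sums)
      have "C i v \<in> {x + y |x y. x \<in> N \<and> y \<in> CE}" if "i \<in> {m..p}" "v \<in> E" for i v
        using that C_CE subspace_0[OF N(1)] by force
      then show "C i v \<in> {x + y |x y. x \<in> N \<and> y \<in> CE}" if "i \<in> {m..p}" "v \<in> E" for i v
        using that by blast
      show "N \<subseteq> {x + y |x y. x \<in> N \<and> y \<in> CE}"
        using subspace_0[OF subspace_CE] by force
      show "N \<subseteq> E" using N W_E by auto
      show "B i v \<in> N" if "i \<in> {m..p}" "v \<in> N" for i v
      proof -
        have "v \<in> W" using that N by blast
        then show ?thesis using B_W that subspace_0[OF N(1)] by simp
      qed
    qed (use N u in auto)
    moreover have "w \<in> N" if "w \<in> W" "w = x + y" "x \<in> N" "y \<in> CE" for w x y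
    proof -
      have "y = w - x" using that by simp
      then have "y \<in> W" using that N subspace_diff[OF subspace_W] by blast
      then have "y = 0" using W_CE that by blast
      then show ?thesis using that by simp
    qed
    ultimately show ?thesis using N W_E by blast
  qed simp
qed (auto simp: subspace_W)

text \<open>A vector of \<open>CE\<close> is detected by the components in \<open>W\<close> of its images under products of \<open>B\<close>'s.\<close>

lemma B_stable_in_CE:
  assumes N: "subspace N" "N \<subseteq> CE" "\<And>i v. i \<in> {m..p} \<Longrightarrow> v \<in> N \<Longrightarrow> B i v \<in> N" and "u \<in> N"
  shows "u = 0"
proof (rule ccontr)
  assume "u \<noteq> 0"
  define closed where "closed G \<longleftrightarrow> subspace G \<and> N \<subseteq> G \<and> (\<forall>i\<in>{m..p}. \<forall>v\<in>G. A i v \<in> G)" for G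
  define G where "G = \<Inter>{G. closed G}"
  have least: "G \<subseteq> H" if "closed H" for H using that unfolding G_def by blast
  have "closed CE"
    unfolding closed_def using N A_CE subspace_CE by auto
  then have GCE: "G \<subseteq> CE" by (rule least)
  have G: "subspace G" unfolding G_def by (rule subspace_Inter) (auto simp: closed_def)
  have NG: "N \<subseteq> G" unfolding G_def closed_def by blast
  have A_G: "A i v \<in> G" if "i \<in> {m..p}" "v \<in> G" for i v
    using that unfolding G_def closed_def by blast
  have "closed {v \<in> G. \<forall>i\<in>{m..p}. B i v \<in> G}"
    unfolding closed_def
  proof (intro conjI ballI)
    show "subspace {v \<in> G. \<forall>i\<in>{m..p}. B i v \<in> G}"
      by (intro subspace_Collect_conj subspace_Collect_ball subspace_vimage lin_B G)
    show "N \<subseteq> {v \<in> G. \<forall>i\<in>{m..p}. B i v \<in> G}" using NG N by auto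
    fix j v assume j: "j \<in> {m..p}" and v: "v \<in> {v \<in> G. \<forall>i\<in>{m..p}. B i v \<in> G}"
    have vE: "v \<in> E" using v GCE CE_E by auto
    have "B i (A j v) \<in> G" if i: "i \<in> {m..p}" for i
    proof (cases "i \<le> j")
      case True
      show ?thesis unfolding BA[OF i j True vE] using v i j
        by (auto intro!: subspace_diff[OF G] A_G)
    next
      case False
      then show ?thesis using BA0[OF j i _ vE] by (auto simp: subspace_0[OF G])
    qed
    then show "A j v \<in> {v \<in> G. \<forall>i\<in>{m..p}. B i v \<in> G}" using v j A_G by auto
  qed
  then have B_G: "B i v \<in> G" if "i \<in> {m..p}" "v \<in> G" for i v
    using least that by blast
  have "E \<subseteq> CE"
    by (rule C_induct[OF G _ _ \<open>u \<noteq> 0\<close> A_G B_G subspace_CE GCE])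
      (use GCE CE_E NG \<open>u \<in> N\<close> C_CE in auto)
  then show False using W_nontrivial W_CE W_E by blast
qed

text \<open>The form in which the previous lemma shows that an operator commuting with the \<open>B\<close>'s is zero.\<close>

lemma zero_on_E_if_image_in_CE:
  assumes f: "lin f" "\<And>v. v \<in> E \<Longrightarrow> f v \<in> CE"
    and fB: "\<And>i v. i \<in> {m..p} \<Longrightarrow> v \<in> E \<Longrightarrow> B i (f v) = f (B i v)" and "v \<in> E"
  shows "f v = 0"
proof (rule B_stable_in_CE[of "f ` E"])
  show "subspace (f ` E)" using f(1) subspace_E by (rule subspace_image)
  show "B i u \<in> f ` E" if "i \<in> {m..p}" "u \<in> f ` E" for i u
    using that fB by auto
qed (use f \<open>v \<in> E\<close> in auto)

lemma commutator_W:
  assumes "i \<in> {m..p}" "k \<in> {m..p}" "i \<le> k" "w \<in> W"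
  shows "B i (C k w) = A k (A i w) - A i (A k w)"
  using BC[OF assms(1-3) W_E[OF assms(4)]] B_W[OF assms(4)] assms by (simp add: lin_ABC)

text \<open>
  The two Chinese relations for the \<open>A\<^sub>j\<close> on \<open>W\<close>, read off from the coefficient relations by means of the
  commutator formula above; the lifting lemmas below thus need no reference to the operators \<open>a\<^sub>j\<close>.
\<close>

lemma A_relation_left:
  assumes ind: "i \<in> {m..p}" "k \<in> {m..p}" "j \<in> {m..p}" and ord: "i \<le> k" "k \<le> j" and w: "w \<in> W"
  shows "A j (A k (A i w)) = A j (A i (A k w))"
proof -
  have wE: "w \<in> E" using w by (rule W_E)
  have "A j (A k (A i w)) - A j (A i (A k w)) = A j (B i (C k w))"
    using commutator_W[OF ind(1,2) ord(1) w] by (simp add: lin_ABC)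
  also have "\<dots> = B i (A j (C k w)) + A i (B j (C k w))"
    using BA[OF ind(1,3), of "C k w"] ord ind wE by simp
  also have "\<dots> = 0" using AC0[OF ind(2,3) ord(2) wE] BC0[OF ind(2,3) ord(2) wE] by (simp add: lin_ABC)
  finally show ?thesis by simp
qed

lemma A_relation_right:
  assumes ind: "i \<in> {m..p}" "j \<in> {m..p}" "k \<in> {m..p}" and ord: "i \<le> j" "j \<le> k" and w: "w \<in> W"
  shows "A j (A k (A i w)) = A k (A j (A i w))"
proof -
  have wE: "w \<in> E" using w by (rule W_E)
  have "A k (A j (A i w)) - A j (A k (A i w)) = B j (C k (A i w))"
    using commutator_W[OF ind(2,3) ord(2)] w ind by simp
  also have "C k (A i w) = A i (C k w) + C i (A k w)"
    using AC[OF ind(1,3) _ wE] ord by simp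
  also have "B j \<dots> = 0"
    using BA0[OF ind(1,2) ord(1), of "C k w"] BC0[OF ind(1,2) ord(1), of "A k w"] ind wE
    by (simp add: lin_ABC)
  finally show ?thesis by simp
qed

lemma zero_if_in_CE_and_B_zero:
  assumes "u \<in> CE" "\<And>i. i \<in> {m..p} \<Longrightarrow> B i u = 0"
  shows "u = 0"
proof (rule W_CE)
  show "u \<in> W" using assms CE_E by (simp add: W_def)
qed fact

section \<open>Lifting relations from the inner space\<close>

text \<open>
  As \<open>E\<close> is generated from \<open>W\<close> by the \<open>C\<close>'s, an identity between operators on \<open>E\<close> follows from the same
  identity on \<open>W\<close> once it is shown to survive the application of a \<open>C\<^sub>i\<close>.
\<close>

lemma eq_on_E_by_C_induct:
  assumes "lin f" "lin g" "\<And>w. w \<in> W \<Longrightarrow> f w = g w"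
    and "\<And>i v. i \<in> {m..p} \<Longrightarrow> v \<in> E \<Longrightarrow> f v = g v \<Longrightarrow> f (C i v) = g (C i v)" and "v \<in> E"
  shows "f v = g v"
proof -
  have "E \<subseteq> {v. f v = g v}"
    using assms by (intro W_induct subspace_equalizer) auto
  then show ?thesis using assms(5) by blast
qed

lemma lin_null: "lin (\<lambda>v. 0)"
  by (simp add: lin_iff)

text \<open>
  An element of \<open>CE\<close> that all \<open>B\<^sub>i\<close> kill is zero.  On \<open>W\<close> this tests the linear relation between \<open>C\<^sub>j\<close>
  and \<open>C\<^sub>k\<close>; since the \<open>C\<close>'s commute, the relation then holds on all of \<open>E\<close>.
\<close>

lemma C_combination_zero:
  assumes jk: "j \<in> {m..p}" "k \<in> {m..p}"
    and eq: "\<And>i w. i \<in> {m..p} \<Longrightarrow> w \<in> W \<Longrightarrow> c *s B i (C j w) = d *s B i (C k w)"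
    and v: "v \<in> E"
  shows "c *s C j v = d *s C k v"
proof (rule eq_on_E_by_C_induct[OF _ _ _ _ v])
  show "lin (\<lambda>v. c *s C j v)" "lin (\<lambda>v. d *s C k v)" by (intro lin_scaled lin_C)+
  show "c *s C j w = d *s C k w" if "w \<in> W" for w
  proof -
    have "c *s C j w - d *s C k w = 0"
    proof (rule zero_if_in_CE_and_B_zero)
      show "c *s C j w - d *s C k w \<in> CE"
        using jk W_E[OF that] by (intro subspace_diff subspace_scale subspace_CE C_CE)
    qed (use eq that in \<open>simp add: lin_ABC\<close>)
    then show ?thesis by simp
  qed
  show "c *s C j (C i v) = d *s C k (C i v)"
    if "i \<in> {m..p}" "v \<in> E" "c *s C j v = d *s C k v" for i v
  proof -
    have "c *s C i (C j v) = d *s C i (C k v)"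
      using arg_cong[OF that(3), of "C i"] by (simp add: lin_ABC)
    then show ?thesis
      unfolding CC[OF jk(1) that(1,2)] CC[OF jk(2) that(1,2)] .
  qed
qed

text \<open>The values \<open>B\<^sub>i C\<^sub>j w\<close> that decide whether \<open>C\<^sub>j\<close> vanishes are commutators of \<open>A\<^sub>i\<close> and \<open>A\<^sub>j\<close> on \<open>W\<close>.\<close>

lemma C_zero:
  assumes j: "j \<in> {m..p}"
    and comm: "\<And>i w. i \<in> {m..p} \<Longrightarrow> i < j \<Longrightarrow> w \<in> W \<Longrightarrow> A i (A j w) = A j (A i w)"
    and v: "v \<in> E"
  shows "C j v = 0"
proof -
  have "1 *s C j v = 0 *s C j v"
  proof (rule C_combination_zero[OF j j _ v])
    fix i w assume i: "i \<in> {m..p}" and w: "w \<in> W"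
    have "B i (C j w) = 0"
    proof (cases "i < j")
      case True
      then show ?thesis using commutator_W[OF i j _ w] comm[OF i True w] by simp
    next
      case False
      then show ?thesis using BC0[OF j i _ W_E[OF w]] by simp
    qed
    then show "1 *s B i (C j w) = 0 *s B i (C j w)" by simp
  qed
  then show ?thesis by simp
qed

lemma scalar_on_W_lifts:
  assumes j: "j \<in> {m..p}" and scalar: "\<And>w. w \<in> W \<Longrightarrow> A j w = c *s w" and v: "v \<in> E"
  shows "A j v = c *s v" and "B j v = 0" and "C j v = 0"
proof -
  have Cj: "C j v = 0" if "v \<in> E" for v
    using j that by (intro C_zero) (auto simp: scalar lin_ABC)
  \<comment> \<open>The relation \<open>A\<^sub>j (A\<^sub>k A\<^sub>i - A\<^sub>i A\<^sub>k) = 0\<close> yields this with the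
    factor \<open>c\<close>, the value of \<open>A\<^sub>j\<close> on \<open>W\<close>.\<close>
  have Ck: "c *s C k v = 0" if k: "k \<in> {m..p}" "k \<le> j" and "v \<in> E" for k v
  proof -
    have "c *s C k v = 0 *s C k v"
    proof (rule C_combination_zero[OF k(1) k(1) _ that(3)])
      fix i w assume i: "i \<in> {m..p}" and w: "w \<in> W"
      have "c *s B i (C k w) = 0"
      proof (cases "i \<le> k")
        case True
        have "A j (A k (A i w)) = A j (A i (A k w))"
          using A_relation_left[OF i k(1) j True k(2) w] .
        then have "c *s (A k (A i w) - A i (A k w)) = 0"
          using scalar w i k by (simp add: scale_right_diff_distrib)
        then show ?thesis using commutator_W[OF i k(1) True w] by simp
      next
        case False
        then show ?thesis using BC0[OF k(1) i _ W_E[OF w]] by simp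
      qed
      then show "c *s B i (C k w) = 0 *s B i (C k w)" by simp
    qed
    then show ?thesis by simp
  qed
  have Aj: "A j v = c *s v" if "v \<in> E" for v
  proof (rule eq_on_E_by_C_induct[OF lin_A _ _ _ that])
    show "A j (C i v) = c *s C i v" if i: "i \<in> {m..p}" and v: "v \<in> E" "A j v = c *s v" for i v
    proof (cases "i \<le> j")
      case True
      then show ?thesis using AC0[OF i j True v(1)] Ck[OF i True v(1)] by simp
    next
      case False
      then show ?thesis using AC[OF j i _ v(1)] v Cj[of "A i v"] i by (simp add: lin_ABC)
    qed
  qed (auto simp: scalar intro: lin_scaled lin_ident)
  show "A j v = c *s v" using v by (rule Aj)
  show "C j v = 0" using v by (rule Cj)
  show "B j v = 0"
  proof (rule eq_on_E_by_C_induct[OF lin_B lin_null _ _ v])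
    show "B j (C i v) = 0" if i: "i \<in> {m..p}" and v: "v \<in> E" "B j v = 0" for i v
    proof (cases "i \<le> j")
      case True
      then show ?thesis using BC0[OF i j True v(1)] by simp
    next
      case False
      then show ?thesis using BC[OF j i _ v(1)] v Cj[of "B i v"] Aj i by (simp add: lin_ABC)
    qed
  qed (use B_W j in auto)
qed

lemma proportional_on_W_lifts:
  assumes j: "j \<in> {m..p}" "j - 1 \<in> {m..p}" "j \<noteq> 0"
    and pr: "\<And>w. w \<in> W \<Longrightarrow> c *s A j w = d *s A (j - 1) w" and v: "v \<in> E"
  shows "c *s A j v = d *s A (j - 1) v" "c *s B j v = d *s B (j - 1) v"
    "c *s C j v = d *s C (j - 1) v"
proof -
  have T: "c *s C j v = d *s C (j - 1) v" if "v \<in> E" for v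
  proof (rule C_combination_zero[OF j(1,2) _ that])
    fix i w assume i: "i \<in> {m..p}" and w: "w \<in> W"
    have pw: "c *s A j w = d *s A (j - 1) w" "c *s A j (A i w) = d *s A (j - 1) (A i w)"
      using pr w i by auto
    have pi: "c *s A i (A j w) = d *s A i (A (j - 1) w)"
      using arg_cong[OF pw(1), of "A i"] by (simp add: lin_ABC)
    consider "i \<le> j - 1" | "i = j" | "i > j" using j by linarith
    then show "c *s B i (C j w) = d *s B i (C (j - 1) w)"
    proof cases
      case 1
      then show ?thesis
        using commutator_W[OF i j(1) _ w] commutator_W[OF i j(2) 1 w] pw pi
        by (simp add: scale_right_diff_distrib)
    next
      case 2
      then show ?thesis
        using BC0[OF j(1,1) _ W_E[OF w]] BC0[OF j(2) i _ W_E[OF w]] by simp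
    next
      case 3
      then show ?thesis
        using BC0[OF j(1) i _ W_E[OF w]] BC0[OF j(2) i _ W_E[OF w]] by simp
    qed
  qed
  have R: "c *s A j v = d *s A (j - 1) v" if "v \<in> E" for v
  proof (rule eq_on_E_by_C_induct[OF _ _ _ _ that])
    fix i v assume i: "i \<in> {m..p}" and v: "v \<in> E" and IH: "c *s A j v = d *s A (j - 1) v"
    have IHC: "c *s C i (A j v) = d *s C i (A (j - 1) v)" for i
      using arg_cong[OF IH, of "C i"] by (simp add: lin_ABC)
    consider "i \<le> j - 1" | "i = j" | "i > j" using j by linarith
    then show "c *s A j (C i v) = d *s A (j - 1) (C i v)"
    proof cases
      case 1
      then show ?thesis using AC0[OF i j(2) 1 v] AC0[OF i j(1) _ v] by simp
    next
      case 2
      have "d *s A (j - 1) (C j v) = d *s C j (A (j - 1) v) - d *s C (j - 1) (A j v)"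
        using AC[OF j(2,1) _ v] by (simp add: scale_right_diff_distrib)
      also have "d *s C (j - 1) (A j v) = c *s C j (A j v)"
        using T j v by simp
      also have "d *s C j (A (j - 1) v) = c *s C j (A j v)" using IHC by simp
      finally show ?thesis using 2 AC0[OF j(1,1) _ v] by simp
    next
      case 3
      then show ?thesis
        using AC[OF j(1) i _ v] AC[OF j(2) i _ v] IHC T[of "A i v"] i v
        by (simp add: scale_right_diff_distrib)
    qed
  qed (use pr in \<open>auto intro: lin_scaled lin_A\<close>)
  show "c *s A j v = d *s A (j - 1) v" using v by (rule R)
  show "c *s C j v = d *s C (j - 1) v" using v by (rule T)
  show "c *s B j v = d *s B (j - 1) v"
  proof (rule eq_on_E_by_C_induct[OF _ _ _ _ v])
    fix i v assume i: "i \<in> {m..p}" and v: "v \<in> E" and IH: "c *s B j v = d *s B (j - 1) v"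
    have IHC: "c *s C i (B j v) = d *s C i (B (j - 1) v)" for i
      using arg_cong[OF IH, of "C i"] by (simp add: lin_ABC)
    have RA: "c *s A i (A j v) = d *s A i (A (j - 1) v)" for i
      using arg_cong[OF R[OF v], of "A i"] by (simp add: lin_ABC)
    consider "i \<le> j - 1" | "i = j" | "i > j" using j by linarith
    then show "c *s B j (C i v) = d *s B (j - 1) (C i v)"
    proof cases
      case 1
      then show ?thesis using BC0[OF i j(2) 1 v] BC0[OF i j(1) _ v] by simp
    next
      case 2
      have "d *s B (j - 1) (C j v) = d *s C j (B (j - 1) v) - d *s C (j - 1) (B j v) -
          (d *s A (j - 1) (A j v) - d *s A j (A (j - 1) v))"
        using BC[OF j(2,1) _ v] by (simp add: scale_right_diff_distrib)
      also have "d *s C (j - 1) (B j v) = c *s C j (B j v)"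
        using T j v by simp
      also have "d *s C j (B (j - 1) v) = c *s C j (B j v)" using IHC by simp
      also have "d *s A (j - 1) (A j v) = c *s A j (A j v)"
        using R[of "A j v"] j v by simp
      also have "d *s A j (A (j - 1) v) = c *s A j (A j v)" using RA by simp
      finally show ?thesis using 2 BC0[OF j(1,1) _ v] by simp
    next
      case 3
      then show ?thesis
        using BC[OF j(1) i _ v] BC[OF j(2) i _ v] IHC T[of "B i v"] R[of "A i v"] RA[of i] i v
        by (simp add: scale_right_diff_distrib)
    qed
  qed (use B_W j in \<open>auto intro: lin_scaled lin_B\<close>)
qed

text \<open>
  A commutator that vanishes on \<open>W\<close> maps \<open>E = W + CE\<close> into \<open>CE\<close>; \<open>f\<close> allows a further factor on the left.
\<close>

lemma commutator_CE:
  assumes jk: "j \<in> {m..p}" "k \<in> {m..p}" and f: "lin f" "\<And>v. v \<in> CE \<Longrightarrow> f v \<in> CE"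
    and comm: "\<And>w. w \<in> W \<Longrightarrow> f (A j (A k w)) = f (A k (A j w))" and v: "v \<in> E"
  shows "f (A j (A k v) - A k (A j v)) \<in> CE"
proof -
  have "E \<subseteq> {v. f (A j (A k v) - A k (A j v)) \<in> CE}"
  proof (rule E_induct)
    have "lin (\<lambda>v. f (A j (A k v) - A k (A j v)))"
      by (rule linI) (simp_all add: lin_ABC lin_simps[OF f(1)] scale_right_diff_distrib)
    then show "subspace {v. f (A j (A k v) - A k (A j v)) \<in> CE}"
      using subspace_CE by (rule subspace_vimage)
    show "W \<subseteq> {v. f (A j (A k v) - A k (A j v)) \<in> CE}"
    proof clarify
      fix w assume "w \<in> W"
      from comm[OF this] show "f (A j (A k w) - A k (A j w)) \<in> CE"
        by (simp only: lin_diff[OF f(1)] diff_self subspace_0[OF subspace_CE])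
    qed
    show "CE \<subseteq> {v. f (A j (A k v) - A k (A j v)) \<in> CE}"
    proof clarify
      fix v assume "v \<in> CE"
      then show "f (A j (A k v) - A k (A j v)) \<in> CE"
        by (intro f(2) subspace_diff[OF subspace_CE] A_CE jk)
    qed
  qed
  then show ?thesis using v by blast
qed

context
  fixes mu :: "nat \<Rightarrow> 'a"
  assumes arcs: "\<And>q t w. \<lbrakk>q \<in> {m..p}; t \<in> {m..p}; q < t; q + t = m + p; w \<in> W\<rbrakk> \<Longrightarrow>
      A t (A q w) = mu q *s w"
    and mu_nonzero: "\<And>q. q \<in> {m..p} \<Longrightarrow> 2 * q < m + p \<Longrightarrow> mu q \<noteq> 0"
begin

text \<open>
  With \<open>t\<close> the partner of \<open>j\<close>, the scalar \<open>\<mu>\<^sub>j = A\<^sub>t A\<^sub>j\<close> can be inserted on the left, and then the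
  relation \<open>A\<^sub>j A\<^sub>i A\<^sub>j = A\<^sub>j A\<^sub>j A\<^sub>i\<close> exchanges the factors.
\<close>

lemma lower_commute_W:
  assumes i: "i \<in> {m..p}" and j: "j \<in> {m..p}" and ij: "i \<le> j" "2 * j < m + p" and w: "w \<in> W"
  shows "A i (A j w) = A j (A i w)"
proof -
  define t where "t = m + p - j"
  have t: "t \<in> {m..p}" "j < t" "j + t = m + p" using j ij unfolding t_def by auto
  have "mu j *s A i (A j w) = A t (A j (A i (A j w)))"
    using arcs[OF j t] i j w by simp
  also have "\<dots> = A t (A j (A j (A i w)))"
    using A_relation_left[OF i j j ij(1) _ w] by simp
  also have "\<dots> = mu j *s A j (A i w)"
    using arcs[OF j t] i j w by simp
  finally show ?thesis using mu_nonzero[OF j ij(2)] by simp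
qed

text \<open>For upper indices the scalar \<open>A\<^sub>j A\<^sub>q\<close>, with \<open>q\<close> the partner of \<open>j\<close>, is inserted on the right.\<close>

lemma upper_commute_W:
  assumes j: "j \<in> {m..p}" and k: "k \<in> {m..p}" and jk: "j \<le> k" "2 * j > m + p" and w: "w \<in> W"
  shows "A j (A k w) = A k (A j w)"
proof -
  define q where "q = m + p - j"
  have q: "q \<in> {m..p}" "q < j" "q + j = m + p" "2 * q < m + p" using j jk unfolding q_def by auto
  have "mu q *s A j (A k w) = A j (A k (mu q *s w))" by (simp add: lin_ABC)
  also have "\<dots> = A j (A k (A j (A q w)))" using arcs[OF q(1) j q(2,3) w] by simp
  also have "\<dots> = A k (A j (A j (A q w)))"
    using A_relation_right[OF j j k _ jk(1), of "A q w"] q w by simp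
  also have "\<dots> = A k (A j (mu q *s w))" using arcs[OF q(1) j q(2,3) w] by simp
  also have "\<dots> = mu q *s A k (A j w)" by (simp add: lin_ABC)
  finally show ?thesis using mu_nonzero q by simp
qed

lemma C_lower: "j \<in> {m..p} \<Longrightarrow> 2 * j < m + p \<Longrightarrow> v \<in> E \<Longrightarrow> C j v = 0"
  by (rule C_zero) (auto intro: lower_commute_W)

text \<open>
  Modulo \<open>CE\<close>, the product \<open>B\<^sub>j C\<^sub>k\<close> is a commutator of upper \<open>A\<close>'s, and these commutators vanish on \<open>W\<close>.
  So \<open>B\<^sub>j\<close> maps \<open>E = W + CE\<close> into \<open>CE\<close>, and it commutes with the other \<open>B\<close>'s.
\<close>

lemma B_upper:
  assumes j: "j \<in> {m..p}" "2 * j > m + p" and v: "v \<in> E"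
  shows "B j v = 0"
proof (rule zero_on_E_if_image_in_CE[OF lin_B _ _ v])
  show "B j v \<in> CE" if "v \<in> E" for v
  proof -
    have "E \<subseteq> {v. B j v \<in> CE}"
    proof (rule E_induct)
      show "subspace {v. B j v \<in> CE}" by (intro subspace_vimage subspace_CE lin_B)
      then show "CE \<subseteq> {v. B j v \<in> CE}"
      proof (rule CE_minimal)
        fix k v assume k: "k \<in> {m..p}" and v: "v \<in> E"
        show "C k v \<in> {v. B j v \<in> CE}"
        proof (cases "j \<le> k")
          case True
          have "A j (A k v) - A k (A j v) \<in> CE"
            using commutator_CE[OF j(1) k lin_ident] upper_commute_W[OF j(1) k True j(2)] v by simp
          then show ?thesis using BC[OF j(1) k True v] j k v
            by (auto intro!: subspace_diff[OF subspace_CE] C_CE)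
        next
          case False
          then show ?thesis using BC0[OF k j(1) _ v] by (simp add: subspace_0[OF subspace_CE])
        qed
      qed
      show "W \<subseteq> {v. B j v \<in> CE}" using B_W j subspace_0[OF subspace_CE] by auto
    qed
    then show ?thesis using that by blast
  qed
qed (use BB j in auto)

lemma AC_lower:
  assumes q: "q \<in> {m..p}" "2 * q < m + p" and k: "k \<in> {m..p}" and v: "v \<in> E"
  shows "A q (C k v) = C k (A q v)"
proof (cases "q \<le> k")
  case True
  then show ?thesis using AC[OF q(1) k True v] C_lower[OF q, of "A k v"] k v by simp
next
  case False
  then show ?thesis using AC0[OF k q(1) _ v] C_lower[OF k, of "A q v"] q v by simp
qed

context
  fixes q t
  assumes q: "q \<in> {m..p}" and t: "t \<in> {m..p}" and qt: "q < t" "q + t = m + p"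
begin

text \<open>
  On \<open>W\<close> the product \<open>A\<^sub>t A\<^sub>q\<close> is a scalar, so this says that \<open>A\<^sub>t\<close> annihilates all commutators with
  \<open>A\<^sub>q\<close>.  For \<open>k \<le> t\<close> it is a Chinese relation; for \<open>k > t\<close> it holds because \<open>A\<^sub>t\<close> and \<open>A\<^sub>k\<close> commute.
\<close>

lemma arc_central_W:
  assumes "k \<in> {m..p}" "w \<in> W"
  shows "A t (A q (A k w)) = A t (A k (A q w))"
proof -
  consider "k \<le> q" | "q \<le> k" "k \<le> t" | "t < k" by linarith
  then show ?thesis
  proof cases
    case 1
    then show ?thesis using A_relation_left[OF assms(1) q t 1 _ assms(2)] qt by simp
  next
    case 2
    then show ?thesis using A_relation_left[OF q assms(1) t 2 assms(2)] by simp
  next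
    case 3
    have "A t (A k (A q w)) = A k (A t (A q w))"
      using 3 qt q assms by (intro upper_commute_W[OF t]) simp_all
    then show ?thesis using arcs[OF q t qt] assms by (simp add: lin_ABC)
  qed
qed

lemma arc_central_W':
  assumes "k \<in> {m..p}" "w \<in> W"
  shows "A t (A k (A q w)) = A k (A t (A q w))"
  using arc_central_W[OF assms] arcs[OF q t qt] assms by (simp add: lin_ABC)

text \<open>
  \<open>C\<^sub>t A\<^sub>q\<close> and \<open>A\<^sub>t B\<^sub>q\<close> are the coefficients of \<open>y\<close> and \<open>x\<close> in the symbol of \<open>a\<^sub>t a\<^sub>q\<close>.  For the first, its
  images under the \<open>B\<^sub>i\<close> are values of the commutators of the central \<open>A\<^sub>t A\<^sub>q\<close> with \<open>A\<^sub>i\<close>.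
\<close>

lemma CA_arc:
  assumes v: "v \<in> E"
  shows "C t (A q v) = 0"
proof (rule eq_on_E_by_C_induct[OF lin_comp[OF lin_C lin_A] lin_null _ _ v])
  show "C t (A q w) = 0" if w: "w \<in> W" for w
  proof (rule zero_if_in_CE_and_B_zero)
    show "C t (A q w) \<in> CE" using q t W_E[OF w] by (intro C_CE) auto
    show "B i (C t (A q w)) = 0" if i: "i \<in> {m..p}" for i
    proof (cases "i \<le> t")
      case True
      then show ?thesis
        using commutator_W[OF i t True, of "A q w"] arc_central_W'[OF i w] q w by simp
    next
      case False
      then show ?thesis using BC0[OF t i, of "A q w"] q W_E[OF w] by simp
    qed
  qed
  show "C t (A q (C i v)) = 0" if "i \<in> {m..p}" "v \<in> E" "C t (A q v) = 0" for i v
    using that AC_lower[OF q _ that(1,2)] qt q CC[OF t that(1), of "A q v"] by (simp add: lin_ABC)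
qed

text \<open>
  The argument is dual to the previous one: \<open>A\<^sub>t\<close> commutes with the \<open>B\<close>'s because \<open>B\<^sub>t = 0\<close>, so it is
  enough that \<open>A\<^sub>t B\<^sub>q\<close> maps into \<open>CE\<close>.
\<close>

lemma AB_arc:
  assumes v: "v \<in> E"
  shows "A t (B q v) = 0"
proof (rule zero_on_E_if_image_in_CE[OF lin_comp[OF lin_A lin_B] _ _ v])
  show "A t (B q v) \<in> CE" if "v \<in> E" for v
  proof -
    have "E \<subseteq> {v. A t (B q v) \<in> CE}"
    proof (rule E_induct)
      show "subspace {v. A t (B q v) \<in> CE}"
        by (intro subspace_vimage subspace_CE lin_comp[OF lin_A lin_B])
      then show "CE \<subseteq> {v. A t (B q v) \<in> CE}"
      proof (rule CE_minimal)
        fix k v assume k: "k \<in> {m..p}" and v: "v \<in> E"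
        show "C k v \<in> {v. A t (B q v) \<in> CE}"
        proof (cases "q \<le> k")
          case True
          have "B q (C k v) = C k (B q v) - (A q (A k v) - A k (A q v))"
            using BC[OF q k True v] C_lower[OF q, of "B k v"] qt k v by simp
          moreover have "A t (A q (A k v) - A k (A q v)) \<in> CE"
            using commutator_CE[OF q k lin_A A_CE[OF t]] arc_central_W[OF k] v by simp
          ultimately show ?thesis using q t k v
            by (auto simp: lin_diff[OF lin_A] intro!: subspace_diff[OF subspace_CE] A_CE C_CE)
        next
          case False
          then show ?thesis using BC0[OF k q _ v] by (simp add: subspace_0[OF subspace_CE] lin_ABC)
        qed
      qed
      show "W \<subseteq> {v. A t (B q v) \<in> CE}" using B_W q subspace_0[OF subspace_CE] by (auto simp: lin_ABC)
    qed
    then show ?thesis using that by blast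
  qed
  show "B i (A t (B q v)) = A t (B q (B i v))" if i: "i \<in> {m..p}" and v: "v \<in> E" for i v
  proof -
    have Bt: "B t u = 0" if "u \<in> E" for u using B_upper[OF t _ that] qt by simp
    have "B i (A t u) = A t (B i u)" if "u \<in> E" for u
    proof (cases "i \<le> t")
      case True
      then show ?thesis using BA[OF i t True that] Bt[OF that] by (simp add: lin_ABC)
    next
      case False
      then show ?thesis
        using BA[OF t i _ that] BA0[OF t i _ that] Bt[OF that] Bt[of "A i u"] i that
        by (simp add: lin_ABC)
    qed
    then show ?thesis using BB[OF i q v] q v by simp
  qed
qed

text \<open>The constant coefficient of the symbol of \<open>a\<^sub>t a\<^sub>q\<close> takes on \<open>E\<close> the scalar value it has on \<open>W\<close>.\<close>

lemma arc_lifts: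
  assumes v: "v \<in> E"
  shows "A t (A q v) + C t (B q v) = mu q *s v"
proof (rule eq_on_E_by_C_induct[OF _ _ _ _ v, where f = "\<lambda>v. A t (A q v) + C t (B q v)"])
  show "lin (\<lambda>v. A t (A q v) + C t (B q v))"
    by (rule linI) (simp_all add: lin_ABC scale_right_distrib)
  show "A t (A q w) + C t (B q w) = mu q *s w" if "w \<in> W" for w
    using arcs[OF q t qt that] B_W[OF that q] by (simp add: lin_ABC)
  show "A t (A q (C k v)) + C t (B q (C k v)) = mu q *s C k v"
    if k: "k \<in> {m..p}" and v: "v \<in> E" and IH: "A t (A q v) + C t (B q v) = mu q *s v" for k v
  proof (cases "q \<le> k")
    case False
    then show ?thesis using C_lower[OF k] v q qt by (simp add: lin_ABC)
  next
    case True
    have C: "C t (B q (C k v)) = C k (C t (B q v)) + C t (A k (A q v))"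
    proof -
      have "B q (C k v) = C k (B q v) - (A q (A k v) - A k (A q v))"
        using BC[OF q k True v] C_lower[OF q, of "B k v"] qt k v by simp
      then show ?thesis
        using CA_arc[of "A k v"] CC[OF t k, of "B q v"] q k v by (simp add: lin_ABC)
    qed
    have IHC: "C k (C t (B q v)) = mu q *s C k v - C k (A t (A q v))"
      using arg_cong[OF IH, of "C k"] by (simp add: lin_ABC algebra_simps)
    have AqC: "A q (C k v) = C k (A q v)" using AC_lower[OF q _ k v] qt by simp
    have "A t (C k (A q v)) = C k (A t (A q v)) - C t (A k (A q v))"
    proof (cases "t \<le> k")
      case True
      then show ?thesis using AC[OF t k True, of "A q v"] q v by simp
    next
      case False
      then have "k \<le> t" by simp
      then have "A k (C t (A q v)) = C t (A k (A q v)) - C k (A t (A q v))"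
        and "A t (C k (A q v)) = 0"
        using AC[OF k t _, of "A q v"] AC0[OF k t _, of "A q v"] q v by simp_all
      then show ?thesis using CA_arc[OF v] by (simp add: lin_ABC algebra_simps)
    qed
    then show ?thesis unfolding AqC C IHC by simp
  qed
qed (intro lin_scaled lin_ident)

end

end

end

section \<open>Operators satisfying the Chinese relations\<close>

context uncountable_vector_space
begin

text \<open>
  For \<open>l = 1\<close> and \<open>r = n\<close> this is the case in which an element of \<open>exceptional_elements n\<close> annihilates
  the space.
\<close>

definition exceptional_on :: "(nat \<Rightarrow> 'b \<Rightarrow> 'b) \<Rightarrow> nat \<Rightarrow> nat \<Rightarrow> 'b set \<Rightarrow> bool" where
  "exceptional_on a l r U \<longleftrightarrow>
     (\<exists>i\<in>{l..r}. \<exists>c. \<forall>v\<in>U. a i v = c *s v) \<or>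
     (\<exists>j\<in>{l<..r}. \<exists>c d. (c, d) \<noteq> (0, 0) \<and> (\<forall>v\<in>U. c *s a j v = d *s a (j - 1) v))"

end

locale chinese_operators = uncountable_vector_space scale
  for scale :: "'a::alg_closed_field \<Rightarrow> 'b::ab_group_add \<Rightarrow> 'b" (infixr \<open>*s\<close> 75) +
  fixes a :: "nat \<Rightarrow> 'b \<Rightarrow> 'b" and l r :: nat and U :: "'b set"
  assumes lr: "l \<le> r" and lin_a: "lin (a i)" and irr: "irreducible_on (a ` {l..r}) U"
    and rel_right: "\<lbrakk>l \<le> i; i \<le> j; j \<le> k; k \<le> r; v \<in> U\<rbrakk> \<Longrightarrow> a j (a k (a i v)) = a k (a j (a i v))"
    and rel_left: "\<lbrakk>l \<le> i; i \<le> j; j \<le> k; k \<le> r; v \<in> U\<rbrakk> \<Longrightarrow> a k (a j (a i v)) = a k (a i (a j v))"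
begin

lemmas lin_a_simps = lin_simps[OF lin_a]

lemma subspace_U: "subspace U"
  using irr unfolding irreducible_on_def by blast

lemma a_U [simp]: "l \<le> i \<Longrightarrow> i \<le> r \<Longrightarrow> v \<in> U \<Longrightarrow> a i v \<in> U"
  using irr unfolding irreducible_on_def by simp

lemma U_irreducible:
  assumes "subspace N" "N \<subseteq> U" "u \<in> N" "u \<noteq> 0"
    and "\<And>i v. l \<le> i \<Longrightarrow> i \<le> r \<Longrightarrow> v \<in> N \<Longrightarrow> a i v \<in> N"
  shows "N = U"
proof (rule irreducible_onD[OF irr assms(1,2) _ assms(3,4)])
  show "f v \<in> N" if "f \<in> a ` {l..r}" "v \<in> N" for f v using that assms(5) by auto
qed

lemma commuting_scalar:
  assumes "lin T" "\<And>v. v \<in> U \<Longrightarrow> T v \<in> U"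
    and "\<And>i v. l \<le> i \<Longrightarrow> i \<le> r \<Longrightarrow> v \<in> U \<Longrightarrow> T (a i v) = a i (T v)"
  shows "\<exists>c. \<forall>v\<in>U. T v = c *s v"
  by (rule schur_uncountable[OF irr]) (use assms in \<open>auto simp: lin_a\<close>)

lemma outer_scalar: "\<exists>c. \<forall>v\<in>U. a r (a l v) = c *s v"
proof (rule commuting_scalar)
  show "lin (\<lambda>v. a r (a l v))" by (rule linI) (simp_all add: lin_a_simps)
  show "a r (a l v) \<in> U" if "v \<in> U" for v using that lr by simp
  show "a r (a l (a i v)) = a i (a r (a l v))" if "l \<le> i" "i \<le> r" "v \<in> U" for i v
    using rel_right[of l i r v] rel_left[of l i r v] that by simp
qed

text \<open>If \<open>a\<^sub>r a\<^sub>l = 0\<close>, the ideal generated by \<open>a\<^sub>l\<close> is killed by \<open>a\<^sub>r\<close> from the left, because that ideal is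
  spanned by the elements \<open>a\<^sub>l w\<close> and \<open>a\<^sub>j a\<^sub>l w\<close>.\<close>

lemma outer_zero_exceptional:
  assumes zero: "\<And>v. v \<in> U \<Longrightarrow> a r (a l v) = 0"
  shows "exceptional_on a l r U"
proof (cases "\<forall>v\<in>U. a l v = 0")
  case True
  then show ?thesis using lr unfolding exceptional_on_def
    by (intro disjI1 bexI[of _ l] exI[of _ 0]) auto
next
  case False
  then obtain u where u: "u \<in> U" "a l u \<noteq> 0" by blast
  define G where "G = a l ` U \<union> (\<Union>j\<in>{l..r}. (\<lambda>v. a j (a l v)) ` U)"
  have GU: "span G \<subseteq> U"
    by (rule span_minimal) (auto simp: G_def subspace_U lr)
  have aG: "a i g \<in> G" if i: "l \<le> i" "i \<le> r" and "g \<in> G" for i g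
  proof -
    consider v where "v \<in> U" "g = a l v" | j v where "l \<le> j" "j \<le> r" "v \<in> U" "g = a j (a l v)"
      using \<open>g \<in> G\<close> unfolding G_def by auto
    then show ?thesis
    proof cases
      case 1
      then show ?thesis unfolding G_def using i by auto
    next
      case (2 j v)
      show ?thesis
      proof (cases "i \<le> j")
        case True
        have "a i g = a j (a l (a i v))"
          unfolding 2(4) using rel_right[OF order_refl i(1) True 2(2,3)]
            rel_left[OF order_refl i(1) True 2(2,3)] by (rule trans)
        moreover have "a j (a l (a i v)) \<in> G"
          unfolding G_def using 2 i by (intro UnI2 UN_I[of j] imageI) auto
        ultimately show ?thesis by simp
      next
        case False
        then have "a i g = a i (a l (a j v))"
          unfolding 2(4) using 2 i by (intro rel_left) auto
        moreover have "a i (a l (a j v)) \<in> G"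
          unfolding G_def using 2 i by (intro UnI2 UN_I[of i] imageI) auto
        ultimately show ?thesis by simp
      qed
    qed
  qed
  have "span G = U"
  proof (rule U_irreducible[OF subspace_span GU])
    show "a l u \<in> span G" "a l u \<noteq> 0" using u by (auto simp: G_def intro: span_base)
    fix i v assume i: "l \<le> i" "i \<le> r" and v: "v \<in> span G"
    have "span G \<subseteq> {v. a i v \<in> span G}"
    proof (rule span_minimal)
      show "G \<subseteq> {v. a i v \<in> span G}" using span_base aG[OF i] by blast
      show "subspace {v. a i v \<in> span G}" using lin_a subspace_span by (rule subspace_vimage)
    qed
    then show "a i v \<in> span G" using v by blast
  qed
  moreover have "span G \<subseteq> {v. a r v = 0}"
  proof (rule span_minimal)
    have "a r (a j (a l v)) = 0" if "l \<le> j" "j \<le> r" "v \<in> U" for j v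
      using rel_right[of l j r v] that zero by (simp add: lin_a_simps)
    then show "G \<subseteq> {v. a r v = 0}" unfolding G_def using zero by auto
  qed (intro subspace_kernel lin_a)
  ultimately have "\<forall>v\<in>U. a r v = 0 *s v" by auto
  then show ?thesis using lr unfolding exceptional_on_def
    by (intro disjI1 bexI[of _ r] exI[of _ 0]) auto
qed

lemma commutative_exceptional:
  assumes "\<And>i v. l \<le> i \<Longrightarrow> i \<le> r \<Longrightarrow> v \<in> U \<Longrightarrow> a l (a i v) = a i (a l v)"
  shows "exceptional_on a l r U"
proof -
  obtain c where "\<forall>v\<in>U. a l v = c *s v"
    using commuting_scalar[OF lin_a, of l] assms lr by auto
  then show ?thesis using lr unfolding exceptional_on_def
    by (intro disjI1 bexI[of _ l] exI[of _ c]) auto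
qed

lemma outer_nonzero_scalar:
  assumes "\<not> exceptional_on a l r U"
  obtains c where "c \<noteq> 0" "\<And>v. v \<in> U \<Longrightarrow> a r (a l v) = c *s v" "l < r"
proof -
  obtain c where c: "\<forall>v\<in>U. a r (a l v) = c *s v" using outer_scalar by blast
  moreover have "c \<noteq> 0" using outer_zero_exceptional assms c by auto
  moreover have "l \<noteq> r" using commutative_exceptional assms lr by auto
  ultimately show ?thesis using that lr by auto
qed

end

text \<open>
  The situation of a nonzero scalar \<open>a\<^sub>r a\<^sub>l\<close>.  Then \<open>e = 1 - x y\<close> is the projection onto \<open>E = ker y\<close>
  along the image of \<open>x\<close>, and \<open>A\<^sub>j = e a\<^sub>j e\<close>, \<open>B\<^sub>j = e y a\<^sub>j e\<close>, \<open>C\<^sub>j = e a\<^sub>j x e\<close> as operators on \<open>E\<close>.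
\<close>

locale toeplitz_operators = chinese_operators scale a l r U
  for scale :: "'a::alg_closed_field \<Rightarrow> 'b::ab_group_add \<Rightarrow> 'b" (infixr \<open>*s\<close> 75)
    and a :: "nat \<Rightarrow> 'b \<Rightarrow> 'b" and l r :: nat and U :: "'b set" +
  fixes lam :: 'a
  assumes lam: "lam \<noteq> 0" and outer: "v \<in> U \<Longrightarrow> a r (a l v) = lam *s v"
    and not_exceptional: "\<not> exceptional_on a l r U" and l_less_r: "l < r"
begin

abbreviation x :: "'b \<Rightarrow> 'b" where "x \<equiv> a l"

definition y :: "'b \<Rightarrow> 'b" where "y v = inverse lam *s a r v"

definition e :: "'b \<Rightarrow> 'b" where "e v = v - x (y v)"

definition E :: "'b set" where "E = {v \<in> U. y v = 0}"

definition A :: "nat \<Rightarrow> 'b \<Rightarrow> 'b" where "A j v = e (a j v)"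

definition B :: "nat \<Rightarrow> 'b \<Rightarrow> 'b" where "B j v = y (a j v)"

definition C :: "nat \<Rightarrow> 'b \<Rightarrow> 'b" where "C j v = e (a j (x v))"

lemma lin_y: "lin y"
  by (rule linI) (simp_all add: y_def lin_a_simps scale_right_distrib mult.commute)

lemma lin_e: "lin e"
  by (rule linI) (simp_all add: e_def lin_a_simps lin_simps[OF lin_y] scale_right_diff_distrib)

lemma lin_A: "lin (A j)"
  by (rule linI) (simp_all add: A_def lin_a_simps lin_simps[OF lin_e])

lemma lin_B: "lin (B j)"
  by (rule linI) (simp_all add: B_def lin_a_simps lin_simps[OF lin_y])

lemma lin_C: "lin (C j)"
  by (rule linI) (simp_all add: C_def lin_a_simps lin_simps[OF lin_e])

lemmas lin_xy = lin_a_simps lin_simps[OF lin_y] lin_simps[OF lin_e]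
lemmas lin_coeff = lin_simps[OF lin_A] lin_simps[OF lin_B] lin_simps[OF lin_C]

lemma x_U [simp]: "v \<in> U \<Longrightarrow> x v \<in> U"
  using lr by simp

lemma y_U [simp]: "v \<in> U \<Longrightarrow> y v \<in> U"
  using lr by (simp add: y_def subspace_scale[OF subspace_U])

lemma yx [simp]: "v \<in> U \<Longrightarrow> y (x v) = v"
  using lam by (simp add: y_def outer)

lemma E_U: "v \<in> E \<Longrightarrow> v \<in> U" and y_E: "v \<in> E \<Longrightarrow> y v = 0"
  by (simp_all add: E_def)

lemma subspace_E: "subspace E"
  unfolding E_def by (intro subspace_Collect_conj subspace_U subspace_kernel lin_y)

lemma e_E: "v \<in> U \<Longrightarrow> e v \<in> E"
  by (simp add: E_def e_def lin_xy subspace_diff[OF subspace_U])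

lemma e_on_E: "v \<in> E \<Longrightarrow> e v = v"
  by (simp add: e_def y_E lin_xy)

lemma e_x: "v \<in> U \<Longrightarrow> e (x v) = 0"
  by (simp add: e_def lin_xy)

lemma split_e: "v = e v + x (y v)"
  by (simp add: e_def)

lemma a_split: "a j v = A j v + x (B j v)"
  unfolding A_def B_def by (rule split_e)

lemma split_unique:
  assumes "p + x u = q + x w" "p \<in> E" "q \<in> E" "u \<in> U" "w \<in> U"
  shows "p = q" "u = w"
proof -
  have "y (p + x u) = y (q + x w)" using assms(1) by simp
  then show "u = w" using assms(2-) by (simp add: lin_xy y_E)
  then show "p = q" using assms(1) by simp
qed

context
  fixes j assumes j: "l \<le> j" "j \<le> r"
begin

lemma A_E: "v \<in> U \<Longrightarrow> A j v \<in> E"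
  unfolding A_def using j by (intro e_E) simp

lemma C_E: "v \<in> U \<Longrightarrow> C j v \<in> E"
  unfolding C_def using j by (intro e_E) simp

lemma B_E: assumes "v \<in> E" shows "B j v \<in> E"
proof -
  have "y (y (a j v)) = y (a j (y v))"
    using rel_left[of j r r v] E_U[OF assms] j by (simp add: y_def lin_xy)
  then show ?thesis using E_U[OF assms] y_E[OF assms] j by (simp add: E_def B_def lin_xy)
qed

text \<open>Exchanging \<open>a\<^sub>j\<close> with \<open>x\<close> costs only a vector of \<open>E\<close>, because \<open>y (a\<^sub>j x - x a\<^sub>j) = 0\<close>.\<close>

lemma a_x: assumes "v \<in> U" shows "a j (x v) = C j v + x (a j v)"
proof -
  have "y (a j (x v)) = y (x (a j v))"
    using rel_left[of l j r v] assms j by (simp add: y_def)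
  then show ?thesis using assms j by (simp add: C_def e_def)
qed

lemma C_x: assumes "v \<in> U" shows "C j (x v) = 0"
proof -
  have "a j (x (x v)) = x (a j (x v))"
    using rel_right[of l l j v] assms j by simp
  then show ?thesis unfolding C_def using e_x assms j by simp
qed

lemma C_e: assumes "v \<in> U" shows "C j v = C j (e v)"
proof -
  have "C j v = C j (e v + x (y v))" by (rule arg_cong[OF split_e])
  then show ?thesis using C_x[of "y v"] assms by (simp add: lin_coeff)
qed

end

text \<open>
  After \<open>y\<close> and before \<open>x\<close> all generators commute.  Expanding these two statements in components
  along \<open>E\<close>, \<open>x E\<close>, \<open>x\<^sup>2 E\<close> yields the symmetric part of the coefficient relations.
\<close>

lemma y_commute: "\<lbrakk>l \<le> i; i \<le> r; l \<le> j; j \<le> r; v \<in> U\<rbrakk> \<Longrightarrow> y (a i (a j v)) = y (a j (a i v))"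
  using rel_left[of i j r v] rel_left[of j i r v] by (cases "i \<le> j") (auto simp: y_def)

lemma commute_x: "\<lbrakk>l \<le> i; i \<le> r; l \<le> j; j \<le> r; v \<in> U\<rbrakk> \<Longrightarrow> a i (a j (x v)) = a j (a i (x v))"
  using rel_right[of l i j v] rel_right[of l j i v] by (cases "i \<le> j") auto

lemma split_aa:
  assumes "l \<le> i" "i \<le> r" "l \<le> j" "j \<le> r" "v \<in> E"
  shows "a i (a j v) = (A i (A j v) + C i (B j v)) + x ((B i (A j v) + A i (B j v)) + x (B i (B j v)))"
proof -
  have "a i (a j v) = a i (A j v) + a i (x (B j v))"
    using arg_cong[OF a_split, of "a i" j v] by (simp add: lin_xy)
  also have "a i (x (B j v)) = C i (B j v) + x (a i (B j v))"
    using a_x[OF assms(1,2)] B_E[OF assms(3-5)] E_U by blast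
  finally show ?thesis
    using a_split[of i "A j v"] a_split[of i "B j v"] assms by (simp add: lin_xy algebra_simps)
qed

lemma split_aax:
  assumes "l \<le> i" "i \<le> r" "l \<le> j" "j \<le> r" "v \<in> E"
  shows "a i (a j (x v)) = (A i (C j v) + C i (A j v)) + x (B i (C j v) + a i (a j v))"
proof -
  have v: "v \<in> U" using E_U assms by blast
  have "a i (a j (x v)) = a i (C j v) + a i (x (a j v))"
    using a_x[OF assms(3,4) v] by (simp add: lin_xy)
  also have "a i (x (a j v)) = C i (a j v) + x (a i (a j v))"
    using a_x[OF assms(1,2)] v assms by simp
  also have "C i (a j v) = C i (A j v)"
    unfolding A_def using C_e[OF assms(1,2)] v assms by simp
  finally show ?thesis using a_split[of i "C j v"] assms by (simp add: lin_xy algebra_simps)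
qed

context
  fixes i j v
  assumes ind: "l \<le> i" "i \<le> r" "l \<le> j" "j \<le> r" and v: "v \<in> E"
begin

lemma vU: "v \<in> U"
  using v by (rule E_U)

lemma coeff_E:
  "A i v \<in> E" "A j v \<in> E" "B i v \<in> E" "B j v \<in> E" "C i v \<in> E" "C j v \<in> E"
  by (intro A_E B_E C_E ind v vU)+

lemma BA_BB_sym:
  "B i (A j v) + A i (B j v) = B j (A i v) + A j (B i v)"
  "B i (B j v) = B j (B i v)"
proof -
  have E: "B i (A j v) + A i (B j v) \<in> E" "B j (A i v) + A j (B i v) \<in> E"
    "B i (B j v) \<in> E" "B j (B i v) \<in> E"
    "A i (A j v) + C i (B j v) \<in> E" "A j (A i v) + C j (B i v) \<in> E"
    by (intro subspace_add[OF subspace_E] A_E B_E C_E E_U ind v)+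
  have y: "y (p + x u) = u" if "p \<in> E" "u \<in> U" for p u
    using that by (simp add: lin_xy y_E)
  have "(B i (A j v) + A i (B j v)) + x (B i (B j v)) = (B j (A i v) + A j (B i v)) + x (B j (B i v))"
  proof -
    have "y (a i (a j v)) = (B i (A j v) + A i (B j v)) + x (B i (B j v))"
      unfolding split_aa[OF ind v]
      by (rule y) (intro E E_U[OF E(1)] subspace_add[OF subspace_U] x_U E_U[OF E(3)])+
    moreover have "y (a j (a i v)) = (B j (A i v) + A j (B i v)) + x (B j (B i v))"
      unfolding split_aa[OF ind(3,4,1,2) v]
      by (rule y) (intro E E_U[OF E(2)] subspace_add[OF subspace_U] x_U E_U[OF E(4)])+
    ultimately show ?thesis using y_commute[OF ind vU] by simp
  qed
  note split_unique[OF this E(1,2) E_U[OF E(3)] E_U[OF E(4)]]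
  then show "B i (A j v) + A i (B j v) = B j (A i v) + A j (B i v)" "B i (B j v) = B j (B i v)" .
qed

lemma AC_sym_BC_sym:
  "A i (C j v) + C i (A j v) = A j (C i v) + C j (A i v)"
  "B i (C j v) + A i (A j v) + C i (B j v) = B j (C i v) + A j (A i v) + C j (B i v)"
proof -
  have E: "A i (C j v) + C i (A j v) \<in> E" "A j (C i v) + C j (A i v) \<in> E"
    "B i (C j v) \<in> E" "B j (C i v) \<in> E" "A i (A j v) + C i (B j v) \<in> E" "A j (A i v) + C j (B i v) \<in> E"
    by (intro subspace_add[OF subspace_E] A_E B_E C_E E_U ind v)+
  have "(A i (C j v) + C i (A j v)) + x (B i (C j v) + a i (a j v)) =
    (A j (C i v) + C j (A i v)) + x (B j (C i v) + a j (a i v))"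
    using commute_x[OF ind vU] unfolding split_aax[OF ind v] split_aax[OF ind(3,4,1,2) v] .
  note * = split_unique[OF this E(1,2) subspace_add[OF subspace_U] subspace_add[OF subspace_U],
      OF E_U[OF E(3)] a_U[OF ind(1,2) a_U[OF ind(3,4) vU]]
        E_U[OF E(4)] a_U[OF ind(3,4) a_U[OF ind(1,2) vU]]]
  show "A i (C j v) + C i (A j v) = A j (C i v) + C j (A i v)" by (rule *)
  have "B j (C i v) - B i (C j v) = a i (a j v) - a j (a i v)"
    using *(2) by (simp add: algebra_simps)
  also have "a i (a j v) - a j (a i v) = (A i (A j v) + C i (B j v)) - (A j (A i v) + C j (B i v))"
    unfolding split_aa[OF ind v] split_aa[OF ind(3,4,1,2) v] BA_BB_sym by simp
  finally show "B i (C j v) + A i (A j v) + C i (B j v) = B j (C i v) + A j (A i v) + C j (B i v)"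
    by (simp add: algebra_simps)
qed

lemma CC_sym: "C i (C j v) = C j (C i v)"
proof -
  have "C i (C j v) + x (a i (a j (x v))) = a i (a j (x (x v)))"
    if "l \<le> i" "i \<le> r" "l \<le> j" "j \<le> r" for i j
  proof -
    have "a i (a j (x (x v))) = a i (x (a j (x v)))"
      using a_x[OF that(3,4), of "x v"] C_x[OF that(3,4) vU] vU by simp
    also have "\<dots> = C i (a j (x v)) + x (a i (a j (x v)))"
      using a_x[OF that(1,2), of "a j (x v)"] vU that by simp
    also have "C i (a j (x v)) = C i (C j v)"
      using C_e[OF that(1,2), of "a j (x v)"] vU that by (simp add: C_def)
    finally show ?thesis by simp
  qed
  from this[OF ind] this[OF ind(3,4,1,2)] commute_x[OF ind x_U[OF vU]] commute_x[OF ind vU]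
  have "C i (C j v) + x (a j (a i (x v))) = C j (C i v) + x (a j (a i (x v)))" by simp
  then show ?thesis by (rule add_right_imp_eq)
qed

text \<open>
  The remaining relations reflect the order of the indices: \<open>(a\<^sub>j y - y a\<^sub>j) a\<^sub>i = 0\<close> for \<open>i \<le> j\<close>, applied
  to \<open>v\<close> and to \<open>x v\<close>, and \<open>a\<^sub>j (a\<^sub>i x - x a\<^sub>i) = 0\<close> in the next lemma.
\<close>

lemma BA_BC_zero:
  assumes "i \<le> j"
  shows "B j (A i v) = 0" "B j (C i v) = 0"
proof -
  have comm: "a j (y (a i u)) = y (a j (a i u))" if "u \<in> U" for u
    using rel_right[of i j r u] that ind assms by (simp add: y_def lin_xy)
  have E: "B j (A i v) \<in> E" "A j (B i v) \<in> E" "B j (B i v) \<in> E" "A j (A i v) + C j (B i v) \<in> E"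
    by (intro subspace_add[OF subspace_E] A_E B_E C_E E_U ind v)+
  have "y (a j (a i v)) = B j (A i v) + A j (B i v) + x (B j (B i v))"
    unfolding split_aa[OF ind(3,4,1,2) v] lin_add[OF lin_y, of "A j (A i v) + C j (B i v)"] y_E[OF E(4)]
    using E E_U by (simp add: subspace_add[OF subspace_U])
  moreover have "a j (y (a i v)) = A j (B i v) + x (B j (B i v))"
    using a_split[of j "B i v"] by (simp add: B_def)
  ultimately show "B j (A i v) = 0" using comm[OF vU] by simp
  have AC: "A j (C i v) + C j (A i v) \<in> E" "B j (C i v) \<in> E"
    by (intro subspace_add[OF subspace_E] A_E B_E C_E E_U ind v)+
  have "y (a j (a i (x v))) = B j (C i v) + a j (a i v)"
    unfolding split_aax[OF ind(3,4,1,2) v] lin_add[OF lin_y, of "A j (C i v) + C j (A i v)"] y_E[OF AC(1)]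
    using E_U[OF AC(2)] vU ind by (simp add: subspace_add[OF subspace_U])
  moreover have "a j (y (a i (x v))) = a j (a i v)"
  proof -
    have "y (a i (x v)) = a i v"
      unfolding a_x[OF ind(1,2) vU] using coeff_E vU ind by (simp add: lin_xy y_E)
    then show ?thesis by simp
  qed
  ultimately show "B j (C i v) = 0" using comm[of "x v"] vU by simp
qed

lemma AC_zero:
  assumes "i \<le> j"
  shows "A j (C i v) = 0"
proof -
  have "a j (C i v) = a j (a i (x v)) - a j (x (a i v))"
    using a_x[OF ind(1,2) vU] by (simp add: lin_xy)
  also have "\<dots> = 0" using rel_left[of l i j v] assms ind vU by simp
  finally show ?thesis by (simp add: A_def lin_xy)
qed

end

lemma span_powers:
  assumes N: "subspace N" "N \<subseteq> E" "u \<in> N" "u \<noteq> 0"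
    and ABC: "\<And>j v. l < j \<Longrightarrow> j < r \<Longrightarrow> v \<in> N \<Longrightarrow> A j v \<in> N \<and> B j v \<in> N \<and> C j v \<in> N"
  shows "span (\<Union>k. (x ^^ k) ` N) = U"
proof -
  define G where "G = (\<Union>k. (x ^^ k) ` N)"
  have powG: "(x ^^ k) v \<in> span G" if "v \<in> N" for k v
    using that unfolding G_def by (auto intro: span_base)
  have NU: "v \<in> U" if "v \<in> N" for v using that N E_U by blast
  have powU: "(x ^^ k) v \<in> U" if "v \<in> N" for k v
    using NU[OF that] by (induction k) auto
  have closedI: "f v \<in> span G" if "lin f" "\<And>k w. w \<in> N \<Longrightarrow> f ((x ^^ k) w) \<in> span G" "v \<in> span G" for f v
  proof -
    have "span G \<subseteq> {v. f v \<in> span G}"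
      by (rule span_minimal) (use that in \<open>auto simp: G_def intro!: subspace_vimage\<close>)
    then show ?thesis using that(3) by blast
  qed
  have xG: "x v \<in> span G" if "v \<in> span G" for v
  proof (rule closedI[OF lin_a _ that])
    show "x ((x ^^ k) w) \<in> span G" if "w \<in> N" for k w
      using powG[OF that, of "Suc k"] by simp
  qed
  have yG: "y v \<in> span G" if "v \<in> span G" for v
  proof (rule closedI[OF lin_y _ that])
    show "y ((x ^^ k) w) \<in> span G" if "w \<in> N" for k w
    proof (cases k)
      case 0
      then show ?thesis using that N y_E by (auto simp: span_zero)
    next
      case (Suc k')
      then show ?thesis using powG[OF that] powU[OF that] by simp
    qed
  qed
  have aG: "a j v \<in> span G" if j: "l < j" "j < r" and "v \<in> span G" for j v
  proof (rule closedI[OF lin_a _ that(3)])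
    have j': "l \<le> j" "j \<le> r" using j by auto
    show "a j ((x ^^ k) w) \<in> span G" if w: "w \<in> N" for k w
    proof (induction k)
      case 0
      have "A j w + x (B j w) \<in> span G"
        using powG[of "A j w" 0] powG[of "B j w" 0] ABC[OF j w] by (auto intro!: span_add xG)
      then show ?case using a_split[of j w] by simp
    next
      case (Suc k)
      have "C j ((x ^^ k) w) \<in> span G"
      proof (cases k)
        case 0
        then show ?thesis using powG[of "C j w" 0] ABC[OF j w] by simp
      next
        case (Suc k')
        then show ?thesis using C_x[OF j'] powU[OF w] by (simp add: span_zero)
      qed
      then show ?case using a_x[OF j' powU[OF w]] Suc by (auto intro!: span_add xG)
    qed
  qed
  have "span G \<subseteq> U" by (rule span_minimal) (use powU in \<open>auto simp: G_def subspace_U\<close>)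
  then have "span G = U"
  proof (rule U_irreducible[OF subspace_span])
    show "u \<in> span G" using powG[OF N(3), of 0] by simp
    show "u \<noteq> 0" by fact
    fix i v assume i: "l \<le> i" "i \<le> r" and v: "v \<in> span G"
    consider "i = l" | "l < i" "i < r" | "i = r" using i by linarith
    then show "a i v \<in> span G"
    proof cases
      case 3
      have "a r v = lam *s y v" using lam by (simp add: y_def)
      then show ?thesis using 3 yG[OF v] by (simp add: span_scale)
    qed (use xG aG v in auto)
  qed
  then show ?thesis unfolding G_def .
qed

text \<open>If \<open>E = 0\<close>, then \<open>x\<close> is surjective, so all generators commute with \<open>x\<close> and \<open>x\<close> is a scalar.\<close>

lemma E_nontrivial: "\<exists>v\<in>E. v \<noteq> 0"
proof (rule ccontr)
  assume no: "\<not> ?thesis"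
  have xy: "x (y v) = v" if "v \<in> U" for v
  proof -
    have "e v = 0" using no e_E[OF that] by blast
    then show ?thesis by (simp add: e_def)
  qed
  have "x (a i v) = a i (x v)" if "l \<le> i" "i \<le> r" "v \<in> U" for i v
    using commute_x[of l i "y v"] xy[of v] that lr by simp
  then show False using commutative_exceptional not_exceptional by blast
qed

text \<open>
  For a nonzero stable \<open>N \<subseteq> E\<close> the sum of the \<open>x\<^sup>k N\<close> is \<open>U\<close>, and the projection \<open>e\<close> of \<open>U\<close> onto \<open>E\<close>
  maps this sum to \<open>N\<close>.
\<close>

lemma E_irreducible:
  "irreducible_on (A ` {l<..<r} \<union> B ` {l<..<r} \<union> C ` {l<..<r}) E"
  unfolding irreducible_on_def
proof (intro conjI allI impI)
  show "\<forall>f\<in>A ` {l<..<r} \<union> B ` {l<..<r} \<union> C ` {l<..<r}. \<forall>v\<in>E. f v \<in> E"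
    using A_E B_E C_E E_U by auto
  fix N assume N: "subspace N" "N \<subseteq> E"
    and st: "\<forall>f\<in>A ` {l<..<r} \<union> B ` {l<..<r} \<union> C ` {l<..<r}. \<forall>v\<in>N. f v \<in> N"
  show "N \<subseteq> {0} \<or> N = E"
  proof (cases "N \<subseteq> {0}")
    case False
    then obtain u where u: "u \<in> N" "u \<noteq> 0" by blast
    have sp: "span (\<Union>k. (x ^^ k) ` N) = U"
      by (rule span_powers[OF N u]) (use st in auto)
    have "span (\<Union>k. (x ^^ k) ` N) \<subseteq> {v. e v \<in> N}"
    proof (rule span_minimal)
      show "(\<Union>k. (x ^^ k) ` N) \<subseteq> {v. e v \<in> N}"
      proof clarify
        fix k w assume w: "w \<in> N"
        show "e ((x ^^ k) w) \<in> N"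
        proof (cases k)
          case 0
          then show ?thesis using w N e_on_E by auto
        next
          case (Suc k')
          have "(x ^^ k') w \<in> U" using w N E_U by (induction k') auto
          then show ?thesis using Suc e_x subspace_0[OF N(1)] by simp
        qed
      qed
    qed (intro subspace_vimage lin_e N)
    then have "E \<subseteq> N" using sp E_U e_on_E by fastforce
    then show ?thesis using N by blast
  qed simp
qed (use E_nontrivial subspace_E in auto)

lemma U_induct:
  assumes "subspace P" "E \<subseteq> P" "\<And>v. v \<in> U \<Longrightarrow> v \<in> P \<Longrightarrow> x v \<in> P"
  shows "U \<subseteq> P"
proof -
  from E_nontrivial obtain u where u: "u \<in> E" "u \<noteq> 0" by blast
  have "span (\<Union>k. (x ^^ k) ` E) = U"
    by (rule span_powers[OF subspace_E order_refl u]) (use A_E B_E C_E E_U in auto)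
  moreover have "(x ^^ k) v \<in> P \<and> (x ^^ k) v \<in> U" if "v \<in> E" for k v
    using that assms(2,3) E_U by (induction k) auto
  then have "span (\<Union>k. (x ^^ k) ` E) \<subseteq> P"
    by (intro span_minimal assms(1)) auto
  ultimately show ?thesis by simp
qed

lemma E_commuting_scalar:
  assumes "lin T" "\<And>v. v \<in> E \<Longrightarrow> T v \<in> E"
    and "\<And>i v. \<lbrakk>l < i; i < r; v \<in> E\<rbrakk> \<Longrightarrow>
      T (A i v) = A i (T v) \<and> T (B i v) = B i (T v) \<and> T (C i v) = C i (T v)"
  shows "\<exists>c. \<forall>v\<in>E. T v = c *s v"
proof (rule schur_uncountable[OF E_irreducible])
  show "countable (A ` {l<..<r} \<union> B ` {l<..<r} \<union> C ` {l<..<r})" by simp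
  show "lin f" if "f \<in> A ` {l<..<r} \<union> B ` {l<..<r} \<union> C ` {l<..<r}" for f
    using that lin_A lin_B lin_C by auto
qed (use assms in auto)

text \<open>
  If \<open>A\<^sub>m = C\<^sub>m = 0\<close>, the coefficient relations make \<open>B\<^sub>m\<close> commute with all coefficients.  So \<open>B\<^sub>m\<close> is a
  scalar and \<open>a\<^sub>m\<close> is proportional to its neighbour \<open>x\<close>.
\<close>

lemma first_nondegenerate:
  assumes "l + 1 < r"
  shows "\<exists>v\<in>E. A (l + 1) v \<noteq> 0 \<or> C (l + 1) v \<noteq> 0"
proof (rule ccontr)
  define m where "m = l + 1"
  have m: "l \<le> m" "m \<le> r" "l < m" using assms unfolding m_def by auto
  assume "\<not> ?thesis"
  then have zero: "A m v = 0" "C m v = 0" if "v \<in> E" for v using that unfolding m_def by auto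
  have "\<exists>c. \<forall>v\<in>E. B m v = c *s v"
  proof (rule E_commuting_scalar[OF lin_B])
    show "B m v \<in> E" if "v \<in> E" for v using B_E[OF m(1,2)] that .
    fix i v assume i: "l < i" "i < r" and v: "v \<in> E"
    then have i': "l \<le> i" "i \<le> r" by auto
    note E = A_E[OF i' E_U[OF v]] B_E[OF i' v] C_E[OF i' E_U[OF v]]
    show "B m (A i v) = A i (B m v) \<and> B m (B i v) = B i (B m v) \<and> B m (C i v) = C i (B m v)"
      using BA_BB_sym[OF m(1,2) i' v] AC_sym_BC_sym[OF m(1,2) i' v] zero v E
      by (simp add: lin_coeff)
  qed
  then obtain c where c: "\<And>v. v \<in> E \<Longrightarrow> B m v = c *s v" by blast
  have "U \<subseteq> {v. a m v = c *s x v}"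
  proof (rule U_induct)
    show "subspace {v. a m v = c *s x v}"
      by (intro subspace_equalizer lin_a lin_scaled)
    show "E \<subseteq> {v. a m v = c *s x v}"
      using a_split[of m] zero c by (auto simp: lin_xy)
    show "x v \<in> {v. a m v = c *s x v}" if "v \<in> U" "v \<in> {v. a m v = c *s x v}" for v
      using a_x[OF m(1,2) that(1)] C_e[OF m(1,2) that(1)] zero(2)[OF e_E[OF that(1)]] that
      by (simp add: lin_xy)
  qed
  then have "\<forall>v\<in>U. 1 *s a m v = c *s a (m - 1) v" unfolding m_def by auto
  then have "exceptional_on a l r U"
    unfolding exceptional_on_def using m
    by (intro disjI2 bexI[of _ m] exI[of _ 1] exI[of _ c]) auto
  then show False using not_exceptional by blast
qed

text \<open>Likewise \<open>A\<^sub>p = B\<^sub>p = 0\<close> makes \<open>a\<^sub>p\<close> proportional to its neighbour \<open>a\<^sub>r\<close>.\<close>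

lemma last_nondegenerate:
  assumes "l + 1 < r"
  shows "\<exists>v\<in>E. A (r - 1) v \<noteq> 0 \<or> B (r - 1) v \<noteq> 0"
proof (rule ccontr)
  define p where "p = r - 1"
  have p: "l \<le> p" "p \<le> r" "p < r" using assms unfolding p_def by auto
  assume "\<not> ?thesis"
  then have zero: "A p v = 0" "B p v = 0" if "v \<in> E" for v using that unfolding p_def by auto
  have "\<exists>c. \<forall>v\<in>E. C p v = c *s v"
  proof (rule E_commuting_scalar[OF lin_C])
    show "C p v \<in> E" if "v \<in> E" for v using C_E[OF p(1,2)] that E_U by blast
    fix i v assume i: "l < i" "i < r" and v: "v \<in> E"
    then have i': "l \<le> i" "i \<le> r" by auto
    note E = A_E[OF i' E_U[OF v]] B_E[OF i' v] C_E[OF i' E_U[OF v]]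
    show "C p (A i v) = A i (C p v) \<and> C p (B i v) = B i (C p v) \<and> C p (C i v) = C i (C p v)"
      using AC_sym_BC_sym[OF p(1,2) i' v] CC_sym[OF p(1,2) i' v] zero v E
      by (simp add: lin_coeff)
  qed
  then obtain c where c: "\<And>v. v \<in> E \<Longrightarrow> C p v = c *s v" by blast
  have "U \<subseteq> {v. a p v = c *s y v}"
  proof (rule U_induct)
    show "subspace {v. a p v = c *s y v}"
      by (intro subspace_equalizer lin_a lin_scaled lin_y)
    show "E \<subseteq> {v. a p v = c *s y v}"
      using a_split[of p] zero y_E by (auto simp: lin_xy)
    show "x v \<in> {v. a p v = c *s y v}" if v: "v \<in> U" "v \<in> {v. a p v = c *s y v}" for v
    proof -
      have "a p (x v) = c *s e v + x (c *s y v)"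
        using a_x[OF p(1,2) v(1)] C_e[OF p(1,2) v(1)] c[OF e_E[OF v(1)]] v(2) by simp
      also have "\<dots> = c *s (e v + x (y v))" by (simp add: lin_xy scale_right_distrib)
      also have "\<dots> = c *s v" by (simp add: e_def)
      finally show ?thesis using v by simp
    qed
  qed
  then have "\<forall>v\<in>U. (c * inverse lam) *s a r v = 1 *s a (r - 1) v" unfolding p_def y_def by auto
  then have "exceptional_on a l r U"
    unfolding exceptional_on_def using p
    by (intro disjI2 bexI[of _ r] exI[of _ "c * inverse lam"] exI[of _ 1]) auto
  then show False using not_exceptional by blast
qed

lemma coefficients:
  assumes "l + 1 < r"
  shows "toeplitz_coefficients scale A B C E (l + 1) (r - 1)"
proof -
  have I: "{l + 1..r - 1} = {l<..<r}" using assms by auto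
  show ?thesis
  proof (intro toeplitz_coefficients.intro uncountable_vector_space_axioms
      toeplitz_coefficients_axioms.intro, unfold I)
    show "irreducible_on (A ` {l<..<r} \<union> B ` {l<..<r} \<union> C ` {l<..<r}) E"
      by (rule E_irreducible)
    fix i j v assume "i \<in> {l<..<r}" "j \<in> {l<..<r}" and v: "v \<in> E"
    then have ij: "l \<le> i" "i \<le> r" "l \<le> j" "j \<le> r" by auto
    show "B i (B j v) = B j (B i v)" using BA_BB_sym[OF ij v] by blast
    show "C i (C j v) = C j (C i v)" using CC_sym[OF ij v] .
    assume le: "i \<le> j"
    show BA0: "B j (A i v) = 0" and BC0: "B j (C i v) = 0" using BA_BC_zero[OF ij v le] .
    show AC0: "A j (C i v) = 0" using AC_zero[OF ij v le] .
    show "B i (A j v) = A j (B i v) - A i (B j v)"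
      using BA_BB_sym[OF ij v] BA0 by (simp add: algebra_simps)
    show "A i (C j v) = C j (A i v) - C i (A j v)"
      using AC_sym_BC_sym[OF ij v] AC0 by (simp add: algebra_simps)
    show "B i (C j v) = C j (B i v) - C i (B j v) - (A i (A j v) - A j (A i v))"
      using AC_sym_BC_sym[OF ij v] BC0 by (simp add: algebra_simps)
  qed (use assms in \<open>simp_all add: lin_A lin_B lin_C first_nondegenerate[simplified]
      last_nondegenerate[simplified]\<close>)
qed

end

section \<open>Nested arcs\<close>

context uncountable_vector_space
begin

lemma irreducible_on_cong:
  assumes "irreducible_on (f ` I) W" "\<And>i w. i \<in> I \<Longrightarrow> w \<in> W \<Longrightarrow> g i w = f i w"
  shows "irreducible_on (g ` I) W"
proof -
  have *: "(\<forall>h\<in>g ` I. \<forall>v\<in>N. h v \<in> N) \<longleftrightarrow> (\<forall>h\<in>f ` I. \<forall>v\<in>N. h v \<in> N)" if N: "N \<subseteq> W" for N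
  proof -
    have "g i v = f i v" if "i \<in> I" "v \<in> N" for i v using that N assms(2) by blast
    then show ?thesis by simp
  qed
  show ?thesis
    using assms(1) *[of W] * unfolding irreducible_on_def by simp
qed

text \<open>
  The indices \<open>q < t\<close> with \<open>q + t = l + r\<close> are joined by an arc, which carries the scalar \<open>mu q\<close>.  The
  vector \<open>v0\<close> is a vacuum: it is killed by every \<open>a\<^sub>t\<close> and by every product \<open>a\<^sub>t a\<^sub>j\<close> with \<open>j\<close> under the
  arc.  The second property comes from \<open>v0 \<in> W\<close> at each stage of the induction.  Both hold for the
  vector \<open>e\<^bsub>0,\<dots>,0\<^esub>\<close> of \<open>V(\<lambda>\<^sub>1, \<dots>, \<lambda>\<^sub>s)\<close>.
\<close>

definition nested_arcs ::
    "(nat \<Rightarrow> 'b \<Rightarrow> 'b) \<Rightarrow> nat \<Rightarrow> nat \<Rightarrow> 'b set \<Rightarrow> (nat \<Rightarrow> 'a) \<Rightarrow> 'b \<Rightarrow> bool" where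
  "nested_arcs a l r U mu v0 \<longleftrightarrow> v0 \<in> U \<and> v0 \<noteq> 0 \<and>
     (\<forall>q t. l \<le> q \<longrightarrow> q < t \<longrightarrow> t \<le> r \<longrightarrow> q + t = l + r \<longrightarrow>
        mu q \<noteq> 0 \<and> (\<forall>v\<in>U. a t (a q v) = mu q *s v) \<and>
        a t v0 = 0 \<and> (\<forall>j. q < j \<longrightarrow> j < t \<longrightarrow> a t (a j v0) = 0))"

end

context toeplitz_operators
begin

lemma a_x_commute:
  assumes j: "l \<le> j" "j \<le> r" and "\<And>v. v \<in> E \<Longrightarrow> C j v = 0" and v: "v \<in> U"
  shows "a j (x v) = x (a j v)"
  using a_x[OF j v] C_e[OF j v] assms(3)[OF e_E[OF v]] by simp

text \<open>\<open>U\<close> is obtained from \<open>E\<close> by applying \<open>x\<close>, and an operator with \<open>C\<^sub>j = 0\<close> commutes with \<open>x\<close>.\<close>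

lemma scalar_on_E_lifts:
  assumes j: "l \<le> j" "j \<le> r"
    and ABC: "\<And>v. v \<in> E \<Longrightarrow> A j v = c *s v" "\<And>v. v \<in> E \<Longrightarrow> B j v = 0" "\<And>v. v \<in> E \<Longrightarrow> C j v = 0"
    and "v \<in> U"
  shows "a j v = c *s v"
proof -
  have "U \<subseteq> {v. a j v = c *s v}"
  proof (rule U_induct)
    show "subspace {v. a j v = c *s v}" by (intro subspace_equalizer lin_a lin_scaled lin_ident)
    show "E \<subseteq> {v. a j v = c *s v}" using a_split[of j] ABC by (auto simp: lin_xy)
    show "x v \<in> {v. a j v = c *s v}" if "v \<in> U" "v \<in> {v. a j v = c *s v}" for v
      using a_x_commute[OF j ABC(3) that(1)] that by (simp add: lin_xy)
  qed
  then show ?thesis using assms(6) by blast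
qed

lemma proportional_on_E_lifts:
  assumes j: "l \<le> j" "j \<le> r" and k: "l \<le> k" "k \<le> r"
    and ABC: "\<And>v. v \<in> E \<Longrightarrow> c *s A j v = d *s A k v" "\<And>v. v \<in> E \<Longrightarrow> c *s B j v = d *s B k v"
      "\<And>v. v \<in> E \<Longrightarrow> c *s C j v = d *s C k v"
    and "v \<in> U"
  shows "c *s a j v = d *s a k v"
proof -
  have "U \<subseteq> {v. c *s a j v = d *s a k v}"
  proof (rule U_induct)
    show "subspace {v. c *s a j v = d *s a k v}" by (intro subspace_equalizer lin_a lin_scaled)
    show "E \<subseteq> {v. c *s a j v = d *s a k v}"
    proof clarify
      fix v assume v: "v \<in> E"
      have "c *s x (B j v) = d *s x (B k v)"
        using arg_cong[OF ABC(2)[OF v], of x] by (simp add: lin_xy)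
      then show "c *s a j v = d *s a k v"
        using ABC(1)[OF v] unfolding a_split[of j v] a_split[of k v]
        by (simp add: scale_right_distrib)
    qed
    show "x v \<in> {v. c *s a j v = d *s a k v}" if v: "v \<in> U" "v \<in> {v. c *s a j v = d *s a k v}" for v
    proof -
      from v(2) have "c *s a j v = d *s a k v" by simp
      from arg_cong[OF this, of x] have "c *s x (a j v) = d *s x (a k v)" by (simp add: lin_xy)
      moreover have "c *s C j v = d *s C k v"
        using ABC(3)[OF e_E[OF v(1)]] unfolding C_e[OF j v(1)] C_e[OF k v(1)] .
      ultimately show ?thesis
        using a_x[OF j v(1)] a_x[OF k v(1)] by (simp add: scale_right_distrib)
    qed
  qed
  then show ?thesis using assms(8) by blast
qed

context
  assumes l2: "l + 1 < r"
begin

interpretation T: toeplitz_coefficients scale A B C E "l + 1" "r - 1"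
  using l2 by (rule coefficients)

lemma W_U: "w \<in> T.W \<Longrightarrow> w \<in> U"
  using T.W_E E_U by blast

lemma a_on_W:
  assumes "i \<in> {l + 1..r - 1}" "w \<in> T.W"
  shows "a i w = A i w"
  using a_split[of i w] T.B_W[OF assms(2,1)] by (simp add: lin_xy)

lemma inner_chinese_operators: "chinese_operators scale a (l + 1) (r - 1) T.W"
proof (intro chinese_operators.intro uncountable_vector_space_axioms chinese_operators_axioms.intro)
  show "irreducible_on (a ` {l + 1..r - 1}) T.W"
    using T.W_irreducible a_on_W by (rule irreducible_on_cong)
  show "a j (a k (a i v)) = a k (a j (a i v))" "a k (a j (a i v)) = a k (a i (a j v))"
    if "l + 1 \<le> i" "i \<le> j" "j \<le> k" "k \<le> r - 1" "v \<in> T.W" for i j k v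
    using that rel_right[of i j k v] rel_left[of i j k v] W_U by simp_all
qed (use l2 lin_a in simp_all)

lemma inner_exceptional_lifts:
  assumes "exceptional_on a (l + 1) (r - 1) T.W"
  shows "exceptional_on a l r U"
proof -
  consider (scalar) i c where "i \<in> {l + 1..r - 1}" "\<forall>v\<in>T.W. a i v = c *s v"
    | (proportional) j c d where "j \<in> {l + 1<..r - 1}" "(c, d) \<noteq> (0, 0)"
        "\<forall>v\<in>T.W. c *s a j v = d *s a (j - 1) v"
    using assms unfolding exceptional_on_def by blast
  then show ?thesis
  proof cases
    case scalar
    then have "\<And>w. w \<in> T.W \<Longrightarrow> A i w = c *s w" using a_on_W by simp
    note lift = T.scalar_on_W_lifts[OF scalar(1) this]
    have "a i v = c *s v" if "v \<in> U" for v
      by (rule scalar_on_E_lifts) (use lift that scalar(1) in auto)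
    then show ?thesis unfolding exceptional_on_def using scalar(1)
      by (intro disjI1 bexI[of _ i] exI[of _ c]) auto
  next
    case proportional
    then have j: "j \<in> {l + 1..r - 1}" "j - 1 \<in> {l + 1..r - 1}" "j \<noteq> 0" by auto
    then have "\<And>w. w \<in> T.W \<Longrightarrow> c *s A j w = d *s A (j - 1) w"
      using a_on_W[OF j(1)] a_on_W[OF j(2)] proportional(3) by simp
    note lift = T.proportional_on_W_lifts[OF j this]
    have "c *s a j v = d *s a (j - 1) v" if "v \<in> U" for v
      by (rule proportional_on_E_lifts) (use lift that j in auto)
    then show ?thesis unfolding exceptional_on_def using proportional(1,2)
      by (intro disjI2 bexI[of _ j] exI[of _ c] exI[of _ d]) auto
  qed
qed

text \<open>
  For an inner arc the symbol of \<open>a\<^sub>t a\<^sub>q\<close> is the constant \<open>\<mu>\<^sub>q\<close>, so \<open>a\<^sub>t a\<^sub>q\<close> is this scalar on \<open>E\<close>; it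
  also commutes with \<open>x\<close>.  A vector of \<open>W\<close> is killed by \<open>a\<^sub>r\<close> and, since all \<open>B\<^sub>j\<close> vanish on it, by
  \<open>a\<^sub>r a\<^sub>j\<close>.  So the vacuum of \<open>W\<close> is one for \<open>U\<close>.
\<close>

lemma inner_arcs_lift:
  assumes arcs: "nested_arcs a (l + 1) (r - 1) T.W mu v0"
  shows "nested_arcs a l r U (mu(l := lam)) v0"
  unfolding nested_arcs_def
proof (intro conjI allI impI)
  have v0: "v0 \<in> T.W" "v0 \<noteq> 0" using arcs unfolding nested_arcs_def by auto
  then show "v0 \<in> U" "v0 \<noteq> 0" using W_U by auto
  have arcsD: "mu q \<noteq> 0" "\<And>v. v \<in> T.W \<Longrightarrow> a t (a q v) = mu q *s v" "a t v0 = 0"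
      "\<And>j. q < j \<Longrightarrow> j < t \<Longrightarrow> a t (a j v0) = 0"
    if "l + 1 \<le> q" "q < t" "t \<le> r - 1" "q + t = l + 1 + (r - 1)" for q t
  proof -
    have "\<forall>q t. l + 1 \<le> q \<longrightarrow> q < t \<longrightarrow> t \<le> r - 1 \<longrightarrow> q + t = l + 1 + (r - 1) \<longrightarrow>
        mu q \<noteq> 0 \<and> (\<forall>v\<in>T.W. a t (a q v) = mu q *s v) \<and>
        a t v0 = 0 \<and> (\<forall>j. q < j \<longrightarrow> j < t \<longrightarrow> a t (a j v0) = 0)"
      using arcs unfolding nested_arcs_def by (elim conjE)
    note * = this[rule_format, OF that]
    show "mu q \<noteq> 0" "a t v0 = 0" using * by simp_all
    show "a t (a q v) = mu q *s v" if "v \<in> T.W" for v using * that by simp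
    show "a t (a j v0) = 0" if "q < j" "j < t" for j using * that by simp
  qed
  have A_arcs: "A t (A q w) = mu q *s w"
    if "q \<in> {l + 1..r - 1}" "t \<in> {l + 1..r - 1}" "q < t" "q + t = l + 1 + (r - 1)" "w \<in> T.W" for q t w
    using arcsD(2)[of q t w] that a_on_W[of q w] a_on_W[of t "A q w"] T.A_W[OF that(5,1)] by simp
  have mu0: "mu q \<noteq> 0" if "q \<in> {l + 1..r - 1}" "2 * q < l + 1 + (r - 1)" for q
  proof -
    define t where "t = l + 1 + (r - 1) - q"
    have "l + 1 \<le> q" "q < t" "t \<le> r - 1" "q + t = l + 1 + (r - 1)"
      using that unfolding t_def by auto
    then show ?thesis by (rule arcsD(1))
  qed
  fix q t assume q: "l \<le> q" and qt: "q < t" and t: "t \<le> r" and sum: "q + t = l + r"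
  have out: "a r v = lam *s y v" for v using lam by (simp add: y_def)
  show "(mu(l := lam)) q \<noteq> 0" using mu0[of q] q qt sum lam by auto
  show "a t v0 = 0"
  proof (cases "q = l")
    case True
    then show ?thesis using sum out y_E[OF T.W_E[OF v0(1)]] by simp
  next
    case False
    then show ?thesis using arcsD(3)[of q t] q qt sum by simp
  qed
  show "a t (a j v0) = 0" if "q < j" "j < t" for j
  proof (cases "q = l")
    case True
    then have "B j v0 = 0" using T.B_W[OF v0(1), of j] that sum by simp
    then show ?thesis using True sum out by (simp add: B_def)
  next
    case False
    then show ?thesis using arcsD(4)[of q t j] that q qt sum by simp
  qed
  show "\<forall>v\<in>U. a t (a q v) = (mu(l := lam)) q *s v"
  proof (cases "q = l")
    case True
    then show ?thesis using outer sum by simp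
  next
    case False
    then have q': "q \<in> {l + 1..r - 1}" and t': "t \<in> {l + 1..r - 1}" and sum': "q + t = l + 1 + (r - 1)"
      using q qt sum l2 by auto
    have lr: "l \<le> q" "q \<le> r" "l \<le> t" "t \<le> r" using q qt t by auto
    have Cq: "C q v = 0" if "v \<in> E" for v
      by (rule T.C_lower[OF A_arcs mu0 q' _ that]) (use qt sum' in auto)
    have Bt: "B t v = 0" if "v \<in> E" for v
      by (rule T.B_upper[OF A_arcs mu0 t' _ that]) (use qt sum' in auto)
    have CA: "C t (A q v) = 0" if "v \<in> E" for v
      by (rule T.CA_arc[OF A_arcs mu0 q' t' qt sum' that])
    have AB: "A t (B q v) = 0" if "v \<in> E" for v
      by (rule T.AB_arc[OF A_arcs mu0 q' t' qt sum' that])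
    have arc: "A t (A q v) + C t (B q v) = mu q *s v" if "v \<in> E" for v
      by (rule T.arc_lifts[OF A_arcs mu0 q' t' qt sum' that])
    have "U \<subseteq> {v. a t (a q v) = mu q *s v}"
    proof (rule U_induct)
      show "subspace {v. a t (a q v) = mu q *s v}"
        by (intro subspace_equalizer lin_comp[OF lin_a lin_a] lin_scaled lin_ident)
      show "E \<subseteq> {v. a t (a q v) = mu q *s v}"
      proof clarify
        fix v assume v: "v \<in> E"
        show "a t (a q v) = mu q *s v"
          unfolding split_aa[OF lr(3,4,1,2) v] arc[OF v] AB[OF v] Bt[OF A_E[OF lr(1,2) E_U[OF v]]]
            Bt[OF B_E[OF lr(1,2) v]] by (simp add: lin_xy)
      qed
      fix v assume v: "v \<in> U" and IH: "v \<in> {v. a t (a q v) = mu q *s v}"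
      have "C t (a q v) = 0"
      proof -
        have "a q v = a q (e v + x (y v))" by (rule arg_cong[OF split_e])
        also have "\<dots> = a q (e v) + x (a q (y v))"
          using a_x_commute[OF lr(1,2) Cq, of "y v"] v by (simp add: lin_xy)
        also have "\<dots> = A q (e v) + x (B q (e v) + a q (y v))"
          unfolding a_split[of q "e v"] by (simp add: lin_xy)
        finally have split: "a q v = A q (e v) + x (B q (e v) + a q (y v))" .
        have "B q (e v) + a q (y v) \<in> U"
          by (intro subspace_add[OF subspace_U] E_U[OF B_E[OF lr(1,2) e_E[OF v]]] a_U lr y_U v)
        then show ?thesis
          unfolding split lin_add[OF lin_C] using CA[OF e_E[OF v]] C_x[OF lr(3,4)] by simp
      qed
      then have "a t (a q (x v)) = x (a t (a q v))"
        using a_x_commute[OF lr(1,2) Cq v] a_x[OF lr(3,4), of "a q v"] v lr by simp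
      then show "x v \<in> {v. a t (a q v) = mu q *s v}" using IH by (simp add: lin_xy)
    qed
    then show ?thesis using False by auto
  qed
qed

end

lemma nested_arcs_two:
  assumes "r = l + 1"
  shows "\<exists>v0. nested_arcs a l r U (\<lambda>_. lam) v0"
proof -
  obtain v0 where v0: "v0 \<in> E" "v0 \<noteq> 0" using E_nontrivial by blast
  then have "a r v0 = 0" using y_E[of v0] lam by (simp add: y_def)
  have "nested_arcs a l r U (\<lambda>_. lam) v0"
    unfolding nested_arcs_def
  proof (intro conjI allI impI)
    fix q t assume "l \<le> q" "q < t" "t \<le> r" "q + t = l + r"
    then have qt: "q = l" "t = r" using assms by auto
    show "\<forall>v\<in>U. a t (a q v) = lam *s v" unfolding qt using outer by blast
    show "a t v0 = 0" unfolding qt by fact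
    show "a t (a j v0) = 0" if "q < j" "j < t" for j using that qt assms by simp
  qed (use v0 E_U lam in auto)
  then show ?thesis by blast
qed

end

context uncountable_vector_space
begin

text \<open>
  Each step replaces \<open>U\<close> by \<open>W\<close> and removes the outermost pair of indices.  It ends with two indices, which
  form an arc, or with one index, which is excluded because then \<open>a\<^sub>l\<close> commutes with everything and is a scalar.
\<close>

theorem nested_arcs_or_exceptional:
  assumes "chinese_operators scale a l r U" "\<not> exceptional_on a l r U"
  shows "odd (l + r) \<and> (\<exists>mu v0. nested_arcs a l r U mu v0)"
  using assms
proof (induction "r - l" arbitrary: l r U rule: less_induct)
  case less
  interpret chinese_operators scale a l r U by fact
  obtain c where c: "c \<noteq> 0" "\<And>v. v \<in> U \<Longrightarrow> a r (a l v) = c *s v" "l < r"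
    using outer_nonzero_scalar[OF less.prems(2)] by blast
  interpret toeplitz_operators scale a l r U c
    by (intro toeplitz_operators.intro toeplitz_operators_axioms.intro) (fact c less.prems)+
  show ?case
  proof (cases "l + 1 < r")
    case True
    have "\<not> exceptional_on a (l + 1) (r - 1) (toeplitz_coefficients.W B E (l + 1) (r - 1))"
      using inner_exceptional_lifts[OF True] less.prems(2) by blast
    then have "odd (l + 1 + (r - 1)) \<and> (\<exists>mu v0. nested_arcs a (l + 1) (r - 1)
        (toeplitz_coefficients.W B E (l + 1) (r - 1)) mu v0)"
      using True by (intro less.hyps inner_chinese_operators) auto
    then show ?thesis using inner_arcs_lift[OF True] True by fastforce
  next
    case False
    then have "r = l + 1" using c(3) by simp
    then show ?thesis using nested_arcs_two by auto
  qed
qed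

end

section \<open>The monomial basis\<close>

locale arc_operators = chinese_operators scale a 1 "2 * s" U
  for scale :: "'a::alg_closed_field \<Rightarrow> 'b::ab_group_add \<Rightarrow> 'b" (infixr \<open>*s\<close> 75)
    and a :: "nat \<Rightarrow> 'b \<Rightarrow> 'b" and s :: nat and U :: "'b set" +
  fixes mu :: "nat \<Rightarrow> 'a" and v0 :: 'b
  assumes arcs: "nested_arcs a 1 (2 * s) U mu v0"
begin

lemma v0: "v0 \<in> U" "v0 \<noteq> 0"
  using arcs unfolding nested_arcs_def by auto

lemma s_pos: "1 \<le> s"
  using lr by simp

lemma arc:
  assumes "q \<in> {1..s}"
  shows "mu q \<noteq> 0" "v \<in> U \<Longrightarrow> a (2 * s + 1 - q) (a q v) = mu q *s v" "a (2 * s + 1 - q) v0 = 0"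
    "q < j \<Longrightarrow> j < 2 * s + 1 - q \<Longrightarrow> a (2 * s + 1 - q) (a j v0) = 0"
proof -
  have "\<forall>q t. 1 \<le> q \<longrightarrow> q < t \<longrightarrow> t \<le> 2 * s \<longrightarrow> q + t = 1 + 2 * s \<longrightarrow>
      mu q \<noteq> 0 \<and> (\<forall>v\<in>U. a t (a q v) = mu q *s v) \<and>
      a t v0 = 0 \<and> (\<forall>j. q < j \<longrightarrow> j < t \<longrightarrow> a t (a j v0) = 0)"
    using arcs unfolding nested_arcs_def by (elim conjE)
  moreover have "1 \<le> q" "q < 2 * s + 1 - q" "2 * s + 1 - q \<le> 2 * s" "q + (2 * s + 1 - q) = 1 + 2 * s"
    using assms by auto
  ultimately have *: "mu q \<noteq> 0 \<and> (\<forall>v\<in>U. a (2 * s + 1 - q) (a q v) = mu q *s v) \<and>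
      a (2 * s + 1 - q) v0 = 0 \<and>
      (\<forall>j. q < j \<longrightarrow> j < 2 * s + 1 - q \<longrightarrow> a (2 * s + 1 - q) (a j v0) = 0)"
    by blast
  show "mu q \<noteq> 0" "v \<in> U \<Longrightarrow> a (2 * s + 1 - q) (a q v) = mu q *s v" "a (2 * s + 1 - q) v0 = 0"
    "q < j \<Longrightarrow> j < 2 * s + 1 - q \<Longrightarrow> a (2 * s + 1 - q) (a j v0) = 0"
    using * by simp_all
qed

text \<open>
  In \<open>V(\<lambda>\<^sub>1, \<dots>, \<lambda>\<^sub>s)\<close> the operators \<open>up k\<close> and \<open>down k\<close> are to raise and lower the index \<open>i\<^sub>k\<close> alone.  The
  generator \<open>a\<^sub>k\<close> raises \<open>i\<^sub>k, \<dots>, i\<^sub>s\<close> and \<open>a\<^bsub>2s-k\<^esub>\<close> lowers \<open>i\<^bsub>k+1\<^esub>, \<dots>, i\<^sub>s\<close>, so their product does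
  the former for \<open>k < s\<close>; \<open>a\<^bsub>2s+1-k\<^esub>\<close> and \<open>a\<^bsub>k+1\<^esub>\<close> do the latter.
\<close>

definition up :: "nat \<Rightarrow> 'b \<Rightarrow> 'b" where
  "up k v = inverse (mu k) *s (if k < s then a (2 * s - k) (a k v) else a k v)"

definition down :: "nat \<Rightarrow> 'b \<Rightarrow> 'b" where
  "down k v = (if k < s then inverse (mu (k + 1)) *s a (2 * s + 1 - k) (a (k + 1) v) else a (k + 1) v)"

lemma lin_up: "lin (up k)"
  by (rule linI) (simp_all add: up_def lin_a_simps scale_right_distrib mult.commute)

lemma lin_down: "lin (down k)"
  by (rule linI) (simp_all add: down_def lin_a_simps scale_right_distrib mult.commute)

lemma up_U [simp]: "k \<in> {1..s} \<Longrightarrow> v \<in> U \<Longrightarrow> up k v \<in> U"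
  by (auto simp: up_def intro!: subspace_scale[OF subspace_U])

lemma down_U [simp]: "k \<in> {1..s} \<Longrightarrow> v \<in> U \<Longrightarrow> down k v \<in> U"
  by (auto simp: down_def intro!: subspace_scale[OF subspace_U])

text \<open>\<open>a\<^sub>k a\<^sub>i\<close> with \<open>i \<le> k\<close> commutes with all generators in between.\<close>

lemma pair_central:
  assumes "1 \<le> i" "i \<le> j" "j \<le> k" "k \<le> 2 * s" "v \<in> U"
  shows "a j (a k (a i v)) = a k (a i (a j v))"
  using rel_right[OF assms] rel_left[OF assms] by (rule trans)

lemma up_commute_a:
  assumes "k < s" "1 \<le> k" "k \<le> j" "j \<le> 2 * s - k" "v \<in> U"
  shows "up k (a j v) = a j (up k v)"
  using pair_central[of k j "2 * s - k" v] assms by (simp add: up_def lin_a_simps)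

lemma down_commute_a:
  assumes "k < s" "1 \<le> k" "k < j" "j \<le> 2 * s + 1 - k" "v \<in> U"
  shows "down k (a j v) = a j (down k v)"
  using pair_central[of "k + 1" j "2 * s + 1 - k" v] assms by (simp add: down_def lin_a_simps)

text \<open>
  For \<open>k < h\<close> the operators \<open>up h\<close> and \<open>down h\<close> are built from generators with indices in the range
  where \<open>up k\<close> and \<open>down k\<close> commute with the generators.
\<close>

lemma commute_of_commute_a:
  assumes T: "lin T" "\<And>v. v \<in> U \<Longrightarrow> T v \<in> U"
    and comm: "\<And>j v. k < j \<Longrightarrow> j \<le> 2 * s - k \<Longrightarrow> v \<in> U \<Longrightarrow> T (a j v) = a j (T v)"
    and k: "1 \<le> k" "k < h" "h \<le> s" and v: "v \<in> U"
  shows "T (up h v) = up h (T v)" "T (down h v) = down h (T v)"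
  using comm k v by (auto simp: up_def down_def lin_scale[OF T(1)])

lemma commute:
  assumes "k \<in> {1..s}" "h \<in> {1..s}" "k \<noteq> h" "v \<in> U"
  shows "up k (up h v) = up h (up k v)" "up k (down h v) = down h (up k v)"
    "down k (up h v) = up h (down k v)" "down k (down h v) = down h (down k v)"
proof -
  have *: "up k (up h v) = up h (up k v) \<and> up k (down h v) = down h (up k v) \<and>
    down k (up h v) = up h (down k v) \<and> down k (down h v) = down h (down k v)"
    if "k \<in> {1..s}" "k < h" "h \<le> s" for k h
  proof -
    have "up k (a j v) = a j (up k v)" "down k (a j v) = a j (down k v)"
      if "k < j" "j \<le> 2 * s - k" "v \<in> U" for j v
      using that \<open>k \<in> {1..s}\<close> \<open>k < h\<close> \<open>h \<le> s\<close> by (auto intro!: up_commute_a down_commute_a)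
    note c = commute_of_commute_a[OF lin_up up_U this(1) _ that(2,3) assms(4)]
      commute_of_commute_a[OF lin_down down_U this(2) _ that(2,3) assms(4)]
    show ?thesis using that(1) by (intro conjI c) auto
  qed
  have "up k (up h v) = up h (up k v) \<and> up k (down h v) = down h (up k v) \<and>
    down k (up h v) = up h (down k v) \<and> down k (down h v) = down h (down k v)"
  proof (cases "k < h")
    case True
    then show ?thesis using assms by (intro *) auto
  next
    case False
    then have "up h (up k v) = up k (up h v) \<and> up h (down k v) = down k (up h v) \<and>
        down h (up k v) = up k (down h v) \<and> down h (down k v) = down k (down h v)"
      using assms by (intro *) auto
    then show ?thesis by (elim conjE) (intro conjI; rule sym; assumption)
  qed
  then show "up k (up h v) = up h (up k v)" "up k (down h v) = down h (up k v)"
    "down k (up h v) = up h (down k v)" "down k (down h v) = down h (down k v)"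
    by blast+
qed

lemma down_up:
  assumes "k \<in> {1..s}" "v \<in> U"
  shows "down k (up k v) = v"
proof (cases "k < s")
  case True
  have "a (k + 1) (a (2 * s - k) (a k v)) = a (2 * s - k) (a (k + 1) (a k v))"
    using rel_right[of k "k + 1" "2 * s - k" v] True assms by simp
  also have "\<dots> = mu (k + 1) *s a k v"
    using arc(2)[of "k + 1" "a k v"] True assms by (simp add: Suc_diff_Suc)
  finally have "a (2 * s + 1 - k) (a (k + 1) (a (2 * s - k) (a k v))) = (mu (k + 1) * mu k) *s v"
    using arc(2)[of k v] assms by (simp add: lin_a_simps)
  moreover have "mu k \<noteq> 0" "mu (k + 1) \<noteq> 0" using arc(1)[of k] arc(1)[of "k + 1"] True assms by auto
  then have "inverse (mu (k + 1)) * (inverse (mu k) * (mu (k + 1) * mu k)) = 1"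
    by (simp add: field_simps)
  ultimately show ?thesis
    using True by (simp add: up_def down_def lin_a_simps)
next
  case False
  then show ?thesis
    using arc(1)[of k] arc(2)[of k v] assms by (simp add: up_def down_def lin_a_simps)
qed

lemma down_v0: "k \<in> {1..s} \<Longrightarrow> down k v0 = 0"
  using arc(3)[of k] arc(4)[of k "k + 1"] by (cases "k < s") (auto simp: down_def)

definition monomial :: "nat list \<Rightarrow> (nat \<Rightarrow> nat) \<Rightarrow> 'b" where
  "monomial ks i = foldr (\<lambda>k. up k ^^ i k) ks v0"

lemma up_power_U: "k \<in> {1..s} \<Longrightarrow> v \<in> U \<Longrightarrow> (up k ^^ m) v \<in> U"
  by (induction m) simp_all

lemma monomial_U: "set ks \<subseteq> {1..s} \<Longrightarrow> monomial ks i \<in> U"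
  by (induction ks) (auto simp: monomial_def v0 intro!: up_power_U)

lemma commute_up_power:
  assumes "k \<in> {1..s}" "h \<in> {1..s}" "k \<noteq> h" "v \<in> U"
  shows "up k ((up h ^^ m) v) = (up h ^^ m) (up k v)" "down k ((up h ^^ m) v) = (up h ^^ m) (down k v)"
  using assms by (induction m) (auto simp: commute up_power_U)

lemma monomial_cong: "(\<And>k. k \<in> set ks \<Longrightarrow> i k = i' k) \<Longrightarrow> monomial ks i = monomial ks i'"
  unfolding monomial_def by (rule foldr_cong) auto

lemma up_monomial:
  "\<lbrakk>k \<in> set ks; distinct ks; set ks \<subseteq> {1..s}\<rbrakk> \<Longrightarrow> up k (monomial ks i) = monomial ks (i(k := i k + 1))"
proof (induction ks)
  case (Cons h ks)
  show ?case
  proof (cases "k = h")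
    case True
    then have "monomial ks (i(k := i k + 1)) = monomial ks i"
      using Cons.prems by (intro monomial_cong) auto
    then show ?thesis using True by (simp add: monomial_def)
  next
    case False
    then have "up k (monomial (h # ks) i) = (up h ^^ i h) (up k (monomial ks i))"
      using commute_up_power(1)[of k h "monomial ks i"] monomial_U[of ks i] Cons.prems
      by (auto simp: monomial_def)
    also have "up k (monomial ks i) = monomial ks (i(k := i k + 1))"
      using Cons.prems False by (intro Cons.IH) auto
    finally show ?thesis using False by (simp add: monomial_def)
  qed
qed simp

lemma up_power_zero: "(up h ^^ m) 0 = 0"
  by (induction m) (simp_all add: lin_zero[OF lin_up])

lemma down_monomial_outside:
  "\<lbrakk>k \<in> {1..s}; k \<notin> set ks; set ks \<subseteq> {1..s}\<rbrakk> \<Longrightarrow> down k (monomial ks i) = 0"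
proof (induction ks)
  case Nil
  then show ?case by (simp add: monomial_def down_v0)
next
  case (Cons h ks)
  then have "down k (monomial (h # ks) i) = (up h ^^ i h) (down k (monomial ks i))"
    using commute_up_power(2)[of k h "monomial ks i"] monomial_U[of ks i]
    by (auto simp: monomial_def)
  then show ?case using Cons by (simp add: up_power_zero)
qed

lemma down_monomial:
  "\<lbrakk>k \<in> set ks; distinct ks; set ks \<subseteq> {1..s}\<rbrakk> \<Longrightarrow>
    down k (monomial ks i) = (if i k > 0 then monomial ks (i(k := i k - 1)) else 0)"
proof (induction ks)
  case (Cons h ks)
  show ?case
  proof (cases "k = h")
    case True
    have rest: "monomial ks (i(k := i k - 1)) = monomial ks i"
      using Cons.prems True by (intro monomial_cong) auto
    show ?thesis
    proof (cases "i k")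
      case 0
      then show ?thesis
        using True Cons.prems down_monomial_outside[of k ks i] by (simp add: monomial_def)
    next
      case (Suc m)
      have "down k (up k ((up k ^^ m) (monomial ks i))) = (up k ^^ m) (monomial ks i)"
        using True Cons.prems by (intro down_up up_power_U monomial_U) auto
      then show ?thesis using True Suc rest by (simp add: monomial_def)
    qed
  next
    case False
    then have "down k (monomial (h # ks) i) = (up h ^^ i h) (down k (monomial ks i))"
      using commute_up_power(2)[of k h "monomial ks i"] monomial_U[of ks i] Cons.prems
      by (auto simp: monomial_def)
    also have "down k (monomial ks i) = (if i k > 0 then monomial ks (i(k := i k - 1)) else 0)"
      using Cons.prems False by (intro Cons.IH) auto
    finally show ?thesis using False by (simp add: monomial_def up_power_zero)
  qed
qed simp

definition basis_vector :: "(nat \<Rightarrow> nat) \<Rightarrow> 'b" where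
  "basis_vector i = monomial [1..<Suc s] i"

lemma basis_vector_U: "basis_vector i \<in> U"
  unfolding basis_vector_def by (rule monomial_U) auto

lemma up_basis_vector: "k \<in> {1..s} \<Longrightarrow> up k (basis_vector i) = basis_vector (i(k := i k + 1))"
  unfolding basis_vector_def by (rule up_monomial) auto

lemma down_basis_vector:
  "k \<in> {1..s} \<Longrightarrow> down k (basis_vector i) = (if i k > 0 then basis_vector (i(k := i k - 1)) else 0)"
  unfolding basis_vector_def by (rule down_monomial) auto

text \<open>Downward induction on \<open>q\<close>, using that \<open>a\<^sub>q\<close> is a multiple of \<open>up q a\<^bsub>q+1\<^esub>\<close>.\<close>

lemma a_first_half: "q \<in> {1..s} \<Longrightarrow> a q (basis_vector i) = mu q *s basis_vector (raise_from s q i)"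
proof (induction "s - q" arbitrary: q)
  case 0
  then have q: "q = s" by simp
  have "i(s := i s + 1) = raise_from s s i" by (auto simp: raise_from_def)
  then have "up s (basis_vector i) = basis_vector (raise_from s s i)"
    using up_basis_vector[of s i] s_pos by simp
  moreover have "a s (basis_vector i) = mu s *s up s (basis_vector i)"
    using arc(1)[of s] 0 by (simp add: up_def)
  ultimately show ?case unfolding q by simp
next
  case (Suc d)
  then have q: "1 \<le> q" "q < s" by auto
  have "up q (a (q + 1) (basis_vector i)) =
      inverse (mu q) *s a (2 * s - q) (a (q + 1) (a q (basis_vector i)))"
    using rel_left[of q "q + 1" "2 * s - q" "basis_vector i"] q basis_vector_U by (simp add: up_def)
  also have "\<dots> = (inverse (mu q) * mu (q + 1)) *s a q (basis_vector i)"
    using arc(2)[of "q + 1" "a q (basis_vector i)"] q basis_vector_U by (simp add: Suc_diff_Suc)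
  finally have "a q (basis_vector i) = (mu q * inverse (mu (q + 1))) *s up q (a (q + 1) (basis_vector i))"
    using arc(1)[of q] arc(1)[of "q + 1"] q by (simp add: field_simps)
  also have "a (q + 1) (basis_vector i) = mu (q + 1) *s basis_vector (raise_from s (q + 1) i)"
    using Suc.hyps(1)[of "q + 1"] Suc.hyps(2) q by simp
  also have "(mu q * inverse (mu (q + 1))) *s up q (mu (q + 1) *s basis_vector (raise_from s (q + 1) i)) =
      mu q *s up q (basis_vector (raise_from s (q + 1) i))"
    using arc(1)[of "q + 1"] q by (simp add: lin_scale[OF lin_up])
  also have "up q (basis_vector (raise_from s (q + 1) i)) = basis_vector (raise_from s q i)"
  proof -
    have "(raise_from s (q + 1) i)(q := raise_from s (q + 1) i q + 1) = raise_from s q i"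
      using q by (auto simp: raise_from_def)
    then show ?thesis using up_basis_vector[of q "raise_from s (q + 1) i"] q by simp
  qed
  finally show ?case .
qed

text \<open>Downward induction on \<open>q\<close>, using \<open>a\<^bsub>2s+1-q\<^esub> = a\<^bsub>2s-q\<^esub> down q\<close>.\<close>

lemma a_second_half:
  "q \<in> {1..s} \<Longrightarrow> a (2 * s + 1 - q) (basis_vector i) =
    (if positive_from s q i then basis_vector (lower_from s q i) else 0)"
proof (induction "s - q" arbitrary: q i)
  case 0
  then have q: "q = s" by simp
  have "i(s := i s - 1) = lower_from s s i" by (auto simp: lower_from_def)
  then have "down s (basis_vector i) = (if i s > 0 then basis_vector (lower_from s s i) else 0)"
    using down_basis_vector[of s i] s_pos by simp
  moreover have "a (2 * s + 1 - s) (basis_vector i) = down s (basis_vector i)"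
    by (simp add: down_def)
  moreover have "positive_from s s i \<longleftrightarrow> i s > 0" by (auto simp: positive_from_def)
  ultimately show ?case unfolding q by simp
next
  case (Suc d)
  then have q: "1 \<le> q" "q < s" by auto
  have q': "2 * s + 1 - (q + 1) = 2 * s - q" by simp
  have IH: "a (2 * s - q) (basis_vector i) =
      (if positive_from s (q + 1) i then basis_vector (lower_from s (q + 1) i) else 0)" for i
    using Suc.hyps(1)[of "q + 1" i] Suc.hyps(2) q unfolding q' by simp
  have pos: "positive_from s q i \<longleftrightarrow> i q > 0 \<and> positive_from s (q + 1) (i(q := i q - 1))"
    using q by (auto simp: positive_from_def le_eq_less_or_eq)
  have low: "lower_from s (q + 1) (i(q := i q - 1)) = lower_from s q i"
    using q by (auto simp: lower_from_def)
  have "a (2 * s - q) (down q (basis_vector i)) =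
      inverse (mu (q + 1)) *s a (2 * s + 1 - q) (a (2 * s - q) (a (q + 1) (basis_vector i)))"
    using rel_right[of "q + 1" "2 * s - q" "2 * s + 1 - q" "basis_vector i"] q basis_vector_U
    by (simp add: down_def lin_a_simps)
  also have "a (2 * s - q) (a (q + 1) (basis_vector i)) = mu (q + 1) *s basis_vector i"
    using arc(2)[of "q + 1" "basis_vector i"] q basis_vector_U unfolding q' by simp
  finally have "a (2 * s + 1 - q) (basis_vector i) = a (2 * s - q) (down q (basis_vector i))"
    using arc(1)[of "q + 1"] q by (simp add: lin_a_simps)
  also have "\<dots> = (if i q > 0 then a (2 * s - q) (basis_vector (i(q := i q - 1))) else 0)"
    using down_basis_vector[of q i] q by (simp add: lin_a_simps)
  also have "\<dots> = (if positive_from s q i then basis_vector (lower_from s q i) else 0)"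
    unfolding IH pos low by simp
  finally show ?case .
qed

lemma down_powers_basis_vector:
  "\<lbrakk>set ks \<subseteq> {1..s}; distinct ks\<rbrakk> \<Longrightarrow> foldr (\<lambda>k. down k ^^ m k) ks (basis_vector i) =
    (if \<forall>k\<in>set ks. m k \<le> i k then basis_vector (\<lambda>k. if k \<in> set ks then i k - m k else i k) else 0)"
proof (induction ks)
  case (Cons h ks)
  have power: "(down h ^^ n) (basis_vector i) = (if n \<le> i h then basis_vector (i(h := i h - n)) else 0)" for n i
  proof (induction n)
    case (Suc n)
    have "(down h ^^ Suc n) (basis_vector i) =
        (if n \<le> i h then down h (basis_vector (i(h := i h - n))) else down h 0)"
      using Suc by simp
    also have "\<dots> = (if Suc n \<le> i h then basis_vector (i(h := i h - Suc n)) else 0)"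
      using down_basis_vector[of h "i(h := i h - n)"] Cons.prems by (auto simp: lin_zero[OF lin_down])
    finally show ?case .
  qed simp
  have zero: "(down h ^^ n) 0 = 0" for n by (induction n) (simp_all add: lin_zero[OF lin_down])
  let ?i = "\<lambda>k. if k \<in> set ks then i k - m k else i k"
  have "?i(h := ?i h - m h) = (\<lambda>k. if k \<in> set (h # ks) then i k - m k else i k)"
    using Cons.prems by auto
  then show ?case using Cons by (auto simp: power zero)
qed simp

text \<open>
  In a linear relation choose an index \<open>m\<close> of maximal degree.  The monomial in the \<open>down k\<close> with
  exponents \<open>m\<close> maps the basis vector of \<open>m\<close> to \<open>v0\<close> and all others that occur to zero.
\<close>

lemma basis_vector_independent:
  assumes X: "finite X" "X \<subseteq> multi_indices s" and sum0: "(\<Sum>i\<in>X. c i *s basis_vector i) = 0"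
    and i: "i \<in> X"
  shows "c i = 0"
proof (rule ccontr)
  assume "c i \<noteq> 0"
  define Y where "Y = {i \<in> X. c i \<noteq> 0}"
  define deg where "deg i = (\<Sum>k=1..s. i k)" for i :: "nat \<Rightarrow> nat"
  have Y: "finite Y" "Y \<noteq> {}" using X i \<open>c i \<noteq> 0\<close> unfolding Y_def by auto
  then have "Max (deg ` Y) \<in> deg ` Y" by (intro Max_in) auto
  then obtain m where m: "m \<in> Y" "deg m = Max (deg ` Y)" by auto
  then have max: "deg i \<le> deg m" if "i \<in> Y" for i
    using Y that by simp
  define D where "D = foldr (\<lambda>k. down k ^^ m k) [1..<Suc s]"
  have "lin (down k ^^ n)" for k n
    by (induction n) (auto simp: lin_iff lin_simps[OF lin_down])
  then have "lin (foldr (\<lambda>k. down k ^^ m k) ks)" for ks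
    by (induction ks) (auto simp: lin_iff)
  then have D: "lin D" unfolding D_def .
  have Di: "D (basis_vector i) = (if i = m then v0 else 0)" if "i \<in> Y" for i
  proof -
    have "D (basis_vector i) = (if \<forall>k\<in>{1..s}. m k \<le> i k
        then basis_vector (\<lambda>k. if k \<in> {1..s} then i k - m k else i k) else 0)"
    proof -
      have ks: "set [1..<Suc s] = {1..s}" by auto
      show ?thesis
        unfolding D_def
        by (rule down_powers_basis_vector[of "[1..<Suc s]" m i, unfolded ks, OF order_refl distinct_upt])
    qed
    moreover have "basis_vector (\<lambda>k. if k \<in> {1..s} then m k - m k else m k) = v0"
    proof -
      have "basis_vector (\<lambda>k. if k \<in> {1..s} then m k - m k else m k) = basis_vector (\<lambda>k. 0)"
        unfolding basis_vector_def by (rule monomial_cong) auto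
      also have "monomial ks (\<lambda>k. 0) = v0" for ks by (induction ks) (auto simp: monomial_def)
      then have "basis_vector (\<lambda>k. 0) = v0" unfolding basis_vector_def .
      finally show ?thesis .
    qed
    moreover have "i = m" if le: "\<forall>k\<in>{1..s}. m k \<le> i k"
    proof (rule ccontr)
      assume "i \<noteq> m"
      then obtain k where "i k \<noteq> m k" by blast
      moreover have "i k = 0" "m k = 0" if "k \<notin> {1..s}"
        using that \<open>i \<in> Y\<close> m(1) X unfolding Y_def multi_indices_def by auto
      ultimately have "k \<in> {1..s}" "m k < i k" using le by (metis, metis le_neq_implies_less)
      then have "deg m < deg i"
        unfolding deg_def using le by (intro sum_strict_mono_ex1) auto
      then show False using max[OF \<open>i \<in> Y\<close>] by simp
    qed
    ultimately show ?thesis by (auto simp del: One_nat_def)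
  qed
  have "(\<Sum>i\<in>Y. c i *s basis_vector i) = 0"
    using sum0 X unfolding Y_def by (subst sum.mono_neutral_left) auto
  then have "0 = D (\<Sum>i\<in>Y. c i *s basis_vector i)" using lin_zero[OF D] by simp
  also have "\<dots> = (\<Sum>i\<in>Y. c i *s D (basis_vector i))"
    using D by (simp add: lin_sum lin_scale)
  also have "\<dots> = (\<Sum>i\<in>Y. if i = m then c m *s v0 else 0)"
    by (rule sum.cong) (auto simp: Di)
  also have "\<dots> = c m *s v0" using Y m(1) by simp
  finally show False using m(1) v0 unfolding Y_def by simp
qed

lemma basis_vectors_span: "span (basis_vector ` multi_indices s) = U"
proof (rule U_irreducible[OF subspace_span])
  let ?S = "basis_vector ` multi_indices s"
  show "span ?S \<subseteq> U" by (rule span_minimal) (auto simp: basis_vector_U subspace_U)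
  have "monomial ks (\<lambda>k. 0) = v0" for ks by (induction ks) (auto simp: monomial_def)
  then have "v0 = basis_vector (\<lambda>k. 0)" unfolding basis_vector_def by simp
  then show "v0 \<in> span ?S" by (auto simp: multi_indices_def intro!: span_base)
  show "v0 \<noteq> 0" by (rule v0)
  fix j v assume j: "1 \<le> j" "j \<le> 2 * s" and v: "v \<in> span ?S"
  have "a j (basis_vector i) \<in> span ?S" if "i \<in> multi_indices s" for i
  proof (cases "j \<le> s")
    case True
    have "raise_from s j i \<in> multi_indices s"
      using that j by (auto simp: multi_indices_def raise_from_def)
    then show ?thesis using a_first_half[of j i] True j
      by (simp add: span_scale span_base)
  next
    case False
    define q where "q = 2 * s + 1 - j"
    have q: "q \<in> {1..s}" "2 * s + 1 - q = j" using False j unfolding q_def by auto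
    have "lower_from s q i \<in> multi_indices s"
      using that q by (auto simp: multi_indices_def lower_from_def)
    then show ?thesis using a_second_half[of q i] q by (auto simp: span_zero intro!: span_base)
  qed
  then have "span ?S \<subseteq> {v. a j v \<in> span ?S}"
    by (intro span_minimal subspace_vimage lin_a subspace_span) auto
  then show "a j v \<in> span ?S" using v by blast
qed

end

section \<open>Words and the monoid algebra\<close>

lemma presented_cong_lists:
  "(u, w) \<in> presented_cong A R \<Longrightarrow> u \<in> lists A \<and> w \<in> lists A"
  by (induction rule: presented_cong.induct) auto

lemma equiv_presented_cong: "equiv (lists A) (presented_cong A R)"
proof (rule equivI)
  show "refl_on (lists A) (presented_cong A R)"
    by (auto simp: refl_on_def intro: pc_refl)
  show "sym (presented_cong A R)" by (auto simp: sym_def intro: pc_sym)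
  show "trans (presented_cong A R)" by (auto simp: trans_def intro: pc_trans)
  show "presented_cong A R \<subseteq> lists A \<times> lists A"
    using presented_cong_lists by (metis mem_Sigma_iff subrelI)
qed

definition word_class :: "nat \<Rightarrow> nat list \<Rightarrow> nat list set" where
  "word_class n w = presented_cong {1..n} (chinese_relations n) `` {w}"

lemma chinese_gen_word_class: "chinese_gen n i = word_class n [i]"
  by (simp add: chinese_gen_def word_class_def)

lemma one_chinese_monoid: "\<one>\<^bsub>chinese_monoid n\<^esub> = word_class n []"
  by (simp add: chinese_monoid_def presented_monoid_def word_class_def)

lemma carrier_chinese_monoid: "carrier (chinese_monoid n) = word_class n ` lists {1..n}"
  by (auto simp: chinese_monoid_def presented_monoid_def word_class_def quotient_def)

lemma word_class_eq_iff:
  assumes "u \<in> lists {1..n}" "w \<in> lists {1..n}"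
  shows "word_class n u = word_class n w \<longleftrightarrow> (u, w) \<in> presented_cong {1..n} (chinese_relations n)"
  unfolding word_class_def by (rule eq_equiv_class_iff[OF equiv_presented_cong assms])

lemma mem_word_class: "u \<in> word_class n w \<longleftrightarrow> (w, u) \<in> presented_cong {1..n} (chinese_relations n)"
  by (simp add: word_class_def)

lemma word_class_self: "w \<in> lists {1..n} \<Longrightarrow> w \<in> word_class n w"
  by (simp add: mem_word_class pc_refl)

lemma mult_word_class:
  assumes "u \<in> lists {1..n}" "w \<in> lists {1..n}"
  shows "word_class n u \<otimes>\<^bsub>chinese_monoid n\<^esub> word_class n w = word_class n (u @ w)"
proof -
  have "word_class n (u' @ w') = word_class n (u @ w)" if "u' \<in> word_class n u" "w' \<in> word_class n w" for u' w'
  proof -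
    have "(u @ w, u' @ w') \<in> presented_cong {1..n} (chinese_relations n)"
      using that unfolding mem_word_class by (rule pc_append)
    with presented_cong_lists[OF this] show ?thesis
      by (subst word_class_eq_iff) (auto intro: pc_sym)
  qed
  then have "(\<Union>u'\<in>word_class n u. \<Union>w'\<in>word_class n w. word_class n (u' @ w')) = word_class n (u @ w)"
    using word_class_self[OF assms(1)] word_class_self[OF assms(2)] by fast
  then show ?thesis
    by (simp add: chinese_monoid_def presented_monoid_def word_class_def)
qed

lemma monoid_chinese_monoid: "monoid (chinese_monoid n)"
proof (rule monoidI)
  let ?M = "chinese_monoid n"
  have app: "u @ w \<in> lists {1..n}" if "u \<in> lists {1..n}" "w \<in> lists {1..n}" for u w
    using that by auto
  have nil: "[] \<in> lists {1..n}" by simp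
  show "\<one>\<^bsub>?M\<^esub> \<in> carrier ?M"
    unfolding carrier_chinese_monoid one_chinese_monoid using nil by (rule imageI)
  fix x assume "x \<in> carrier ?M"
  then obtain u where u: "u \<in> lists {1..n}" "x = word_class n u"
    unfolding carrier_chinese_monoid by blast
  show "\<one>\<^bsub>?M\<^esub> \<otimes>\<^bsub>?M\<^esub> x = x" "x \<otimes>\<^bsub>?M\<^esub> \<one>\<^bsub>?M\<^esub> = x"
    unfolding one_chinese_monoid u(2) mult_word_class[OF nil u(1)] mult_word_class[OF u(1) nil]
    by simp_all
  fix y assume "y \<in> carrier ?M"
  then obtain v where v: "v \<in> lists {1..n}" "y = word_class n v"
    unfolding carrier_chinese_monoid by blast
  show "x \<otimes>\<^bsub>?M\<^esub> y \<in> carrier ?M"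
    unfolding u(2) v(2) mult_word_class[OF u(1) v(1)] carrier_chinese_monoid
    using app[OF u(1) v(1)] by (rule imageI)
  fix z assume "z \<in> carrier ?M"
  then obtain w where w: "w \<in> lists {1..n}" "z = word_class n w"
    unfolding carrier_chinese_monoid by blast
  show "x \<otimes>\<^bsub>?M\<^esub> y \<otimes>\<^bsub>?M\<^esub> z = x \<otimes>\<^bsub>?M\<^esub> (y \<otimes>\<^bsub>?M\<^esub> z)"
    unfolding u(2) v(2) w(2) mult_word_class[OF u(1) v(1)] mult_word_class[OF v(1) w(1)]
      mult_word_class[OF app[OF u(1) v(1)] w(1)] mult_word_class[OF u(1) app[OF v(1) w(1)]] by simp
qed

lemma chinese_relation_cong:
  assumes "1 \<le> i" "i \<le> j" "j \<le> k" "k \<le> n"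
  shows "word_class n [j, k, i] = word_class n [k, j, i]" "word_class n [k, j, i] = word_class n [k, i, j]"
proof -
  have "[j, k, i] \<in> lists {1..n}" "[k, j, i] \<in> lists {1..n}" "[k, i, j] \<in> lists {1..n}"
    using assms by auto
  moreover have "([j, k, i], [k, j, i]) \<in> chinese_relations n" "([k, j, i], [k, i, j]) \<in> chinese_relations n"
    unfolding chinese_relations_def using assms by blast+
  ultimately show "word_class n [j, k, i] = word_class n [k, j, i]"
    "word_class n [k, j, i] = word_class n [k, i, j]"
    by (simp_all only: word_class_eq_iff pc_base)
qed

lemma carrier_monoid_algebra:
  "carrier (monoid_algebra G) = {f. finite {x. f x \<noteq> 0} \<and> {x. f x \<noteq> 0} \<subseteq> carrier G}"
  by (simp add: monoid_algebra_def)

lemma add_monoid_algebra: "f \<oplus>\<^bsub>monoid_algebra G\<^esub> g = f + g"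
  by (simp add: monoid_algebra_def fun_eq_iff)

lemma zero_monoid_algebra: "\<zero>\<^bsub>monoid_algebra G\<^esub> = 0"
  by (simp add: monoid_algebra_def fun_eq_iff)

lemma one_monoid_algebra: "\<one>\<^bsub>monoid_algebra G\<^esub> = single \<one>\<^bsub>G\<^esub> 1"
  by (simp add: monoid_algebra_def single_def)

lemma single_carrier: "m \<in> carrier G \<Longrightarrow> single m c \<in> carrier (monoid_algebra G)"
  by (auto simp: carrier_monoid_algebra single_def)

lemma add_carrier:
  "f \<in> carrier (monoid_algebra G) \<Longrightarrow> g \<in> carrier (monoid_algebra G) \<Longrightarrow> f + g \<in> carrier (monoid_algebra G)"
proof -
  assume f: "f \<in> carrier (monoid_algebra G)" "g \<in> carrier (monoid_algebra G)"
  have "{x. (f + g) x \<noteq> 0} \<subseteq> {x. f x \<noteq> 0} \<union> {x. g x \<noteq> 0}" by auto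
  then show ?thesis using f unfolding carrier_monoid_algebra by (auto intro: finite_subset)
qed

lemma scale_carrier:
  "f \<in> carrier (monoid_algebra G) \<Longrightarrow> (\<lambda>x. c * f x) \<in> carrier (monoid_algebra G)"
proof -
  assume f: "f \<in> carrier (monoid_algebra G)"
  have "{x. c * f x \<noteq> 0} \<subseteq> {x. f x \<noteq> 0}" by auto
  then show ?thesis using f unfolding carrier_monoid_algebra by (auto intro: finite_subset)
qed

lemma single_mult:
  fixes c d :: "'k :: idom"
  shows "single m c \<otimes>\<^bsub>monoid_algebra G\<^esub> single m' d = single (m \<otimes>\<^bsub>G\<^esub> m') (c * d)"
proof
  fix z
  have "{(x, y). single m c x \<noteq> 0 \<and> single m' d y \<noteq> 0 \<and> x \<otimes>\<^bsub>G\<^esub> y = z} =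
      (if c \<noteq> 0 \<and> d \<noteq> 0 \<and> m \<otimes>\<^bsub>G\<^esub> m' = z then {(m, m')} else {})"
    by (auto simp: single_def split: if_splits)
  then show "(single m c \<otimes>\<^bsub>monoid_algebra G\<^esub> single m' d) z = single (m \<otimes>\<^bsub>G\<^esub> m') (c * d) z"
    by (auto simp: monoid_algebra_def single_def)
qed

lemma scalar_mult:
  fixes f :: "'m \<Rightarrow> 'k :: idom"
  assumes "monoid G" "f \<in> carrier (monoid_algebra G)"
  shows "single \<one>\<^bsub>G\<^esub> c \<otimes>\<^bsub>monoid_algebra G\<^esub> f = (\<lambda>x. c * f x)"
proof
  fix z
  have "{(x, y). single \<one>\<^bsub>G\<^esub> c x \<noteq> 0 \<and> f y \<noteq> 0 \<and> x \<otimes>\<^bsub>G\<^esub> y = z} =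
      (if c \<noteq> 0 \<and> f z \<noteq> 0 then {(\<one>\<^bsub>G\<^esub>, z)} else {})"
    using assms monoid.l_one[OF assms(1)]
    by (auto simp: single_def carrier_monoid_algebra subset_iff split: if_splits)
  then show "(single \<one>\<^bsub>G\<^esub> c \<otimes>\<^bsub>monoid_algebra G\<^esub> f) z = c * f z"
    by (auto simp: monoid_algebra_def single_def)
qed

text \<open>An element of the monoid algebra is a finite sum of multiples of elements of the monoid.\<close>

lemma monoid_algebra_induct [consumes 1, case_names zero add single]:
  assumes "f \<in> carrier (monoid_algebra G)"
    and zero: "P 0"
    and add: "\<And>f g. \<lbrakk>f \<in> carrier (monoid_algebra G); g \<in> carrier (monoid_algebra G); P f; P g\<rbrakk> \<Longrightarrow> P (f + g)"
    and single: "\<And>m c. m \<in> carrier G \<Longrightarrow> P (single m c)"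
  shows "P f"
proof -
  have "P f" if "finite X" "{x. f x \<noteq> 0} \<subseteq> X" "X \<subseteq> carrier G" for X f
    using that
  proof (induction X arbitrary: f)
    case empty
    then have f: "f = 0" by (auto simp: fun_eq_iff)
    show ?case unfolding f by (rule zero)
  next
    case (insert m X)
    define g where "g = f(m := 0)"
    have g: "{x. g x \<noteq> 0} \<subseteq> X" using insert.prems unfolding g_def by auto
    then have "P g" using insert by auto
    moreover have "g \<in> carrier (monoid_algebra G)"
      using finite_subset[OF g insert.hyps(1)] g insert.prems(2) unfolding carrier_monoid_algebra by auto
    ultimately have "P (single m (f m) + g)"
      using insert.prems by (intro add single single_carrier) auto
    moreover have "single m (f m) + g = f"
      by (auto simp: fun_eq_iff single_def g_def)
    ultimately show ?case by simp
  qed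
  from this[of "{x. f x \<noteq> 0}"] assms(1) show ?thesis unfolding carrier_monoid_algebra by simp
qed

section \<open>Relabelling generators monotonically\<close>

text \<open>
  The defining relations depend only on the order of the indices, so every monotone map between index
  sets induces a homomorphism of Chinese monoids.
\<close>

lemma map_presented_cong:
  assumes "(u, w) \<in> presented_cong {1..n} (chinese_relations n)"
    and g: "\<And>i. i \<in> {1..n} \<Longrightarrow> g i \<in> {1..m}" "\<And>i j. \<lbrakk>1 \<le> i; i \<le> j; j \<le> n\<rbrakk> \<Longrightarrow> g i \<le> g j"
  shows "(map g u, map g w) \<in> presented_cong {1..m} (chinese_relations m)"
  using assms(1)
proof (induction rule: presented_cong.induct)
  case (pc_base u w)
  then obtain i j k where ijk: "1 \<le> i" "i \<le> j" "j \<le> k" "k \<le> n"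
    and uw: "u = [j, k, i] \<and> w = [k, j, i] \<or> u = [k, j, i] \<and> w = [k, i, j]"
    unfolding chinese_relations_def by blast
  have "1 \<le> g i" "g i \<le> g j" "g j \<le> g k" "g k \<le> m"
    using g(1)[of i] g(1)[of k] g(2)[of i j] g(2)[of j k] ijk by auto
  then have "(map g u, map g w) \<in> chinese_relations m"
    using uw unfolding chinese_relations_def by auto
  moreover have "map g u \<in> lists {1..m}" "map g w \<in> lists {1..m}"
    using pc_base g(1) by auto
  ultimately show ?case by (rule presented_cong.pc_base)
next
  case (pc_refl u)
  then have "map g u \<in> lists {1..m}" using g(1) by auto
  then show ?case by (rule presented_cong.pc_refl)
next
  case (pc_sym u w)
  show ?case using pc_sym.IH by (rule presented_cong.pc_sym)
next
  case (pc_trans u v w)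
  show ?case using pc_trans.IH by (rule presented_cong.pc_trans)
next
  case (pc_append u u' v v')
  show ?case unfolding map_append using pc_append.IH by (rule presented_cong.pc_append)
qed

text \<open>
  The monotone map \<open>skip k\<close> enumerates the indices other than \<open>k\<close>, and \<open>collapse k\<close> is a monotone left
  inverse of it.  Monotonicity leaves only \<open>k - 1\<close> and \<open>k\<close> for \<open>collapse k k\<close>; the maximum with \<open>1\<close>
  selects \<open>k\<close> if \<open>k = 1\<close>.
\<close>

definition skip :: "nat \<Rightarrow> nat \<Rightarrow> nat" where
  "skip k i = (if i < k then i else i + 1)"

definition collapse :: "nat \<Rightarrow> nat \<Rightarrow> nat" where
  "collapse k i = (if i < k then i else max 1 (i - 1))"

lemma skip_collapse: "i \<noteq> k \<Longrightarrow> 1 \<le> i \<Longrightarrow> 1 \<le> k \<Longrightarrow> skip k (collapse k i) = i"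
  by (auto simp: skip_def collapse_def)

lemma collapse_skip: "1 \<le> i \<Longrightarrow> collapse k (skip k i) = i"
  by (auto simp: skip_def collapse_def)

lemma map_skip_collapse:
  assumes "w \<in> lists ({1..n} - {k})" "k \<in> {1..n}"
  shows "map (skip k) (map (collapse k) w) = w"
  using assms by (induction w) (auto simp: skip_collapse)

lemma collapse_word:
  assumes "w \<in> lists ({1..n} - {k})" "k \<in> {1..n}"
  shows "map (collapse k) w \<in> lists {1..n - 1}"
proof -
  have "collapse k i \<in> {1..n - 1}" if "i \<in> {1..n} - {k}" for i
  proof -
    have "1 \<le> i" "i \<le> n" "i \<noteq> k" "1 \<le> k" "k \<le> n" using that assms(2) by auto
    then have "1 \<le> collapse k i \<and> collapse k i \<le> n - 1" unfolding collapse_def max_def by presburger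
    then show ?thesis by simp
  qed
  moreover have "set w \<subseteq> {1..n} - {k}" using assms(1) by (simp only: lists_eq_set mem_Collect_eq)
  ultimately have "collapse k ` set w \<subseteq> {1..n - 1}" by blast
  then show ?thesis by (simp only: lists_eq_set mem_Collect_eq set_map)
qed

lemma skip_word:
  assumes "w \<in> lists {1..n - 1}"
  shows "map (skip k) w \<in> lists ({1..n} - {k})"
proof -
  have skip: "skip k i \<in> {1..n} - {k}" if "i \<in> {1..n - 1}" for i
  proof -
    have "1 \<le> i" "i \<le> n - 1" using that by auto
    then have "1 \<le> skip k i \<and> skip k i \<le> n \<and> skip k i \<noteq> k" unfolding skip_def by presburger
    then show ?thesis by simp
  qed
  have "set w \<subseteq> {1..n - 1}" using assms(1) by (simp only: lists_eq_set mem_Collect_eq)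
  then have "skip k ` set w \<subseteq> {1..n} - {k}" by (intro image_subsetI skip) (rule subsetD)
  then show ?thesis by (simp only: lists_eq_set mem_Collect_eq set_map)
qed

text \<open>
  Words without \<open>k\<close> are congruent if and only if the relabelled words are, since both relabellings
  respect congruence.  For \<open>n = 1\<close> there is no target for \<open>collapse k\<close>, but then the words are empty.
\<close>

lemma collapse_cong_iff:
  assumes k: "k \<in> {1..n}" and u: "u \<in> lists ({1..n} - {k})" and w: "w \<in> lists ({1..n} - {k})"
  shows "(map (collapse k) u, map (collapse k) w) \<in> presented_cong {1..n - 1} (chinese_relations (n - 1))
    \<longleftrightarrow> (u, w) \<in> presented_cong {1..n} (chinese_relations n)"
proof
  assume "(map (collapse k) u, map (collapse k) w) \<in> presented_cong {1..n - 1} (chinese_relations (n - 1))"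
  then have "(map (skip k) (map (collapse k) u), map (skip k) (map (collapse k) w))
      \<in> presented_cong {1..n} (chinese_relations n)"
    by (rule map_presented_cong) (use k in \<open>auto simp: skip_def\<close>)
  then show "(u, w) \<in> presented_cong {1..n} (chinese_relations n)"
    unfolding map_skip_collapse[OF u k] map_skip_collapse[OF w k] .
next
  assume uw: "(u, w) \<in> presented_cong {1..n} (chinese_relations n)"
  show "(map (collapse k) u, map (collapse k) w) \<in> presented_cong {1..n - 1} (chinese_relations (n - 1))"
  proof (cases "n = 1")
    case True
    then have "lists ({1..n} - {k}) = {[]}" using k by simp
    then have "u = []" "w = []" using u w by simp_all
    then show ?thesis by (simp add: pc_refl)
  next
    case False
    show ?thesis
      by (rule map_presented_cong[OF uw]) (use k False in \<open>auto simp: collapse_def\<close>)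
  qed
qed

text \<open>The hull in the definition of the submonoid consists of the classes of words without \<open>k\<close>.\<close>

lemma carrier_chinese_submonoid:
  assumes "k \<in> {1..n}"
  shows "carrier (chinese_submonoid n k) = word_class n ` lists ({1..n} - {k})"
proof -
  let ?M = "chinese_monoid n" and ?H = "word_class n ` lists ({1..n} - {k})"
  have sub: "lists ({1..n} - {k}) \<subseteq> lists {1..n}" by auto
  have H: "submonoid ?H ?M"
  proof (rule submonoid.intro)
    show "?H \<subseteq> carrier ?M" using sub unfolding carrier_chinese_monoid by blast
    show "\<one>\<^bsub>?M\<^esub> \<in> ?H" unfolding one_chinese_monoid by (intro imageI) simp
    fix x y assume "x \<in> ?H" "y \<in> ?H"
    then obtain u w where "u \<in> lists ({1..n} - {k})" "w \<in> lists ({1..n} - {k})"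
      "x = word_class n u" "y = word_class n w" by blast
    moreover from this have "u \<in> lists {1..n}" "w \<in> lists {1..n}" using sub by auto
    ultimately show "x \<otimes>\<^bsub>?M\<^esub> y \<in> ?H" by (simp add: mult_word_class)
  qed
  have gens: "chinese_gen n ` ({1..n} - {k}) \<subseteq> ?H"
  proof (rule image_subsetI)
    show "chinese_gen n i \<in> ?H" if "i \<in> {1..n} - {k}" for i
      unfolding chinese_gen_word_class using that by (intro imageI) simp
  qed
  have least: "?H \<subseteq> T" if T: "submonoid T ?M" "chinese_gen n ` ({1..n} - {k}) \<subseteq> T" for T
  proof (rule image_subsetI)
    fix w assume "w \<in> lists ({1..n} - {k})"
    then show "word_class n w \<in> T"
    proof (induction w)
      case Nil
      then show ?case using submonoid.one_closed[OF T(1)] by (simp add: one_chinese_monoid)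
    next
      case (Cons i w)
      then have "word_class n (i # w) = chinese_gen n i \<otimes>\<^bsub>?M\<^esub> word_class n w"
        unfolding chinese_gen_word_class by (subst mult_word_class) auto
      moreover have "chinese_gen n i \<in> T" using T(2) Cons.hyps by blast
      ultimately show ?case using submonoid.m_closed[OF T(1)] Cons.IH by simp
    qed
  qed
  have "(\<lambda>H. submonoid H ?M) hull (chinese_gen n ` ({1..n} - {k})) = ?H"
    using gens H by (rule hull_unique) (rule least)
  then show ?thesis unfolding chinese_submonoid_def by simp
qed

lemma mult_chinese_submonoid: "x \<otimes>\<^bsub>chinese_submonoid n k\<^esub> y = x \<otimes>\<^bsub>chinese_monoid n\<^esub> y"
  by (simp add: chinese_submonoid_def)

theorem chinese_submonoid_iso:
  assumes k: "k \<in> {1..n}"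
  shows "chinese_submonoid n k \<cong> chinese_monoid (n - 1)"
proof -
  let ?I = "lists ({1..n} - {k})"
  define h where "h X = word_class (n - 1) (map (collapse k) (SOME w. w \<in> X \<and> w \<in> ?I))" for X
  have sub: "w \<in> lists {1..n}" if "w \<in> ?I" for w using that by auto
  have h: "h (word_class n u) = word_class (n - 1) (map (collapse k) u)" if u: "u \<in> ?I" for u
  proof -
    have "\<exists>w. w \<in> word_class n u \<and> w \<in> ?I" using word_class_self[OF sub[OF u]] u by blast
    then have *: "(SOME w. w \<in> word_class n u \<and> w \<in> ?I) \<in> word_class n u \<and>
        (SOME w. w \<in> word_class n u \<and> w \<in> ?I) \<in> ?I" by (rule someI_ex)
    define v where "v = (SOME w. w \<in> word_class n u \<and> w \<in> ?I)"
    have v: "(u, v) \<in> presented_cong {1..n} (chinese_relations n)" "v \<in> ?I"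
      using * unfolding v_def mem_word_class by blast+
    then have "(map (collapse k) u, map (collapse k) v) \<in> presented_cong {1..n - 1} (chinese_relations (n - 1))"
      using collapse_cong_iff[OF k u v(2)] by blast
    then have "word_class (n - 1) (map (collapse k) u) = word_class (n - 1) (map (collapse k) v)"
      by (subst word_class_eq_iff[OF collapse_word[OF u k] collapse_word[OF v(2) k]])
    then show ?thesis unfolding h_def v_def by (rule sym)
  qed
  have "h \<in> hom (chinese_submonoid n k) (chinese_monoid (n - 1))"
    unfolding hom_def carrier_chinese_submonoid[OF k] carrier_chinese_monoid mult_chinese_submonoid
  proof (intro CollectI conjI ballI Pi_I)
    fix X assume "X \<in> word_class n ` ?I"
    then obtain u where u: "u \<in> ?I" "X = word_class n u" by blast
    show "h X \<in> word_class (n - 1) ` lists {1..n - 1}"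
      unfolding u(2) h[OF u(1)] using collapse_word[OF u(1) k] by (rule imageI)
    fix Y assume "Y \<in> word_class n ` ?I"
    then obtain w where w: "w \<in> ?I" "Y = word_class n w" by blast
    have "u @ w \<in> ?I" using u(1) w(1) by simp
    then show "h (X \<otimes>\<^bsub>chinese_monoid n\<^esub> Y) = h X \<otimes>\<^bsub>chinese_monoid (n - 1)\<^esub> h Y"
      unfolding u(2) w(2) mult_word_class[OF sub[OF u(1)] sub[OF w(1)]] h[OF u(1)] h[OF w(1)]
        mult_word_class[OF collapse_word[OF u(1) k] collapse_word[OF w(1) k]]
      using h by simp
  qed
  moreover have "bij_betw h (carrier (chinese_submonoid n k)) (carrier (chinese_monoid (n - 1)))"
    unfolding bij_betw_def
  proof
    show "inj_on h (carrier (chinese_submonoid n k))"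
      unfolding carrier_chinese_submonoid[OF k]
    proof (rule inj_onI)
      fix X Y assume XY: "X \<in> word_class n ` ?I" "Y \<in> word_class n ` ?I" and eq: "h X = h Y"
      then obtain u w where uw: "u \<in> ?I" "w \<in> ?I" and X: "X = word_class n u" and Y: "Y = word_class n w"
        by blast
      show "X = Y"
        using eq unfolding X Y h[OF uw(1)] h[OF uw(2)] word_class_eq_iff[OF sub[OF uw(1)] sub[OF uw(2)]]
          word_class_eq_iff[OF collapse_word[OF uw(1) k] collapse_word[OF uw(2) k]]
          collapse_cong_iff[OF k uw(1,2)] by simp
    qed
    show "h ` carrier (chinese_submonoid n k) = carrier (chinese_monoid (n - 1))"
      unfolding carrier_chinese_submonoid[OF k] carrier_chinese_monoid
    proof (intro equalityI subsetI)
      fix X assume "X \<in> h ` word_class n ` ?I"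
      then obtain u where u: "u \<in> ?I" "X = h (word_class n u)" by blast
      show "X \<in> word_class (n - 1) ` lists {1..n - 1}"
        unfolding u(2) h[OF u(1)] using collapse_word[OF u(1) k] by (rule imageI)
    next
      fix X assume "X \<in> word_class (n - 1) ` lists {1..n - 1}"
      then obtain w where w: "w \<in> lists {1..n - 1}" "X = word_class (n - 1) w" by blast
      have "map (collapse k) (map (skip k) w) = w"
        using w(1) by (induction w) (auto simp: collapse_skip)
      then have "X = h (word_class n (map (skip k) w))"
        using h[OF skip_word[OF w(1)]] w(2) by simp
      then show "X \<in> h ` word_class n ` ?I" using skip_word[OF w(1)] by blast
    qed
  qed
  ultimately show ?thesis unfolding is_iso_def iso_def by blast
qed

section \<open>Simple modules over the Chinese algebra\<close>

context left_module
begin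

lemma smult_zero: assumes "x \<in> carrier M" shows "\<zero>\<^bsub>R\<^esub> \<odot>\<^bsub>M\<^esub> x = \<zero>\<^bsub>M\<^esub>"
proof -
  let ?z = "\<zero>\<^bsub>R\<^esub> \<odot>\<^bsub>M\<^esub> x"
  have z: "?z \<in> carrier M" using assms by blast
  have "?z \<oplus>\<^bsub>M\<^esub> ?z = ?z"
    using smult_l_distr[OF R.zero_closed R.zero_closed assms] by (simp only: R.l_zero[OF R.zero_closed])
  then show ?thesis using M.add.r_cancel_one[OF z z] by blast
qed

lemma smult_minus_one:
  assumes "x \<in> carrier M"
  shows "(\<ominus>\<^bsub>R\<^esub> \<one>\<^bsub>R\<^esub>) \<odot>\<^bsub>M\<^esub> x = \<ominus>\<^bsub>M\<^esub> x"
proof -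
  have "(\<ominus>\<^bsub>R\<^esub> \<one>\<^bsub>R\<^esub>) \<odot>\<^bsub>M\<^esub> x \<oplus>\<^bsub>M\<^esub> x = \<zero>\<^bsub>M\<^esub>"
    using smult_l_distr[OF R.a_inv_closed[OF R.one_closed] R.one_closed assms]
    unfolding R.l_neg[OF R.one_closed] smult_zero[OF assms] smult_one[OF assms] by (rule sym)
  then show ?thesis
    using assms by (intro M.minus_equality[symmetric] smult_closed R.a_inv_closed R.one_closed)
qed

lemma smult_minus_eq_zero_iff:
  assumes "a \<in> carrier R" "b \<in> carrier R" "x \<in> carrier M"
  shows "(a \<ominus>\<^bsub>R\<^esub> b) \<odot>\<^bsub>M\<^esub> x = \<zero>\<^bsub>M\<^esub> \<longleftrightarrow> a \<odot>\<^bsub>M\<^esub> x = b \<odot>\<^bsub>M\<^esub> x"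
proof -
  let ?d = "(a \<ominus>\<^bsub>R\<^esub> b) \<odot>\<^bsub>M\<^esub> x"
  have d: "a \<ominus>\<^bsub>R\<^esub> b \<in> carrier R" using assms by (intro R.minus_closed)
  have D: "?d \<in> carrier M" "b \<odot>\<^bsub>M\<^esub> x \<in> carrier M" using d assms by blast+
  have "(a \<ominus>\<^bsub>R\<^esub> b) \<oplus>\<^bsub>R\<^esub> b = a"
    using assms unfolding R.minus_eq by (simp add: R.a_assoc R.l_neg)
  then have eq: "a \<odot>\<^bsub>M\<^esub> x = ?d \<oplus>\<^bsub>M\<^esub> b \<odot>\<^bsub>M\<^esub> x"
    using smult_l_distr[OF d assms(2,3)] by simp
  show ?thesis unfolding eq using M.add.r_cancel_one[OF D(2,1)] by blast
qed

lemma submodule_if_closed: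
  assumes "N \<subseteq> carrier M" "\<zero>\<^bsub>M\<^esub> \<in> N" "\<And>x y. x \<in> N \<Longrightarrow> y \<in> N \<Longrightarrow> x \<oplus>\<^bsub>M\<^esub> y \<in> N"
    and "\<And>a x. a \<in> carrier R \<Longrightarrow> x \<in> N \<Longrightarrow> a \<odot>\<^bsub>M\<^esub> x \<in> N"
  shows "submodule N R M"
proof (intro submodule.intro subgroup.intro submodule_axioms.intro)
  fix x assume x: "x \<in> N"
  have "\<ominus>\<^bsub>M\<^esub> x \<in> N"
    using assms(4)[of "\<ominus>\<^bsub>R\<^esub> \<one>\<^bsub>R\<^esub>" x] smult_minus_one x assms(1) by auto
  then show "inv\<^bsub>add_monoid M\<^esub> x \<in> N" by (simp add: a_inv_def)
qed (use assms in auto)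

end

abbreviation fun_scale :: "'k \<Rightarrow> ('m \<Rightarrow> 'k) \<Rightarrow> 'm \<Rightarrow> 'k::times" where
  "fun_scale c f \<equiv> (\<lambda>x. c * f x)"

lemma uncountable_vector_space_fun_scale:
  assumes "uncountable (UNIV :: 'k::alg_closed_field set)"
  shows "uncountable_vector_space (fun_scale :: 'k \<Rightarrow> ('m \<Rightarrow> 'k) \<Rightarrow> 'm \<Rightarrow> 'k)"
  by unfold_locales (auto simp: fun_eq_iff algebra_simps assms)

locale simple_chinese_module =
  fixes n :: nat and V :: "(nat list set \<Rightarrow> 'k::alg_closed_field, 'v) module"
  assumes uncountable: "uncountable (UNIV :: 'k set)" and n: "1 \<le> n"
    and simple: "simple_left_module (chinese_algebra n) V"
begin

abbreviation R :: "(nat list set \<Rightarrow> 'k) ring" where "R \<equiv> chinese_algebra n"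

abbreviation gen :: "nat \<Rightarrow> nat list set \<Rightarrow> 'k" where "gen i \<equiv> single (word_class n [i]) 1"

abbreviation scal :: "'k \<Rightarrow> nat list set \<Rightarrow> 'k" where "scal c \<equiv> single (word_class n []) c"

sublocale left_module R V
  using simple by (simp add: simple_left_module_def)

lemma word_class_carrier: "w \<in> lists {1..n} \<Longrightarrow> word_class n w \<in> carrier (chinese_monoid n)"
  unfolding carrier_chinese_monoid by (rule imageI)

lemma gen_R [simp]: "i \<in> {1..n} \<Longrightarrow> gen i \<in> carrier R"
  by (intro single_carrier word_class_carrier) simp

lemma scal_R [simp]: "scal c \<in> carrier R"
  by (intro single_carrier word_class_carrier) simp

lemma single_word_mult:
  assumes "u \<in> lists {1..n}" "w \<in> lists {1..n}"
  shows "single (word_class n u) c \<otimes>\<^bsub>R\<^esub> single (word_class n w) d = single (word_class n (u @ w)) (c * d :: 'k)"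
  unfolding single_mult mult_word_class[OF assms] ..

lemma scal_mult: "f \<in> carrier R \<Longrightarrow> scal c \<otimes>\<^bsub>R\<^esub> f = (\<lambda>x. c * f x)"
  using scalar_mult[OF monoid_chinese_monoid] by (simp add: one_chinese_monoid)

lemma one_R: "\<one>\<^bsub>R\<^esub> = scal 1"
  by (simp add: one_monoid_algebra one_chinese_monoid)

text \<open>The algebra is generated by the scalars and the generators of the monoid.\<close>

lemma algebra_induct [consumes 1, case_names zero add mult scal gen]:
  assumes f: "f \<in> carrier R" and zero: "P 0"
    and add: "\<And>f g. \<lbrakk>f \<in> carrier R; g \<in> carrier R; P f; P g\<rbrakk> \<Longrightarrow> P (f + g)"
    and mult: "\<And>f g. \<lbrakk>f \<in> carrier R; g \<in> carrier R; P f; P g\<rbrakk> \<Longrightarrow> P (f \<otimes>\<^bsub>R\<^esub> g)"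
    and scal: "\<And>c. P (scal c)" and gen: "\<And>i. i \<in> {1..n} \<Longrightarrow> P (gen i)"
  shows "P f"
  using f
proof (induction rule: monoid_algebra_induct)
  case (single m c)
  then obtain w where w: "w \<in> lists {1..n}" "m = word_class n w"
    unfolding carrier_chinese_monoid by blast
  have "P (single (word_class n w) c)" using w(1)
  proof (induction w)
    case (Cons i w)
    have "single (word_class n (i # w)) c = gen i \<otimes>\<^bsub>R\<^esub> single (word_class n w) c"
      using single_word_mult[of "[i]" w 1 c] Cons.hyps by simp
    moreover have "single (word_class n w) c \<in> carrier R"
      using Cons.hyps(2) by (intro single_carrier word_class_carrier)
    ultimately show ?case using mult[of "gen i"] gen[of i] Cons by simp
  qed (rule scal)
  then show ?case using w by simp
next
  case zero
  show ?case by (rule assms(2))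
next
  case (add f g)
  then show ?case by (rule assms(3))
qed

sublocale vs: uncountable_vector_space "fun_scale :: 'k \<Rightarrow> (nat list set \<Rightarrow> 'k) \<Rightarrow> nat list set \<Rightarrow> 'k"
  by (rule uncountable_vector_space_fun_scale[OF uncountable])

lemma subspace_R: "vs.subspace (carrier R)"
proof (rule vs.subspaceI)
  show "0 \<in> carrier R" using R.zero_closed by (simp only: zero_monoid_algebra)
  show "f + g \<in> carrier R" if "f \<in> carrier R" "g \<in> carrier R" for f g
    using that by (rule add_carrier)
  show "fun_scale c f \<in> carrier R" if "f \<in> carrier R" for c f
    using that by (rule scale_carrier)
qed

lemma simpleD:
  assumes "N \<subseteq> carrier V" "\<zero>\<^bsub>V\<^esub> \<in> N" "\<And>x y. x \<in> N \<Longrightarrow> y \<in> N \<Longrightarrow> x \<oplus>\<^bsub>V\<^esub> y \<in> N"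
    and "\<And>a x. a \<in> carrier R \<Longrightarrow> x \<in> N \<Longrightarrow> a \<odot>\<^bsub>V\<^esub> x \<in> N"
  shows "N = {\<zero>\<^bsub>V\<^esub>} \<or> N = carrier V"
  using submodule_if_closed[OF assms] simple unfolding simple_left_module_def by blast

lemma smult_add: "\<lbrakk>f \<in> carrier R; g \<in> carrier R; v \<in> carrier V\<rbrakk> \<Longrightarrow>
    (f + g) \<odot>\<^bsub>V\<^esub> v = f \<odot>\<^bsub>V\<^esub> v \<oplus>\<^bsub>V\<^esub> g \<odot>\<^bsub>V\<^esub> v"
  using smult_l_distr[of f g v] by (simp add: add_monoid_algebra)

lemma smult_0: "v \<in> carrier V \<Longrightarrow> 0 \<odot>\<^bsub>V\<^esub> v = \<zero>\<^bsub>V\<^esub>"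
  using smult_zero by (simp add: zero_monoid_algebra)

lemma smult_zero_right: "f \<in> carrier R \<Longrightarrow> f \<odot>\<^bsub>V\<^esub> \<zero>\<^bsub>V\<^esub> = \<zero>\<^bsub>V\<^esub>"
proof -
  let ?z = "f \<odot>\<^bsub>V\<^esub> \<zero>\<^bsub>V\<^esub>"
  assume f: "f \<in> carrier R"
  then have z: "?z \<in> carrier V" by blast
  have "?z \<oplus>\<^bsub>V\<^esub> ?z = ?z"
    using smult_r_distr[OF f M.zero_closed M.zero_closed] by (simp only: M.l_zero[OF M.zero_closed])
  then show "?z = \<zero>\<^bsub>V\<^esub>" using M.add.r_cancel_one[OF z z] by blast
qed

lemma single_smult:
  assumes "i \<in> {1..n}" "v \<in> carrier V"
  shows "single (word_class n [i]) c \<odot>\<^bsub>V\<^esub> v = scal c \<odot>\<^bsub>V\<^esub> (gen i \<odot>\<^bsub>V\<^esub> v)"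
proof -
  have "single (word_class n [i]) c = scal c \<otimes>\<^bsub>R\<^esub> gen i"
    using single_word_mult[of "[]" "[i]" c 1] assms by simp
  then show ?thesis using smult_assoc[of "scal c" "gen i" v] assms by simp
qed

section \<open>Restriction to a submonoid\<close>

lemma scal_smult_scal: "v \<in> carrier V \<Longrightarrow> scal c \<odot>\<^bsub>V\<^esub> (scal d \<odot>\<^bsub>V\<^esub> v) = scal (c * d) \<odot>\<^bsub>V\<^esub> v"
  using smult_assoc[of "scal c" "scal d" v] single_word_mult[of "[]" "[]" c d] by simp

text \<open>
  The word \<open>m\<close> is empty if \<open>a\<^sub>k\<close> acts as a scalar, and otherwise consists of one neighbour of \<open>k\<close>.
\<close>

lemma exceptional_redundant_generator:
  assumes "x \<in> exceptional_elements n" "\<And>v. v \<in> carrier V \<Longrightarrow> x \<odot>\<^bsub>V\<^esub> v = \<zero>\<^bsub>V\<^esub>"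
  obtains k m d where "k \<in> {1..n}" "\<And>v. v \<in> carrier V \<Longrightarrow> gen k \<odot>\<^bsub>V\<^esub> v = single (word_class n m) d \<odot>\<^bsub>V\<^esub> v"
    "m \<in> lists ({1..n} - {k})"
proof -
  from assms(1)[unfolded exceptional_elements_def chinese_gen_word_class one_chinese_monoid]
  show ?thesis
  \<comment> \<open>The first kind of element is \<open>a\<^sub>i - c\<close>, the second \<open>c a\<^sub>j - d
    a\<^bsub>j-1\<^esub>\<close>; there the generator with nonzero coefficient is redundant.\<close>
  proof (elim UnE CollectE exE conjE)
    fix i c assume x: "x = gen i \<ominus>\<^bsub>R\<^esub> scal c" and i: "i \<in> {1..n}"
    show ?thesis
    proof (rule that[OF i])
      show "gen i \<odot>\<^bsub>V\<^esub> v = scal c \<odot>\<^bsub>V\<^esub> v" if "v \<in> carrier V" for v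
        using smult_minus_eq_zero_iff[OF gen_R[OF i] scal_R that] assms(2)[OF that] unfolding x by blast
    qed simp
  next
    fix j c d assume x: "x = single (word_class n [j]) c \<ominus>\<^bsub>R\<^esub> single (word_class n [j - 1]) d"
      and j2: "j \<in> {2..n}" and cd: "(c, d) \<noteq> (0, 0)"
    have j: "j \<in> {1..n}" "j - 1 \<in> {1..n}" "j \<noteq> j - 1" using j2 by auto
    have R: "single (word_class n [j]) c \<in> carrier R" "single (word_class n [j - 1]) d \<in> carrier R"
      by (rule single_carrier[OF word_class_carrier], use j in simp)+
    have eq: "scal c \<odot>\<^bsub>V\<^esub> (gen j \<odot>\<^bsub>V\<^esub> v) = scal d \<odot>\<^bsub>V\<^esub> (gen (j - 1) \<odot>\<^bsub>V\<^esub> v)" if "v \<in> carrier V" for v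
      using smult_minus_eq_zero_iff[OF R that] assms(2)[OF that]
      unfolding x single_smult[OF j(1) that, of c] single_smult[OF j(2) that, of d] by blast
    have solve: "gen i \<odot>\<^bsub>V\<^esub> v = single (word_class n [i']) (inverse b * b') \<odot>\<^bsub>V\<^esub> v"
      if i: "i \<in> {1..n}" and i': "i' \<in> {1..n}" and b: "b \<noteq> 0" and v: "v \<in> carrier V"
        and eq: "scal b \<odot>\<^bsub>V\<^esub> (gen i \<odot>\<^bsub>V\<^esub> v) = scal b' \<odot>\<^bsub>V\<^esub> (gen i' \<odot>\<^bsub>V\<^esub> v)" for i i' b b' v
    proof -
      have gv: "gen i \<odot>\<^bsub>V\<^esub> v \<in> carrier V" "gen i' \<odot>\<^bsub>V\<^esub> v \<in> carrier V"
        using gen_R[OF i] gen_R[OF i'] v by blast+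
      have "gen i \<odot>\<^bsub>V\<^esub> v = scal (inverse b * b) \<odot>\<^bsub>V\<^esub> (gen i \<odot>\<^bsub>V\<^esub> v)"
        using b gv(1) by (simp add: one_R[symmetric])
      also have "\<dots> = scal (inverse b) \<odot>\<^bsub>V\<^esub> (scal b \<odot>\<^bsub>V\<^esub> (gen i \<odot>\<^bsub>V\<^esub> v))"
        using scal_smult_scal[OF gv(1)] by (rule sym)
      also have "\<dots> = scal (inverse b * b') \<odot>\<^bsub>V\<^esub> (gen i' \<odot>\<^bsub>V\<^esub> v)"
        unfolding eq using gv(2) by (rule scal_smult_scal)
      also have "\<dots> = single (word_class n [i']) (inverse b * b') \<odot>\<^bsub>V\<^esub> v"
        using single_smult[OF i' v] by (rule sym)
      finally show ?thesis .
    qed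
    show ?thesis
    proof (cases "c = 0")
      case False
      show ?thesis
      proof (rule that[OF j(1)])
        show "gen j \<odot>\<^bsub>V\<^esub> v = single (word_class n [j - 1]) (inverse c * d) \<odot>\<^bsub>V\<^esub> v"
          if "v \<in> carrier V" for v
          using solve[OF j(1,2) False that eq[OF that]] .
        show "[j - 1] \<in> lists ({1..n} - {j})" using j by simp
      qed
    next
      case True
      then have d: "d \<noteq> 0" using cd by simp
      show ?thesis
      proof (rule that[OF j(2)])
        show "gen (j - 1) \<odot>\<^bsub>V\<^esub> v = single (word_class n [j]) (inverse d * c) \<odot>\<^bsub>V\<^esub> v"
          if "v \<in> carrier V" for v
          using solve[OF j(2,1) d that eq[OF that, symmetric]] .
        show "[j] \<in> lists ({1..n} - {j - 1})" using j by simp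
      qed
    qed
  qed
qed

text \<open>
  Every element of the algebra acts like an element of the smaller algebra, since this is true for the
  generators.  So both algebras have the same submodules in \<open>V\<close>.
\<close>

lemma simple_over_submonoid:
  assumes k: "k \<in> {1..n}"
    and redundant: "\<And>v. v \<in> carrier V \<Longrightarrow> gen k \<odot>\<^bsub>V\<^esub> v = single (word_class n m) d \<odot>\<^bsub>V\<^esub> v"
    and m: "m \<in> lists ({1..n} - {k})"
  shows "simple_left_module (monoid_algebra (chinese_submonoid n k)) V"
proof -
  define S where "S = (monoid_algebra (chinese_submonoid n k) :: (nat list set \<Rightarrow> 'k) ring)"
  let ?H = "word_class n ` lists ({1..n} - {k})"
  have sub: "u \<in> lists {1..n}" if "u \<in> lists ({1..n} - {k})" for u using that by auto
  have S_carrier: "carrier S = {f. finite {x. f x \<noteq> 0} \<and> {x. f x \<noteq> 0} \<subseteq> ?H}"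
    unfolding S_def carrier_monoid_algebra carrier_chinese_submonoid[OF k] ..
  have SR: "carrier S \<subseteq> carrier R"
    unfolding S_carrier carrier_monoid_algebra carrier_chinese_monoid using sub by blast
  have S_eq: "S = R\<lparr>carrier := carrier S\<rparr>"
    unfolding S_def monoid_algebra_def chinese_submonoid_def by simp
  have single_S: "single (word_class n u) c \<in> carrier S" if "u \<in> lists ({1..n} - {k})" for u c
    unfolding S_carrier using that by (auto simp: single_def)
  have mult_S: "f \<otimes>\<^bsub>R\<^esub> g \<in> carrier S" if f: "f \<in> carrier S" and g: "g \<in> carrier S" for f g
  proof -
    have "f \<otimes>\<^bsub>R\<^esub> g \<in> carrier R" using f g SR by blast
    moreover have "z \<in> ?H" if "(f \<otimes>\<^bsub>R\<^esub> g) z \<noteq> 0" for z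
    proof -
      have "(\<Sum>(x, y) | f x \<noteq> 0 \<and> g y \<noteq> 0 \<and> x \<otimes>\<^bsub>chinese_monoid n\<^esub> y = z. f x * g y) \<noteq> 0"
        using that by (simp add: monoid_algebra_def)
      then obtain x y where xy: "f x \<noteq> 0" "g y \<noteq> 0" "x \<otimes>\<^bsub>chinese_monoid n\<^esub> y = z"
        by (auto elim!: sum.not_neutral_contains_not_neutral)
      then have "x \<in> ?H" "y \<in> ?H" using f g unfolding S_carrier by blast+
      then obtain u w where u: "u \<in> lists ({1..n} - {k})" "x = word_class n u"
        and w: "w \<in> lists ({1..n} - {k})" "y = word_class n w" by blast
      have "z = word_class n (u @ w)"
        using xy(3) unfolding u(2) w(2) mult_word_class[OF sub[OF u(1)] sub[OF w(1)]] by simp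
      moreover have "u @ w \<in> lists ({1..n} - {k})" using u(1) w(1) by simp
      ultimately show ?thesis by blast
    qed
    ultimately show ?thesis unfolding S_carrier carrier_monoid_algebra by blast
  qed
  have add_S: "f + g \<in> carrier S" if "f \<in> carrier S" "g \<in> carrier S" for f g
    using that unfolding S_def by (rule add_carrier)
  have "subring (carrier S) R"
  proof (rule R.subringI[OF SR])
    show "\<one>\<^bsub>R\<^esub> \<in> carrier S" unfolding one_R by (rule single_S) simp
    show "f \<oplus>\<^bsub>R\<^esub> g \<in> carrier S" if "f \<in> carrier S" "g \<in> carrier S" for f g
      using add_S that by (simp add: add_monoid_algebra)
    show "\<ominus>\<^bsub>R\<^esub> f \<in> carrier S" if "f \<in> carrier S" for f
    proof -
      have fR: "f \<in> carrier R" using that SR by blast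
      have neg: "(\<lambda>x. - 1 * f x) \<in> carrier S" using that unfolding S_def by (rule scale_carrier)
      have "(\<lambda>x. - 1 * f x) \<oplus>\<^bsub>R\<^esub> f = \<zero>\<^bsub>R\<^esub>"
        by (simp add: add_monoid_algebra zero_monoid_algebra fun_eq_iff)
      then have "\<ominus>\<^bsub>R\<^esub> f = (\<lambda>x. - 1 * f x)"
        using fR neg SR by (intro R.minus_equality) auto
      then show ?thesis using neg by simp
    qed
  qed (rule mult_S)
  then have "ring S" unfolding S_eq[symmetric] using R.subring_is_ring S_eq by metis
  moreover have S_ops: "\<one>\<^bsub>S\<^esub> = \<one>\<^bsub>R\<^esub>" "f \<oplus>\<^bsub>S\<^esub> g = f \<oplus>\<^bsub>R\<^esub> g" "f \<otimes>\<^bsub>S\<^esub> g = f \<otimes>\<^bsub>R\<^esub> g" for f g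
    by (subst S_eq, simp)+
  ultimately have left: "left_module S V"
    using SR by (intro left_module.intro left_module_axioms.intro M.abelian_group_axioms)
      (auto simp: smult_l_distr smult_r_distr smult_assoc subset_iff)
  have replace: "\<exists>g\<in>carrier S. \<forall>v\<in>carrier V. f \<odot>\<^bsub>V\<^esub> v = g \<odot>\<^bsub>V\<^esub> v" if "f \<in> carrier R" for f
    using that
  proof (induction rule: algebra_induct)
    case zero
    have "0 \<in> carrier S" unfolding S_carrier by simp
    then show ?case by blast
  next
    case (add f f')
    then obtain g g' where g: "g \<in> carrier S" "g' \<in> carrier S"
      "\<forall>v\<in>carrier V. f \<odot>\<^bsub>V\<^esub> v = g \<odot>\<^bsub>V\<^esub> v" "\<forall>v\<in>carrier V. f' \<odot>\<^bsub>V\<^esub> v = g' \<odot>\<^bsub>V\<^esub> v" by blast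
    have gR: "g \<in> carrier R" "g' \<in> carrier R" using g(1,2) SR by blast+
    have "\<forall>v\<in>carrier V. (f + f') \<odot>\<^bsub>V\<^esub> v = (g + g') \<odot>\<^bsub>V\<^esub> v"
      using smult_add[OF add.hyps(1,2)] smult_add[OF gR] g(3,4) by simp
    then show ?case using add_S g by blast
  next
    case (mult f f')
    then obtain g g' where g: "g \<in> carrier S" "g' \<in> carrier S"
      "\<forall>v\<in>carrier V. f \<odot>\<^bsub>V\<^esub> v = g \<odot>\<^bsub>V\<^esub> v" "\<forall>v\<in>carrier V. f' \<odot>\<^bsub>V\<^esub> v = g' \<odot>\<^bsub>V\<^esub> v" by blast
    have gR: "g \<in> carrier R" "g' \<in> carrier R" using g(1,2) SR by blast+
    have "\<forall>v\<in>carrier V. (f \<otimes>\<^bsub>R\<^esub> f') \<odot>\<^bsub>V\<^esub> v = (g \<otimes>\<^bsub>R\<^esub> g') \<odot>\<^bsub>V\<^esub> v"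
    proof
      fix v assume v: "v \<in> carrier V"
      have "g' \<odot>\<^bsub>V\<^esub> v \<in> carrier V" using gR(2) v by blast
      then show "(f \<otimes>\<^bsub>R\<^esub> f') \<odot>\<^bsub>V\<^esub> v = (g \<otimes>\<^bsub>R\<^esub> g') \<odot>\<^bsub>V\<^esub> v"
        using smult_assoc[OF mult.hyps(1,2) v] smult_assoc[OF gR v] g(3,4) v by simp
    qed
    then show ?case using mult_S g by blast
  next
    case (scal c)
    then show ?case using single_S[of "[]" c] by auto
  next
    case (gen i)
    then show ?case
    proof (cases "i = k")
      case True
      then show ?thesis using single_S[OF m] redundant by blast
    next
      case False
      then show ?thesis using single_S[of "[i]" 1] gen by auto
    qed
  qed
  have "N = {\<zero>\<^bsub>V\<^esub>} \<or> N = carrier V" if N: "submodule N S V" for N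
  proof (rule simpleD)
    interpret N: submodule N S V by fact
    show "N \<subseteq> carrier V" using N.subset by simp
    show "\<zero>\<^bsub>V\<^esub> \<in> N" using N.one_closed by simp
    show "x \<oplus>\<^bsub>V\<^esub> y \<in> N" if "x \<in> N" "y \<in> N" for x y using N.m_closed[OF that] by simp
    show "f \<odot>\<^bsub>V\<^esub> x \<in> N" if f: "f \<in> carrier R" and x: "x \<in> N" for f x
    proof -
      obtain g where "g \<in> carrier S" "f \<odot>\<^bsub>V\<^esub> x = g \<odot>\<^bsub>V\<^esub> x"
        using replace[OF f] x \<open>N \<subseteq> carrier V\<close> by blast
      then show ?thesis using N.smult_closed x by simp
    qed
  qed
  then show ?thesis
    using left simple unfolding simple_left_module_def S_def by blast
qed

end

section \<open>A model of the module in a function space\<close>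

text \<open>
  The results on operators require a type that is a vector space.  As \<open>V\<close> is generated by any nonzero
  \<open>w0\<close>, it is isomorphic to the algebra modulo the annihilator of \<open>w0\<close>.  The projection \<open>p\<close> along this
  annihilator selects a complement \<open>U\<close>, on which \<open>ev f = f w0\<close> is an isomorphism onto \<open>V\<close>.
\<close>

locale simple_chinese_module_model = simple_chinese_module n V
  for n and V :: "(nat list set \<Rightarrow> 'k::alg_closed_field, 'v) module" +
  fixes w0 :: 'v and p :: "(nat list set \<Rightarrow> 'k) \<Rightarrow> nat list set \<Rightarrow> 'k"
  assumes w0: "w0 \<in> carrier V" "w0 \<noteq> \<zero>\<^bsub>V\<^esub>"
    and lin_p: "Vector_Spaces.linear fun_scale fun_scale p" and p_R: "p f \<in> carrier R"
    and p_diff: "f \<in> carrier R \<Longrightarrow> (f - p f) \<odot>\<^bsub>V\<^esub> w0 = \<zero>\<^bsub>V\<^esub>"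
    and p_null: "f \<in> carrier R \<Longrightarrow> f \<odot>\<^bsub>V\<^esub> w0 = \<zero>\<^bsub>V\<^esub> \<Longrightarrow> p f = 0"
begin

definition U :: "(nat list set \<Rightarrow> 'k) set" where "U = p ` carrier R"

definition ev :: "(nat list set \<Rightarrow> 'k) \<Rightarrow> 'v" where "ev f = f \<odot>\<^bsub>V\<^esub> w0"

text \<open>
  The inner \<open>p\<close> makes \<open>act i\<close> linear on the whole function space: the product of the algebra is linear
  only on functions of finite support, and \<open>p\<close> maps into these.  The default value \<open>0\<close> makes \<open>act i\<close>
  linear for every index.
\<close>

definition act :: "nat \<Rightarrow> (nat list set \<Rightarrow> 'k) \<Rightarrow> nat list set \<Rightarrow> 'k" where
  "act i f = (if i \<in> {1..n} then p (gen i \<otimes>\<^bsub>R\<^esub> p f) else 0)"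

lemma subspace_U: "vs.subspace U"
  unfolding U_def using lin_p subspace_R by (rule vs.subspace_image)

lemma U_R: "u \<in> U \<Longrightarrow> u \<in> carrier R"
  unfolding U_def using p_R by blast

lemma ev_V: "f \<in> carrier R \<Longrightarrow> ev f \<in> carrier V"
  unfolding ev_def using w0 by blast

lemma ev_add: "f \<in> carrier R \<Longrightarrow> g \<in> carrier R \<Longrightarrow> ev (f + g) = ev f \<oplus>\<^bsub>V\<^esub> ev g"
  unfolding ev_def by (rule smult_add[OF _ _ w0(1)])

lemma ev_mult: "f \<in> carrier R \<Longrightarrow> g \<in> carrier R \<Longrightarrow> ev (f \<otimes>\<^bsub>R\<^esub> g) = f \<odot>\<^bsub>V\<^esub> ev g"
  unfolding ev_def by (rule smult_assoc[OF _ _ w0(1)])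

lemma ev_scale: "f \<in> carrier R \<Longrightarrow> ev (fun_scale c f) = scal c \<odot>\<^bsub>V\<^esub> ev f"
  using ev_mult[of "scal c" f] scal_mult[of f c] by simp

lemma ev_zero: "ev 0 = \<zero>\<^bsub>V\<^esub>"
  unfolding ev_def using w0(1) by (rule smult_0)

lemma ev_p: assumes "f \<in> carrier R" shows "ev (p f) = ev f"
proof -
  have d: "f - p f \<in> carrier R" using vs.subspace_diff[OF subspace_R assms p_R] .
  have "ev f = ev ((f - p f) + p f)" by simp
  also have "\<dots> = ev (f - p f) \<oplus>\<^bsub>V\<^esub> ev (p f)" using d p_R by (rule ev_add)
  also have "ev (f - p f) = \<zero>\<^bsub>V\<^esub>" unfolding ev_def using assms by (rule p_diff)
  finally show ?thesis using ev_V[OF p_R] by simp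
qed

lemma p_U: assumes "u \<in> U" shows "p u = u"
proof -
  from assms obtain f where f: "f \<in> carrier R" "u = p f" unfolding U_def by blast
  have "f - p f \<in> carrier R" using vs.subspace_diff[OF subspace_R f(1) p_R] .
  then have "p (f - p f) = 0" using p_diff[OF f(1)] by (rule p_null)
  then have "p f - p (p f) = 0" by (simp only: vs.lin_diff[OF lin_p])
  then show ?thesis unfolding f(2) by (simp only: right_minus_eq)
qed

lemma ev_zero_iff: assumes "u \<in> U" shows "ev u = \<zero>\<^bsub>V\<^esub> \<longleftrightarrow> u = 0"
proof
  assume "ev u = \<zero>\<^bsub>V\<^esub>"
  then have "p u = 0" unfolding ev_def using U_R[OF assms] by (intro p_null)
  then show "u = 0" using p_U[OF assms] by simp
next
  assume u: "u = 0"
  show "ev u = \<zero>\<^bsub>V\<^esub>" unfolding u by (rule ev_zero)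
qed

lemma ev_inj: assumes "u \<in> U" "v \<in> U" "ev u = ev v" shows "u = v"
proof -
  have d: "u - v \<in> U" using assms subspace_U by (intro vs.subspace_diff)
  have "ev u = ev ((u - v) + v)" by simp
  also have "\<dots> = ev (u - v) \<oplus>\<^bsub>V\<^esub> ev v"
    using U_R[OF d] U_R[OF assms(2)] by (rule ev_add)
  finally have "ev (u - v) \<oplus>\<^bsub>V\<^esub> ev v = ev v" using assms(3) by simp
  then have "ev (u - v) = \<zero>\<^bsub>V\<^esub>"
    using M.add.r_cancel_one[OF ev_V[OF U_R[OF assms(2)]] ev_V[OF U_R[OF d]]] by blast
  then have "u - v = 0" using ev_zero_iff[OF d] by blast
  then show ?thesis by (simp only: right_minus_eq)
qed

lemma ev_surj: "ev ` U = carrier V"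
proof -
  have R: "ev ` carrier R = {\<zero>\<^bsub>V\<^esub>} \<or> ev ` carrier R = carrier V"
  proof (rule simpleD)
    show "ev ` carrier R \<subseteq> carrier V" using ev_V by blast
    show "\<zero>\<^bsub>V\<^esub> \<in> ev ` carrier R" using imageI[OF vs.subspace_0[OF subspace_R], of ev] unfolding ev_zero .
    show "x \<oplus>\<^bsub>V\<^esub> y \<in> ev ` carrier R" if xy: "x \<in> ev ` carrier R" "y \<in> ev ` carrier R" for x y
    proof -
      obtain f g where fg: "f \<in> carrier R" "g \<in> carrier R" "x = ev f" "y = ev g" using xy by blast
      then have "x \<oplus>\<^bsub>V\<^esub> y = ev (f + g)" by (simp only: ev_add)
      then show ?thesis using add_carrier[OF fg(1,2)] by blast
    qed
    show "a \<odot>\<^bsub>V\<^esub> x \<in> ev ` carrier R" if a: "a \<in> carrier R" and x: "x \<in> ev ` carrier R" for a x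
    proof -
      obtain f where f: "f \<in> carrier R" "x = ev f" using x by blast
      then have "a \<odot>\<^bsub>V\<^esub> x = ev (a \<otimes>\<^bsub>R\<^esub> f)" using a by (simp only: ev_mult)
      then show ?thesis using R.m_closed[OF a f(1)] by blast
    qed
  qed
  have "ev \<one>\<^bsub>R\<^esub> = w0" unfolding ev_def using w0(1) by simp
  then have "w0 \<in> ev ` carrier R" using imageI[OF R.one_closed, of ev] by simp
  then have "ev ` carrier R = carrier V" using R w0(2) by blast
  moreover have "ev ` U = ev ` carrier R"
    unfolding U_def image_image by (rule image_cong[OF refl]) (rule ev_p)
  ultimately show ?thesis by simp
qed

lemma mult_gen_p_R: "i \<in> {1..n} \<Longrightarrow> gen i \<otimes>\<^bsub>R\<^esub> p f \<in> carrier R"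
  using gen_R p_R by (intro R.m_closed)

lemma act_U: assumes "i \<in> {1..n}" shows "act i f \<in> U"
  unfolding act_def U_def using assms mult_gen_p_R[OF assms] by simp

lemma ev_act: assumes "i \<in> {1..n}" "u \<in> U" shows "ev (act i u) = gen i \<odot>\<^bsub>V\<^esub> ev u"
proof -
  have "ev (act i u) = ev (gen i \<otimes>\<^bsub>R\<^esub> p u)"
    unfolding act_def using assms(1) mult_gen_p_R[OF assms(1)] by (simp add: ev_p)
  also have "\<dots> = gen i \<odot>\<^bsub>V\<^esub> ev u"
    unfolding p_U[OF assms(2)] using gen_R[OF assms(1)] U_R[OF assms(2)] by (rule ev_mult)
  finally show ?thesis .
qed

lemma lin_act: "vs.lin (act i)"
proof (cases "i \<in> {1..n}")
  case False
  have act: "act i = (\<lambda>f. 0)" by (rule ext) (simp only: act_def False if_False)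
  show ?thesis unfolding act by (rule vs.linI) (simp_all add: fun_eq_iff)
next
  case True
  have "vs.lin (\<lambda>f. gen i \<otimes>\<^bsub>R\<^esub> p f)"
  proof (rule vs.linI)
    fix f g
    have "gen i \<otimes>\<^bsub>R\<^esub> (p f \<oplus>\<^bsub>R\<^esub> p g) = gen i \<otimes>\<^bsub>R\<^esub> p f \<oplus>\<^bsub>R\<^esub> gen i \<otimes>\<^bsub>R\<^esub> p g"
      using p_R p_R gen_R[OF True] by (rule R.r_distr)
    then show "gen i \<otimes>\<^bsub>R\<^esub> p (f + g) = gen i \<otimes>\<^bsub>R\<^esub> p f + gen i \<otimes>\<^bsub>R\<^esub> p g"
      unfolding vs.lin_add[OF lin_p] add_monoid_algebra .
  next
    fix c f
    have "gen i \<otimes>\<^bsub>R\<^esub> p (fun_scale c f) = gen i \<otimes>\<^bsub>R\<^esub> (scal c \<otimes>\<^bsub>R\<^esub> p f)"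
      unfolding vs.lin_scale[OF lin_p] scal_mult[OF p_R] ..
    also have "\<dots> = (gen i \<otimes>\<^bsub>R\<^esub> scal c) \<otimes>\<^bsub>R\<^esub> p f"
      using R.m_assoc[OF gen_R[OF True] scal_R p_R] by (rule sym)
    also have "gen i \<otimes>\<^bsub>R\<^esub> scal c = scal c \<otimes>\<^bsub>R\<^esub> gen i"
      using single_word_mult[of "[i]" "[]" 1 c] single_word_mult[of "[]" "[i]" c 1] True by simp
    also have "(scal c \<otimes>\<^bsub>R\<^esub> gen i) \<otimes>\<^bsub>R\<^esub> p f = scal c \<otimes>\<^bsub>R\<^esub> (gen i \<otimes>\<^bsub>R\<^esub> p f)"
      using scal_R gen_R[OF True] p_R by (rule R.m_assoc)
    also have "\<dots> = fun_scale c (gen i \<otimes>\<^bsub>R\<^esub> p f)"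
      using mult_gen_p_R[OF True] by (rule scal_mult)
    finally show "gen i \<otimes>\<^bsub>R\<^esub> p (fun_scale c f) = fun_scale c (gen i \<otimes>\<^bsub>R\<^esub> p f)" .
  qed
  from vs.lin_comp[OF lin_p this] show ?thesis
    unfolding act_def using True by simp
qed

lemma word_R: "w \<in> lists {1..n} \<Longrightarrow> single (word_class n w) (c :: 'k) \<in> carrier R"
  by (intro single_carrier word_class_carrier)

lemma act_word_U: "w \<in> lists {1..n} \<Longrightarrow> u \<in> U \<Longrightarrow> foldr act w u \<in> U"
  by (cases w) (auto intro: act_U)

lemma ev_act_word:
  "w \<in> lists {1..n} \<Longrightarrow> u \<in> U \<Longrightarrow> ev (foldr act w u) = single (word_class n w) 1 \<odot>\<^bsub>V\<^esub> ev u"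
proof (induction w)
  case Nil
  then show ?case using ev_V[OF U_R[OF Nil(2)]] by (simp add: one_R[symmetric])
next
  case (Cons i w)
  then have iw: "i \<in> {1..n}" "w \<in> lists {1..n}" "u \<in> U" by auto
  have "ev (foldr act (i # w) u) = gen i \<odot>\<^bsub>V\<^esub> ev (foldr act w u)"
    using ev_act[OF iw(1) act_word_U[OF iw(2,3)]] by simp
  also have "\<dots> = gen i \<odot>\<^bsub>V\<^esub> (single (word_class n w) 1 \<odot>\<^bsub>V\<^esub> ev u)"
    using Cons.IH iw by simp
  also have "\<dots> = (gen i \<otimes>\<^bsub>R\<^esub> single (word_class n w) 1) \<odot>\<^bsub>V\<^esub> ev u"
    using smult_assoc[OF gen_R[OF iw(1)] word_R[OF iw(2)] ev_V[OF U_R[OF iw(3)]]] by (rule sym)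
  also have "gen i \<otimes>\<^bsub>R\<^esub> single (word_class n w) 1 = single (word_class n (i # w)) 1"
    using single_word_mult[of "[i]" w 1 1] iw by simp
  finally show ?case .
qed

lemma act_word_cong:
  assumes "u \<in> lists {1..n}" "w \<in> lists {1..n}" "word_class n u = word_class n w" "v \<in> U"
  shows "foldr act u v = foldr act w v"
proof (rule ev_inj)
  show "foldr act u v \<in> U" using assms(1,4) by (rule act_word_U)
  show "foldr act w v \<in> U" using assms(2,4) by (rule act_word_U)
  show "ev (foldr act u v) = ev (foldr act w v)"
    unfolding ev_act_word[OF assms(1,4)] ev_act_word[OF assms(2,4)] assms(3) ..
qed

text \<open>The image under \<open>ev\<close> of a stable subspace is a submodule of \<open>V\<close>.\<close>

lemma act_irreducible: "vs.irreducible_on (act ` {1..n}) U"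
  unfolding vs.irreducible_on_def
proof (intro conjI allI impI)
  show "\<exists>v\<in>U. v \<noteq> 0"
  proof -
    from w0(1) have "w0 \<in> ev ` U" unfolding ev_surj .
    then obtain u where u: "u \<in> U" "w0 = ev u" by blast
    then have "u \<noteq> 0" using ev_zero_iff[OF u(1)] w0(2) by simp
    then show ?thesis using u(1) by blast
  qed
  show "\<forall>f\<in>act ` {1..n}. \<forall>v\<in>U. f v \<in> U" using act_U by blast
  fix N assume N: "vs.subspace N" "N \<subseteq> U" "\<forall>f\<in>act ` {1..n}. \<forall>v\<in>N. f v \<in> N"
  have NR: "u \<in> carrier R" if "u \<in> N" for u using that N(2) U_R by blast
  have evN: "f \<odot>\<^bsub>V\<^esub> x \<in> ev ` N" if f: "f \<in> carrier R" and x: "x \<in> ev ` N" for f x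
  proof -
    have xV: "x \<in> carrier V" if x: "x \<in> ev ` N" for x
    proof -
      obtain u where "u \<in> N" "x = ev u" using x by blast
      then show ?thesis using ev_V[OF NR] by simp
    qed
    have "\<forall>x\<in>ev ` N. f \<odot>\<^bsub>V\<^esub> x \<in> ev ` N"
      using f
    proof (induction rule: algebra_induct)
      case zero
      show ?case
      proof
        fix x assume "x \<in> ev ` N"
        then have "0 \<odot>\<^bsub>V\<^esub> x = ev 0" unfolding ev_zero by (intro smult_0 xV)
        then show "0 \<odot>\<^bsub>V\<^esub> x \<in> ev ` N" using imageI[OF vs.subspace_0[OF N(1)], of ev] by simp
      qed
    next
      case (add f g)
      show ?case
      proof
        fix x assume x: "x \<in> ev ` N"
        then have "f \<odot>\<^bsub>V\<^esub> x \<in> ev ` N" "g \<odot>\<^bsub>V\<^esub> x \<in> ev ` N" using add.IH by blast+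
        then obtain u v where uv: "u \<in> N" "v \<in> N" "f \<odot>\<^bsub>V\<^esub> x = ev u" "g \<odot>\<^bsub>V\<^esub> x = ev v"
          by blast
        have "(f + g) \<odot>\<^bsub>V\<^esub> x = ev (u + v)"
          using smult_add[OF add.hyps(1,2) xV[OF x]] ev_add[OF NR[OF uv(1)] NR[OF uv(2)]] uv(3,4) by simp
        then show "(f + g) \<odot>\<^bsub>V\<^esub> x \<in> ev ` N" using vs.subspace_add[OF N(1) uv(1,2)] by blast
      qed
    next
      case (mult f g)
      show ?case
      proof
        fix x assume x: "x \<in> ev ` N"
        have "f \<odot>\<^bsub>V\<^esub> (g \<odot>\<^bsub>V\<^esub> x) \<in> ev ` N" using mult.IH x by blast
        then show "(f \<otimes>\<^bsub>R\<^esub> g) \<odot>\<^bsub>V\<^esub> x \<in> ev ` N"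
          unfolding smult_assoc[OF mult.hyps(1,2) xV[OF x]] .
      qed
    next
      case (scal c)
      show ?case
      proof
        fix x assume "x \<in> ev ` N"
        then obtain u where u: "u \<in> N" "x = ev u" by blast
        then have "scal c \<odot>\<^bsub>V\<^esub> x = ev (fun_scale c u)" using ev_scale NR by simp
        then show "scal c \<odot>\<^bsub>V\<^esub> x \<in> ev ` N" using vs.subspace_scale[OF N(1) u(1)] by blast
      qed
    next
      case (gen i)
      show ?case
      proof
        fix x assume "x \<in> ev ` N"
        then obtain u where u: "u \<in> N" "x = ev u" by blast
        then have "gen i \<odot>\<^bsub>V\<^esub> x = ev (act i u)" using ev_act[OF gen] N(2) by auto
        then show "gen i \<odot>\<^bsub>V\<^esub> x \<in> ev ` N" using N(3) gen u(1) by blast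
      qed
    qed
    then show ?thesis using x by blast
  qed
  have "ev ` N = {\<zero>\<^bsub>V\<^esub>} \<or> ev ` N = carrier V"
  proof (rule simpleD)
    show "ev ` N \<subseteq> carrier V" by (intro image_subsetI ev_V NR)
    show "\<zero>\<^bsub>V\<^esub> \<in> ev ` N" using imageI[OF vs.subspace_0[OF N(1)], of ev] unfolding ev_zero .
    show "x \<oplus>\<^bsub>V\<^esub> y \<in> ev ` N" if xy: "x \<in> ev ` N" "y \<in> ev ` N" for x y
    proof -
      obtain u v where uv: "u \<in> N" "v \<in> N" "x = ev u" "y = ev v" using xy by blast
      have "x \<oplus>\<^bsub>V\<^esub> y = ev (u + v)" unfolding uv(3,4) ev_add[OF NR[OF uv(1)] NR[OF uv(2)]] ..
      then show ?thesis using vs.subspace_add[OF N(1) uv(1,2)] by blast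
    qed
  qed (rule evN)
  then show "N \<subseteq> {0} \<or> N = U"
  proof
    assume "ev ` N = {\<zero>\<^bsub>V\<^esub>}"
    then have "N \<subseteq> {0}" using ev_zero_iff N(2) by blast
    then show ?thesis by blast
  next
    assume all: "ev ` N = carrier V"
    have "U \<subseteq> N"
    proof
      fix u assume u: "u \<in> U"
      then have "ev u \<in> ev ` N" unfolding all by (intro ev_V U_R)
      then obtain v where v: "v \<in> N" "ev u = ev v" by blast
      then have "u = v" using ev_inj u N(2) by blast
      then show "u \<in> N" using v by simp
    qed
    then show ?thesis using N(2) by blast
  qed
qed (rule subspace_U)

lemma act_chinese: "chinese_operators fun_scale act 1 n U"
proof (intro chinese_operators.intro vs.uncountable_vector_space_axioms chinese_operators_axioms.intro)
  fix i j k v assume ijk: "1 \<le> i" "i \<le> j" "j \<le> k" "k \<le> n" and v: "v \<in> U"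
  have l: "[j, k, i] \<in> lists {1..n}" "[k, j, i] \<in> lists {1..n}" "[k, i, j] \<in> lists {1..n}"
    using ijk by auto
  show "act j (act k (act i v)) = act k (act j (act i v))"
    using act_word_cong[OF l(1,2) chinese_relation_cong(1)[OF ijk] v] by simp
  show "act k (act j (act i v)) = act k (act i (act j v))"
    using act_word_cong[OF l(2,3) chinese_relation_cong(2)[OF ijk] v] by simp
qed (use n lin_act act_irreducible in simp_all)

lemma exceptional_element_exists:
  assumes "vs.exceptional_on act 1 n U"
  shows "\<exists>x\<in>exceptional_elements n. \<forall>v\<in>carrier V. x \<odot>\<^bsub>V\<^esub> v = \<zero>\<^bsub>V\<^esub>"
proof -
  have lift: "\<exists>u\<in>U. v = ev u" if "v \<in> carrier V" for v using that ev_surj by blast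
  consider (scalar) i c where "i \<in> {1..n}" "\<forall>v\<in>U. act i v = fun_scale c v"
    | (proportional) j c d where "j \<in> {1<..n}" "(c, d) \<noteq> (0, 0)"
        "\<forall>v\<in>U. fun_scale c (act j v) = fun_scale d (act (j - 1) v)"
    using assms unfolding vs.exceptional_on_def by blast
  then show ?thesis
  proof cases
    case scalar
    have "(gen i \<ominus>\<^bsub>R\<^esub> scal c) \<odot>\<^bsub>V\<^esub> v = \<zero>\<^bsub>V\<^esub>" if v: "v \<in> carrier V" for v
    proof -
      obtain u where u: "u \<in> U" "v = ev u" using lift[OF v] by blast
      have "gen i \<odot>\<^bsub>V\<^esub> v = ev (act i u)" unfolding u(2) using ev_act[OF scalar(1) u(1)] by (rule sym)
      also have "\<dots> = scal c \<odot>\<^bsub>V\<^esub> v"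
        using scalar(2) u ev_scale[OF U_R[OF u(1)]] by simp
      finally show ?thesis using smult_minus_eq_zero_iff[OF gen_R[OF scalar(1)] scal_R v] by blast
    qed
    moreover have "gen i \<ominus>\<^bsub>R\<^esub> scal c \<in> exceptional_elements n"
      unfolding exceptional_elements_def chinese_gen_word_class one_chinese_monoid
      using scalar(1) by blast
    ultimately show ?thesis by blast
  next
    case proportional
    have j: "j \<in> {1..n}" "j - 1 \<in> {1..n}" "j \<in> {2..n}" using proportional(1) by auto
    have R: "single (word_class n [j]) c \<in> carrier R" "single (word_class n [j - 1]) d \<in> carrier R"
      by (rule word_R, use j in simp)+
    have "(single (word_class n [j]) c \<ominus>\<^bsub>R\<^esub> single (word_class n [j - 1]) d) \<odot>\<^bsub>V\<^esub> v = \<zero>\<^bsub>V\<^esub>"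
      if v: "v \<in> carrier V" for v
    proof -
      obtain u where u: "u \<in> U" "v = ev u" using lift[OF v] by blast
      have *: "single (word_class n [i]) b \<odot>\<^bsub>V\<^esub> v = ev (fun_scale b (act i u))" if i: "i \<in> {1..n}" for i b
        unfolding ev_scale[OF U_R[OF act_U[OF i]]] ev_act[OF i u(1)] u(2)[symmetric]
        using i v by (rule single_smult)
      have "single (word_class n [j]) c \<odot>\<^bsub>V\<^esub> v = single (word_class n [j - 1]) d \<odot>\<^bsub>V\<^esub> v"
        unfolding *[OF j(1)] *[OF j(2)] using proportional(3) u(1) by simp
      then show ?thesis using smult_minus_eq_zero_iff[OF R v] by blast
    qed
    moreover have "single (word_class n [j]) c \<ominus>\<^bsub>R\<^esub> single (word_class n [j - 1]) d \<in> exceptional_elements n"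
      unfolding exceptional_elements_def chinese_gen_word_class one_chinese_monoid
      using j(3) proportional(2) by blast
    ultimately show ?thesis by blast
  qed
qed

text \<open>
  An element of the algebra acts through words that represent its monoid elements; the module
  \<open>V(\<lambda>\<^sub>1, \<dots>, \<lambda>\<^sub>s)\<close> is defined in the same way.
\<close>

lemma ev_lincomb_words:
  assumes rep: "\<And>m. m \<in> carrier (chinese_monoid n) \<Longrightarrow> w m \<in> lists {1..n} \<and> word_class n (w m) = m"
    and f: "f \<in> carrier R" and u: "u \<in> U"
  shows "ev (vs.lincomb (\<lambda>m. foldr act (w m) u) f) = f \<odot>\<^bsub>V\<^esub> ev u"
  using f
proof (induction rule: monoid_algebra_induct)
  case zero
  have "vs.lincomb (\<lambda>m. foldr act (w m) u) 0 = 0" by (simp add: vs.lincomb_def)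
  then show ?case unfolding smult_0[OF ev_V[OF U_R[OF u]]] by (simp only: ev_zero)
next
  case (add f g)
  have fin: "finite {i. f i \<noteq> 0}" "finite {i. g i \<noteq> 0}"
    using add.hyps unfolding carrier_monoid_algebra by blast+
  have in_U: "vs.lincomb (\<lambda>m. foldr act (w m) u) h \<in> carrier R" if "h \<in> carrier R" for h
  proof (rule U_R, rule vs.lincomb_in[OF subspace_U])
    fix m assume "h m \<noteq> 0"
    then have "m \<in> carrier (chinese_monoid n)" using that unfolding carrier_monoid_algebra by blast
    then show "foldr act (w m) u \<in> U" using rep act_word_U u by blast
  qed
  have "vs.lincomb (\<lambda>m. foldr act (w m) u) (f + g) =
      vs.lincomb (\<lambda>m. foldr act (w m) u) f + vs.lincomb (\<lambda>m. foldr act (w m) u) g"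
    using vs.lincomb_add[OF fin] by (simp only: plus_fun_def)
  then show ?case
    by (simp only: ev_add[OF in_U[OF add.hyps(1)] in_U[OF add.hyps(2)]] add.IH
      smult_add[OF add.hyps(1,2) ev_V[OF U_R[OF u]]])
next
  case (single m c)
  have w: "w m \<in> lists {1..n}" "word_class n (w m) = m" using rep[OF single] by blast+
  have "ev (vs.lincomb (\<lambda>m. foldr act (w m) u) (single m c)) = scal c \<odot>\<^bsub>V\<^esub> ev (foldr act (w m) u)"
    unfolding vs.lincomb_single using U_R[OF act_word_U[OF w(1) u]] by (rule ev_scale)
  also have "\<dots> = scal c \<odot>\<^bsub>V\<^esub> (single (word_class n (w m)) 1 \<odot>\<^bsub>V\<^esub> ev u)"
    unfolding ev_act_word[OF w(1) u] ..
  also have "\<dots> = (scal c \<otimes>\<^bsub>R\<^esub> single (word_class n (w m)) 1) \<odot>\<^bsub>V\<^esub> ev u"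
    using smult_assoc[OF scal_R word_R[OF w(1)] ev_V[OF U_R[OF u]]] by (rule sym)
  also have "scal c \<otimes>\<^bsub>R\<^esub> single (word_class n (w m)) 1 = single m c"
    using single_word_mult[of "[]" "w m" c 1] w by simp
  finally show ?case .
qed

end

context simple_chinese_module_model
begin

section \<open>The classification\<close>

lemma some_representative:
  assumes "m \<in> carrier (chinese_monoid n)"
  shows "(SOME w. w \<in> m) \<in> lists {1..n} \<and> word_class n (SOME w. w \<in> m) = m"
proof -
  obtain u where u: "u \<in> lists {1..n}" "m = word_class n u"
    using assms unfolding carrier_chinese_monoid by blast
  have "(SOME w. w \<in> m) \<in> m" by (rule someI[of _ u]) (simp only: u(2) word_class_self[OF u(1)])
  then have *: "(u, SOME w. w \<in> m) \<in> presented_cong {1..n} (chinese_relations n)"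
    unfolding u(2) mem_word_class .
  then have l: "(SOME w. w \<in> m) \<in> lists {1..n}" using presented_cong_lists by blast
  have "word_class n u = word_class n (SOME w. w \<in> m)"
    using word_class_eq_iff[OF u(1) l] * by blast
  then show ?thesis using l u(2) by simp
qed

text \<open>
  The linear extension \<open>Psi\<close> of \<open>i \<mapsto> basis_vector i\<close> is a bijection onto \<open>U\<close> that intertwines \<open>V_gen\<close>
  with the generators.  Its composition with \<open>ev\<close> is the inverse of the isomorphism.
\<close>

theorem isomorphic_V_module:
  assumes ns: "n = 2 * s" and nested: "vs.nested_arcs act 1 n U mu v0"
  shows "left_module_isomorphic R V (V_module s mu)"
proof -
  \<comment> \<open>The operators themselves depend on \<open>n\<close>, so only the index bound is rewritten.\<close>
  interpret arcs: arc_operators fun_scale act s U mu v0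
    by (intro arc_operators.intro arc_operators_axioms.intro
        subst[where P = "\<lambda>t. chinese_operators fun_scale act 1 t U", OF ns act_chinese]
        subst[where P = "\<lambda>t. vs.nested_arcs act 1 t U mu v0", OF ns nested])
  define P where "P = {c :: (nat \<Rightarrow> nat) \<Rightarrow> 'k. finite {i. c i \<noteq> 0} \<and> {i. c i \<noteq> 0} \<subseteq> multi_indices s}"
  define Psi where "Psi = vs.lincomb arcs.basis_vector"
  have PI: "c \<in> P" if "finite {i. c i \<noteq> 0}" "\<And>i. c i \<noteq> 0 \<Longrightarrow> i \<in> multi_indices s" for c
    unfolding P_def using that by blast
  have fin: "finite {i. c i \<noteq> 0}" if "c \<in> P" for c using that unfolding P_def by blast
  have P_add: "(\<lambda>i. c i + d i) \<in> P" if "c \<in> P" "d \<in> P" for c d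
  proof -
    have "{i. c i + d i \<noteq> 0} \<subseteq> {i. c i \<noteq> 0} \<union> {i. d i \<noteq> 0}" by auto
    then show ?thesis using that unfolding P_def by (auto intro: finite_subset)
  qed
  have P_scale: "(\<lambda>i. a * c i) \<in> P" if "c \<in> P" for a c
  proof -
    have "{i. a * c i \<noteq> 0} \<subseteq> {i. c i \<noteq> 0}" by auto
    then show ?thesis using that unfolding P_def by (auto intro: finite_subset)
  qed
  have P_zero: "(\<lambda>i. 0) \<in> P" unfolding P_def by simp
  have Psi_zero: "Psi (\<lambda>i. 0) = 0" unfolding Psi_def vs.lincomb_def by simp
  have Psi_U: "Psi c \<in> U" for c
    unfolding Psi_def by (rule vs.lincomb_in[OF subspace_U]) (rule arcs.basis_vector_U)
  have Psi_add: "Psi (\<lambda>i. c i + d i) = Psi c + Psi d" if "c \<in> P" "d \<in> P" for c d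
    unfolding Psi_def using fin[OF that(1)] fin[OF that(2)] by (rule vs.lincomb_add)
  have Psi_inj: "c = d" if c: "c \<in> P" and d: "d \<in> P" and eq: "Psi c = Psi d" for c d
  proof (rule ccontr)
    assume "c \<noteq> d"
    then obtain i where i: "c i \<noteq> d i" by blast
    let ?X = "{i. c i \<noteq> 0} \<union> {i. d i \<noteq> 0}"
    have X: "finite ?X" "?X \<subseteq> multi_indices s" using c d unfolding P_def by blast+
    have "(\<Sum>i\<in>?X. fun_scale (c i) (arcs.basis_vector i)) = (\<Sum>i\<in>?X. fun_scale (d i) (arcs.basis_vector i))"
      using eq unfolding Psi_def
      by (subst (asm) (1 2) vs.lincomb_superset[OF X(1)]) auto
    then have "(\<Sum>i\<in>?X. fun_scale (c i - d i) (arcs.basis_vector i)) = 0"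
      by (simp only: vs.scale_left_diff_distrib sum_subtractf right_minus_eq)
    moreover have "i \<in> ?X" using i by auto
    ultimately have "c i - d i = 0" by (rule arcs.basis_vector_independent[OF X])
    then show False using i by simp
  qed
  have Psi_surj: "Psi ` P = U"
  proof
    show "Psi ` P \<subseteq> U" by (rule image_subsetI) (rule Psi_U)
    have "vs.subspace (Psi ` P)"
    proof (rule vs.subspaceI)
      show "0 \<in> Psi ` P" using imageI[OF P_zero, of Psi] unfolding Psi_zero .
      show "x + y \<in> Psi ` P" if xy: "x \<in> Psi ` P" "y \<in> Psi ` P" for x y
      proof -
        obtain c d where cd: "c \<in> P" "d \<in> P" "x = Psi c" "y = Psi d" using xy by blast
        show ?thesis using imageI[OF P_add[OF cd(1,2)], of Psi] unfolding Psi_add[OF cd(1,2)] cd(3,4) .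
      qed
      show "fun_scale a x \<in> Psi ` P" if x: "x \<in> Psi ` P" for a x
      proof -
        obtain c where c: "c \<in> P" "x = Psi c" using x by blast
        have "fun_scale a x = Psi (\<lambda>i. a * c i)"
          unfolding c(2) Psi_def by (rule vs.lincomb_scale[OF fin[OF c(1)], symmetric])
        then show ?thesis using imageI[OF P_scale[OF c(1), of a], of Psi] by simp
      qed
    qed
    moreover have "arcs.basis_vector ` multi_indices s \<subseteq> Psi ` P"
    proof (rule image_subsetI)
      fix i assume "i \<in> multi_indices s"
      then have "single i 1 \<in> P" by (intro PI) (auto simp: single_def split: if_splits)
      moreover have "Psi (single i 1) = arcs.basis_vector i"
        unfolding Psi_def vs.lincomb_single by simp
      ultimately show "arcs.basis_vector i \<in> Psi ` P" by (metis imageI)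
    qed
    ultimately have "vs.span (arcs.basis_vector ` multi_indices s) \<subseteq> Psi ` P"
      by (intro vs.span_minimal)
    then show "U \<subseteq> Psi ` P" unfolding arcs.basis_vectors_span .
  qed
  have basis: "V_gen_basis s mu j i \<in> P \<and> Psi (V_gen_basis s mu j i) = act j (arcs.basis_vector i)"
    if j: "j \<in> {1..n}" and i: "i \<in> multi_indices s" for j i
  proof (cases "j \<le> s")
    case True
    have "raise_from s j i \<in> multi_indices s"
      using i j by (auto simp: multi_indices_def raise_from_def)
    then have "single (raise_from s j i) (mu j) \<in> P"
      by (intro PI) (auto simp: single_def split: if_splits)
    moreover have "Psi (single (raise_from s j i) (mu j)) = act j (arcs.basis_vector i)"
      unfolding Psi_def vs.lincomb_single using arcs.a_first_half[of j i] True j by simp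
    ultimately show ?thesis unfolding V_gen_basis_def using True by simp
  next
    case False
    \<comment> \<open>The index \<open>j > s\<close> is the partner of \<open>q\<close>.\<close>
    define q where "q = 2 * s - j + 1"
    have q: "q \<in> {1..s}" "2 * s + 1 - q = j" using False j ns unfolding q_def by auto
    have act: "act j (arcs.basis_vector i) =
        (if positive_from s q i then arcs.basis_vector (lower_from s q i) else 0)"
      using arcs.a_second_half[OF q(1), of i] unfolding q(2) .
    have basis: "V_gen_basis s mu j i = (if positive_from s q i then single (lower_from s q i) 1 else (\<lambda>x. 0))"
      unfolding V_gen_basis_def q_def using False by simp
    show ?thesis
    proof (cases "positive_from s q i")
      case True
      have "lower_from s q i \<in> multi_indices s"
        using i q by (auto simp: multi_indices_def lower_from_def)
      then have "single (lower_from s q i) 1 \<in> P"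
        by (intro PI) (auto simp: single_def split: if_splits)
      moreover have "Psi (single (lower_from s q i) 1) = arcs.basis_vector (lower_from s q i)"
        unfolding Psi_def vs.lincomb_single by simp
      ultimately show ?thesis unfolding act basis using True by simp
    next
      case False
      show ?thesis unfolding act basis if_not_P[OF False] using P_zero Psi_zero by blast
    qed
  qed
  have gen: "V_gen s mu j c \<in> P \<and> Psi (V_gen s mu j c) = act j (Psi c)"
    if j: "j \<in> {1..n}" and c: "c \<in> P" for j c
  proof
    have supp: "i \<in> multi_indices s" if "c i \<noteq> 0" for i using c that unfolding P_def by blast
    show "V_gen s mu j c \<in> P"
    proof (rule PI)
      show "finite {i. V_gen s mu j c i \<noteq> 0}" using fin[OF c] by (rule V_gen_finite_support)
      fix x assume "V_gen s mu j c x \<noteq> 0"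
      then obtain i where "c i \<noteq> 0" "V_gen_basis s mu j i x \<noteq> 0"
        unfolding V_gen_def by (auto elim!: sum.not_neutral_contains_not_neutral)
      then show "x \<in> multi_indices s"
        using basis[OF j supp] unfolding P_def by blast
    qed
    have "Psi (V_gen s mu j c) = (\<Sum>i | c i \<noteq> 0. fun_scale (c i) (Psi (V_gen_basis s mu j i)))"
      unfolding V_gen_def Psi_def
      by (rule vs.lincomb_sum[OF fin[OF c]]) (use basis[OF j supp] fin in blast)
    also have "\<dots> = (\<Sum>i | c i \<noteq> 0. fun_scale (c i) (act j (arcs.basis_vector i)))"
      by (rule sum.cong[OF refl]) (use basis[OF j supp] in simp)
    also have "\<dots> = act j (Psi c)"
      unfolding Psi_def vs.lincomb_def by (simp only: vs.lin_sum[OF lin_act] vs.lin_scale[OF lin_act])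
    finally show "Psi (V_gen s mu j c) = act j (Psi c)" .
  qed
  have word: "V_word s mu w c \<in> P \<and> Psi (V_word s mu w c) = foldr act w (Psi c)"
    if "w \<in> lists {1..n}" "c \<in> P" for w c
    using that
  proof (induction w)
    case Nil
    then show ?case by (simp add: V_word_def)
  next
    case (Cons j w)
    have IH: "V_word s mu w c \<in> P" "Psi (V_word s mu w c) = foldr act w (Psi c)"
      using Cons.IH Cons.prems by blast+
    have "V_word s mu (j # w) c = V_gen s mu j (V_word s mu w c)" by (simp add: V_word_def)
    then show ?case using gen[OF Cons.hyps(1) IH(1)] IH(2) by simp
  qed
  have smult: "f \<odot>\<^bsub>V_module s mu\<^esub> c \<in> P \<and> ev (Psi (f \<odot>\<^bsub>V_module s mu\<^esub> c)) = f \<odot>\<^bsub>V\<^esub> ev (Psi c)"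
    if f: "f \<in> carrier R" and c: "c \<in> P" for f c
  proof
    define rep where "rep m = (SOME w. w \<in> m)" for m :: "nat list set"
    have eq: "f \<odot>\<^bsub>V_module s mu\<^esub> c = (\<lambda>i. \<Sum>m | f m \<noteq> 0. f m * V_word s mu (rep m) c i)"
      by (simp add: V_module_def rep_def)
    have f': "finite {m. f m \<noteq> 0}" "\<And>m. f m \<noteq> 0 \<Longrightarrow> m \<in> carrier (chinese_monoid n)"
      using f unfolding carrier_monoid_algebra by blast+
    have rep: "rep m \<in> lists {1..n} \<and> word_class n (rep m) = m" if "m \<in> carrier (chinese_monoid n)" for m
      unfolding rep_def using that by (rule some_representative)
    have wordP: "V_word s mu (rep m) c \<in> P" "Psi (V_word s mu (rep m) c) = foldr act (rep m) (Psi c)"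
      if "f m \<noteq> 0" for m
      using word[of "rep m" c] rep[OF f'(2)[OF that]] c by blast+
    show "f \<odot>\<^bsub>V_module s mu\<^esub> c \<in> P"
      unfolding eq
    proof (rule PI)
      have sub: "{i. (\<Sum>m | f m \<noteq> 0. f m * V_word s mu (rep m) c i) \<noteq> 0} \<subseteq>
          (\<Union>m\<in>{m. f m \<noteq> 0}. {i. V_word s mu (rep m) c i \<noteq> 0})"
        by (auto elim!: sum.not_neutral_contains_not_neutral)
      moreover have "finite (\<Union>m\<in>{m. f m \<noteq> 0}. {i. V_word s mu (rep m) c i \<noteq> 0})"
        using f'(1) by (rule finite_UN_I) (use wordP(1) fin in blast)
      ultimately show "finite {i. (\<Sum>m | f m \<noteq> 0. f m * V_word s mu (rep m) c i) \<noteq> 0}"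
        by (rule finite_subset)
      fix i assume "(\<Sum>m | f m \<noteq> 0. f m * V_word s mu (rep m) c i) \<noteq> 0"
      then obtain m where "f m \<noteq> 0" "V_word s mu (rep m) c i \<noteq> 0" using sub by blast
      then show "i \<in> multi_indices s" using wordP(1) unfolding P_def by blast
    qed
    have "Psi (f \<odot>\<^bsub>V_module s mu\<^esub> c) = (\<Sum>m | f m \<noteq> 0. fun_scale (f m) (Psi (V_word s mu (rep m) c)))"
      unfolding eq Psi_def by (rule vs.lincomb_sum[OF f'(1)]) (use wordP(1) fin in blast)
    also have "\<dots> = vs.lincomb (\<lambda>m. foldr act (rep m) (Psi c)) f"
      unfolding vs.lincomb_def by (rule sum.cong[OF refl]) (use wordP(2) in simp)
    finally show "ev (Psi (f \<odot>\<^bsub>V_module s mu\<^esub> c)) = f \<odot>\<^bsub>V\<^esub> ev (Psi c)"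
      using ev_lincomb_words[OF rep f Psi_U] by simp
  qed
  define Phi where "Phi c = ev (Psi c)" for c
  have Phi_add: "Phi (\<lambda>i. c i + d i) = Phi c \<oplus>\<^bsub>V\<^esub> Phi d" if "c \<in> P" "d \<in> P" for c d
    unfolding Phi_def Psi_add[OF that] by (intro ev_add U_R Psi_U)
  have Phi: "bij_betw Phi P (carrier V)"
    unfolding bij_betw_def
  proof
    show "inj_on Phi P"
      using ev_inj[OF Psi_U Psi_U] Psi_inj unfolding Phi_def inj_on_def by blast
    have "Phi ` P = ev ` (Psi ` P)" unfolding Phi_def by (rule image_image[symmetric])
    then show "Phi ` P = carrier V" unfolding Psi_surj ev_surj .
  qed
  define h where "h = the_inv_into P Phi"
  have carrier: "carrier (V_module s mu) = P" unfolding V_module_def P_def by simp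
  have h: "bij_betw h (carrier V) P" unfolding h_def using Phi by (rule bij_betw_the_inv_into)
  have hP: "h x \<in> P" if "x \<in> carrier V" for x using h that by (rule bij_betw_apply)
  have Phi_h: "Phi (h x) = x" if "x \<in> carrier V" for x
    unfolding h_def using Phi that by (rule f_the_inv_into_f_bij_betw)
  have h_Phi: "h (Phi c) = c" if "c \<in> P" for c
    unfolding h_def using bij_betw_imp_inj_on[OF Phi] that by (rule the_inv_into_f_f)
  show ?thesis
    unfolding left_module_isomorphic_def carrier
  proof (intro exI[of _ h] conjI ballI)
    show "bij_betw h (carrier V) P" by (rule h)
    fix x assume x: "x \<in> carrier V"
    show "h (x \<oplus>\<^bsub>V\<^esub> y) = h x \<oplus>\<^bsub>V_module s mu\<^esub> h y" if y: "y \<in> carrier V" for y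
    proof -
      have "h (x \<oplus>\<^bsub>V\<^esub> y) = h (Phi (\<lambda>i. h x i + h y i))"
        unfolding Phi_add[OF hP[OF x] hP[OF y]] Phi_h[OF x] Phi_h[OF y] ..
      also have "\<dots> = (\<lambda>i. h x i + h y i)" by (rule h_Phi[OF P_add[OF hP[OF x] hP[OF y]]])
      finally show ?thesis by (simp add: V_module_def)
    qed
    fix f assume f: "f \<in> carrier R"
    have "h (f \<odot>\<^bsub>V\<^esub> x) = h (Phi (f \<odot>\<^bsub>V_module s mu\<^esub> h x))"
      using smult[OF f hP[OF x]] Phi_h[OF x] unfolding Phi_def by simp
    also have "\<dots> = f \<odot>\<^bsub>V_module s mu\<^esub> h x" using smult[OF f hP[OF x]] by (intro h_Phi) blast
    finally show "h (f \<odot>\<^bsub>V\<^esub> x) = f \<odot>\<^bsub>V_module s mu\<^esub> h x" .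
  qed
qed

lemma isomorphic_or_exceptional:
  "(\<exists>s \<Lambda>. n = 2 * s \<and> (\<forall>j\<in>{1..s}. \<Lambda> j \<noteq> 0) \<and> left_module_isomorphic R V (V_module s \<Lambda>))
    \<or> (\<exists>x\<in>exceptional_elements n. \<forall>v\<in>carrier V. x \<odot>\<^bsub>V\<^esub> v = \<zero>\<^bsub>V\<^esub>)"
proof (cases "vs.exceptional_on act 1 n U")
  case True
  then show ?thesis using exceptional_element_exists by blast
next
  case False
  then obtain mu v0 where "odd (1 + n)" and nested: "vs.nested_arcs act 1 n U mu v0"
    using vs.nested_arcs_or_exceptional[OF act_chinese] by blast
  then obtain s where s: "n = 2 * s" by auto
  interpret arcs: arc_operators fun_scale act s U mu v0
    by (intro arc_operators.intro arc_operators_axioms.intro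
        subst[where P = "\<lambda>t. chinese_operators fun_scale act 1 t U", OF s act_chinese]
        subst[where P = "\<lambda>t. vs.nested_arcs act 1 t U mu v0", OF s nested])
  show ?thesis using isomorphic_V_module[OF s nested] arcs.arc(1) s by blast
qed

end

lemma (in simple_chinese_module) model_exists: "\<exists>w0 p. simple_chinese_module_model n V w0 p"
proof -
  obtain w0 where w0: "w0 \<in> carrier V" "w0 \<noteq> \<zero>\<^bsub>V\<^esub>"
    using simple M.zero_closed unfolding simple_left_module_def by blast
  define L where "L = {f \<in> carrier R. f \<odot>\<^bsub>V\<^esub> w0 = \<zero>\<^bsub>V\<^esub>}"
  have L: "vs.subspace L"
  proof (rule vs.subspaceI)
    show "0 \<in> L" unfolding L_def using vs.subspace_0[OF subspace_R] smult_0[OF w0(1)] by blast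
    show "f + g \<in> L" if fg: "f \<in> L" "g \<in> L" for f g
    proof -
      have c: "f \<in> carrier R" "g \<in> carrier R" using fg unfolding L_def by blast+
      have "(f + g) \<odot>\<^bsub>V\<^esub> w0 = \<zero>\<^bsub>V\<^esub> \<oplus>\<^bsub>V\<^esub> \<zero>\<^bsub>V\<^esub>"
        using smult_add[OF c w0(1)] fg unfolding L_def by simp
      then show ?thesis unfolding L_def using add_carrier[OF c] by simp
    qed
    show "fun_scale c f \<in> L" if f: "f \<in> L" for c f
    proof -
      have fR: "f \<in> carrier R" using f unfolding L_def by blast
      have "fun_scale c f \<odot>\<^bsub>V\<^esub> w0 = scal c \<odot>\<^bsub>V\<^esub> (f \<odot>\<^bsub>V\<^esub> w0)"
        using smult_assoc[OF scal_R fR w0(1), of c] unfolding scal_mult[OF fR] .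
      also have "\<dots> = \<zero>\<^bsub>V\<^esub>" using f smult_zero_right[OF scal_R] unfolding L_def by simp
      finally show ?thesis unfolding L_def using scale_carrier[OF fR, of c] by blast
    qed
  qed
  have "L \<subseteq> carrier R" unfolding L_def by blast
  from vs.projection_along[OF L subspace_R this] obtain p where p: "vs.lin p" "\<And>f. p f \<in> carrier R"
    "\<And>f. f \<in> carrier R \<Longrightarrow> f - p f \<in> L" "\<And>f. f \<in> L \<Longrightarrow> p f = 0" by blast
  have "simple_chinese_module_model n V w0 p"
    using p(3,4) unfolding L_def
    by (intro simple_chinese_module_model.intro simple_chinese_module_model_axioms.intro
        simple_chinese_module_axioms w0 p(1,2)) blast+
  then show ?thesis by blast
qed

theorem theorem3p13:
  fixes n :: nat
    and V :: "(nat list set \<Rightarrow> 'k::alg_closed_field, 'v) module"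
  assumes "uncountable (UNIV :: 'k set)"
    and "n \<ge> 1"
    and "simple_left_module (chinese_algebra n) V"
  shows "((\<exists>s \<Lambda>. n = 2 * s \<and> (\<forall>j\<in>{1..s}. \<Lambda> j \<noteq> 0) \<and>
            left_module_isomorphic (chinese_algebra n) V (V_module s \<Lambda>))
          \<or> (\<exists>x\<in>exceptional_elements n. \<forall>v\<in>carrier V. x \<odot>\<^bsub>V\<^esub> v = \<zero>\<^bsub>V\<^esub>))
       \<and> ((\<exists>x\<in>exceptional_elements n. \<forall>v\<in>carrier V. x \<odot>\<^bsub>V\<^esub> v = \<zero>\<^bsub>V\<^esub>) \<longrightarrow>
          (\<exists>k\<in>{1..n}. chinese_submonoid n k \<cong> chinese_monoid (n - 1) \<and>
             simple_left_module (monoid_algebra (chinese_submonoid n k)) V))"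
proof -
  interpret simple_chinese_module n V
    using assms by (intro simple_chinese_module.intro)
  obtain w0 p where "simple_chinese_module_model n V w0 p" using model_exists by blast
  then interpret simple_chinese_module_model n V w0 p .
  show ?thesis
  proof (intro conjI impI)
    assume "\<exists>x\<in>exceptional_elements n. \<forall>v\<in>carrier V. x \<odot>\<^bsub>V\<^esub> v = \<zero>\<^bsub>V\<^esub>"
    then obtain x where x: "x \<in> exceptional_elements n"
      and null: "\<forall>v\<in>carrier V. x \<odot>\<^bsub>V\<^esub> v = \<zero>\<^bsub>V\<^esub>" by blast
    show "\<exists>k\<in>{1..n}. chinese_submonoid n k \<cong> chinese_monoid (n - 1) \<and>
        simple_left_module (monoid_algebra (chinese_submonoid n k)) V"
    proof (rule exceptional_redundant_generator[OF x null[rule_format]])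
      fix k m d assume k: "k \<in> {1..n}"
        and "\<And>v. v \<in> carrier V \<Longrightarrow> gen k \<odot>\<^bsub>V\<^esub> v = single (word_class n m) d \<odot>\<^bsub>V\<^esub> v"
        and "m \<in> lists ({1..n} - {k})"
      then have "simple_left_module (monoid_algebra (chinese_submonoid n k)) V"
        by (rule simple_over_submonoid)
      then show ?thesis using k chinese_submonoid_iso[OF k] by blast
    qed
  qed (rule isomorphic_or_exceptional)
qed

end
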